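(* Let $\Phi$ be a thick morphism from a manifold $M_1$ to a manifold $M_2$ with generating function $S(x,q)=S_0(x)+\varphi^i(x)q_i+S^{ij}(x)q_iq_j+\cdots$ in local coordinates $x$ on $M_1$ and $y$ on $M_2$ (with conjugate momenta $p$ and $q$). For $g\in C^\infty(M_2)$, the pullback $\Phi^*[g]$, defined by $$\Phi^*[g](x)=g(\overline y)+S(x,\overline q)-\overline y^\alpha\overline q_\alpha,\qquad \overline q_\alpha=\frac{\partial g}{\partial y^\alpha}(\overline y),\quad \overline y^\alpha=\frac{\partial S}{\partial q_\alpha}(x,\overline q),$$ is given by $$\Phi^*[g](x)=\sum_{t\in T^\circ}\frac{1}{|t|_\circ!\,|t|_\bullet!}\langle S,g;t\rangle(x)=\sum_{t\in[T^\circ]}\frac{1}{|\mathrm{sym}(t)|}\langle S,g;t\rangle(x).$$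
   Context: All manifolds are ordinary (non-super). A thick morphism $\Phi$ from $M_1$ to $M_2$ is a formal canonical relation $\Phi\subset T^*M_2\times\overline{T^*M_1}$ (a Lagrangian submanifold of the formal neighbourhood of $M_2\times T^*M_1$) together with, in local coordinates, a generating function $S(x,q)$, a formal power series in $q$ with coefficients smooth in $x$ and symmetric in their indices, such that $\Phi$ is locally given by $y^i=\partial S/\partial q_i(x,q)$, $p_a=\partial S/\partial x^a(x,q)$. Only the local formulas are used in the statement. Repeated indices are summed. $S^{a_1\dots a_m}(x)$ is the coefficient of $q_{a_1}\cdots q_{a_m}$, $S^i=\varphi^i$, the coefficient without indices is $S_0$, and $\varphi(x)=(\varphi^i(x))$. The pullback is formal: $\overline y=\overline y(x)$, $\overline q=\overline q(x)$ are the unique solutions as functional power series in $g$ (replace $g$ by $\epsilon g$ and use formal power series in $\epsilon$; to zeroth order $\overline q=0$, $\overline y=\varphi(x)$, and $g(\overline y)$ is Taylor expanded at $\varphi(x)$). The expansion is an identity of such series. A bipartite graph is $t=(B_t,W_t,E_t)$ with black vertices $B_t=\{1,\dots,n\}$, white vertices $W_t=\{-1,\dots,-m\}$ and a finite multiset $E_t$ of elements of $B_t\times W_t$ (edges). A bipartite tree is a (nonempty) connected bipartite graph without cycles; $|t|_\bullet=|B_t|$, $|t|_\circ=|W_t|$. An isomorphism is a pair of permutations of the black and white vertices carrying edges to edges; $\mathrm{sym}(t)$ is the automorphism group. $T^\circ$ is the set of bipartite trees whose leaves (degree-one vertices) are all white, including the one-vertex trees $\bullet$ and $\circ$; $[T^\circ]$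 is its set of isomorphism classes. For a vertex $v$ let $e^v_1,\dots,e^v_{m_v}$ be the edges attached to $v$. Using edges as dummy summation indices, $$\langle S,g;t\rangle(x):=\Big(\prod_{v\in B_t}m_v!\,S^{e^v_1\dots e^v_{m_v}}(x)\Big)\Big(\prod_{w\in W_t}\frac{\partial}{\partial y^{e^w_1}}\cdots\frac{\partial}{\partial y^{e^w_{m_w}}}g(\varphi(x))\Big).$$ *)

theory Defs
  imports "HOL-Analysis.Analysis" "HOL-Computational_Algebra.Formal_Power_Series"
    "HOL-Combinatorics.Permutations"
begin

section \<open>Smooth functions on coordinate domains\<close>

definition partial_deriv :: "'n::finite \<Rightarrow> (real^'n \<Rightarrow> real) \<Rightarrow> real^'n \<Rightarrow> real" where
  "partial_deriv i f y = frechet_derivative f (at y) (axis i 1)"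

definition iter_partial :: "'n::finite list \<Rightarrow> (real^'n \<Rightarrow> real) \<Rightarrow> real^'n \<Rightarrow> real" where
  "iter_partial is f = foldr partial_deriv is f"

text \<open>Differentiability at every stage makes all iterated partial derivatives exist and be
  continuous; this is only used for open sets.\<close>
definition smooth_on :: "(real^'n::finite) set \<Rightarrow> (real^'n \<Rightarrow> real) \<Rightarrow> bool" where
  "smooth_on V f \<longleftrightarrow> (\<forall>is. \<forall>y\<in>V. iter_partial is f differentiable (at y))"

section \<open>Formal power series in several variables\<close>

text \<open>A formal power series in the variables \<open>q\<^sub>i\<close> is given by its coefficient tensors
  \<open>T [a\<^sub>1, \<dots>, a\<^sub>m]\<close>, standing for the sum of
  \<open>T [a\<^sub>1, \<dots>, a\<^sub>m] q\<^bsub>a\<^sub>1\<^esub> \<cdots> q\<^bsub>a\<^sub>m\<^esub>\<close> over all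
  lists of indices of all lengths.\<close>
type_synonym 'n tensor_series = "'n list \<Rightarrow> real"

text \<open>Leibniz rule on each monomial: \<open>q\<^bsub>a\<^sub>1\<^esub> \<cdots> q\<^bsub>a\<^sub>m\<^esub>\<close> arises
  once for every position at which a factor \<open>q\<^sub>i\<close> was removed.  For symmetric coefficients
  this is \<open>(m + 1) T [i, a\<^sub>1, \<dots>, a\<^sub>m]\<close>.\<close>
definition dq :: "'n \<Rightarrow> 'n tensor_series \<Rightarrow> 'n tensor_series" where
  "dq i T a = (\<Sum>j\<le>length a. T (take j a @ i # drop j a))"

text \<open>Substitution of formal power series in \<open>\<epsilon>\<close> (the variable \<^term>\<open>fps_X\<close>) without
  constant term.  The topology on \<^typ>\<open>real fps\<close> is the \<open>\<epsilon>\<close>-adic one, so the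
  sum is the formal sum.\<close>
definition subst_series :: "'n::finite tensor_series \<Rightarrow> ('n \<Rightarrow> real fps) \<Rightarrow> real fps" where
  "subst_series T q = (\<Sum>\<^sub>\<infinity>a. fps_const (T a) * (\<Prod>i\<leftarrow>a. q i))"

text \<open>The value \<open>f(y)\<close> at a formal point \<open>y = y0 + O(\<epsilon>)\<close>, by Taylor expansion
  at \<open>y0\<close>.\<close>
definition taylor_eval :: "(real^'n::finite \<Rightarrow> real) \<Rightarrow> real^'n \<Rightarrow> ('n \<Rightarrow> real fps) \<Rightarrow> real fps" where
  "taylor_eval f y0 y =
     subst_series (\<lambda>a. iter_partial a f y0 / fact (length a)) (\<lambda>i. y i - fps_const (y0 $ i))"

section \<open>Thick morphisms and their pullback, in local coordinates\<close>

text \<open>\<open>S [a\<^sub>1, \<dots>, a\<^sub>m] x\<close> is \<open>S\<^bsup>a\<^sub>1\<dots>a\<^sub>m\<^esup>(x)\<close>; thus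
  \<open>S [] = S\<^sub>0\<close> and \<open>S [i] = \<phi>\<^sup>i\<close>.\<close>
type_synonym ('m, 'n) generating_function = "'n list \<Rightarrow> real^'m \<Rightarrow> real"

definition base_map :: "('m::finite, 'n::finite) generating_function \<Rightarrow> real^'m \<Rightarrow> real^'n" where
  "base_map S x = (\<chi> i. S [i] x)"

text \<open>\<open>U\<close> and \<open>V\<close> are the coordinate domains on source and target.  Over these
  charts the thick morphism is the formal canonical relation
  \<open>y\<^sup>i = \<partial>S/\<partial>q\<^sub>i\<close>, \<open>p\<^sub>a = \<partial>S/\<partial>x\<^sup>a\<close>
  together with \<open>S\<close>, so it is determined by \<open>S\<close>.\<close>
definition thick_morphism ::
  "(real^'m::finite) set \<Rightarrow> (real^'n::finite) set \<Rightarrow> ('m, 'n) generating_function \<Rightarrow> bool" where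
  "thick_morphism U V S \<longleftrightarrow>
     open U \<and> open V \<and>
     (\<forall>a. smooth_on U (S a)) \<and>
     (\<forall>a b. mset a = mset b \<longrightarrow> S a = S b) \<and>
     base_map S ` U \<subseteq> V"

text \<open>The equations for \<open>(q, y)\<close> defining the pullback, with \<open>g\<close> replaced by
  \<open>\<epsilon> g\<close>.\<close>
definition pullback_equations ::
  "('m::finite, 'n::finite) generating_function \<Rightarrow> (real^'n \<Rightarrow> real) \<Rightarrow> real^'m \<Rightarrow>
   ('n \<Rightarrow> real fps) \<Rightarrow> ('n \<Rightarrow> real fps) \<Rightarrow> bool" where
  "pullback_equations S g x q y \<longleftrightarrow>
     (\<forall>\<alpha>. fps_nth (q \<alpha>) 0 = 0) \<and>
     (\<forall>\<alpha>. fps_nth (y \<alpha>) 0 = base_map S x $ \<alpha>) \<and>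
     (\<forall>\<alpha>. q \<alpha> = fps_X * taylor_eval (partial_deriv \<alpha> g) (base_map S x) y) \<and>
     (\<forall>\<alpha>. y \<alpha> = subst_series (dq \<alpha> (\<lambda>a. S a x)) q)"

text \<open>The functional power series \<open>\<Phi>\<^sup>*[g](x)\<close>: the coefficient of \<open>\<epsilon>\<^sup>k\<close>
  is its term of degree \<open>k\<close> in \<open>g\<close>.\<close>
definition pullback ::
  "('m::finite, 'n::finite) generating_function \<Rightarrow> (real^'n \<Rightarrow> real) \<Rightarrow> real^'m \<Rightarrow> real fps" where
  "pullback S g x =
     (let (q, y) = (THE (q, y). pullback_equations S g x q y)
      in fps_X * taylor_eval g (base_map S x) y + subst_series (\<lambda>a. S a x) q
         - (\<Sum>\<alpha>\<in>UNIV. y \<alpha> * q \<alpha>))"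

section \<open>Bipartite trees\<close>

text \<open>Black vertices are positive and white vertices negative integers, so the two vertex
  sets are disjoint.\<close>
record bigraph =
  num_black :: nat
  num_white :: nat
  edges :: "(int \<times> int) multiset"

definition black :: "bigraph \<Rightarrow> int set" where
  "black t = {1..int (num_black t)}"

definition white :: "bigraph \<Rightarrow> int set" where
  "white t = {- int (num_white t)..-1}"

definition bipartite_graph :: "bigraph \<Rightarrow> bool" where
  "bipartite_graph t \<longleftrightarrow> set_mset (edges t) \<subseteq> black t \<times> white t"

definition adjacency :: "bigraph \<Rightarrow> (int \<times> int) set" where
  "adjacency t = set_mset (edges t) \<union> (set_mset (edges t))\<inverse>"

definition connected_graph :: "bigraph \<Rightarrow> bool" where
  "connected_graph t \<longleftrightarrow>
     (\<forall>u\<in>black t \<union> white t. \<forall>v\<in>black t \<union> white t. (u, v) \<in> (adjacency t)\<^sup>*)"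

text \<open>A cycle is given by its cyclic sequence of distinct vertices; \<open>(max u v, min u v)\<close>
  puts the black end of an edge first.  Comparing multisets makes a repeated edge a cycle of
  length two, while a single edge traversed back and forth is not a cycle.\<close>
definition is_cycle :: "bigraph \<Rightarrow> int list \<Rightarrow> bool" where
  "is_cycle t vs \<longleftrightarrow>
     length vs \<ge> 2 \<and> distinct vs \<and>
     mset (map (\<lambda>(u, v). (max u v, min u v)) (zip vs (rotate1 vs))) \<subseteq># edges t"

definition bipartite_tree :: "bigraph \<Rightarrow> bool" where
  "bipartite_tree t \<longleftrightarrow>
     bipartite_graph t \<and> black t \<union> white t \<noteq> {} \<and> connected_graph t \<and> (\<nexists>vs. is_cycle t vs)"

definition incident_edges :: "bigraph \<Rightarrow> int \<Rightarrow> (int \<times> int) multiset" where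
  "incident_edges t v = {#e \<in># edges t. fst e = v \<or> snd e = v#}"

definition degree :: "bigraph \<Rightarrow> int \<Rightarrow> nat" where
  "degree t v = size (incident_edges t v)"

definition white_leaf_trees :: "bigraph set" where
  "white_leaf_trees =
     {t. bipartite_tree t \<and> (\<forall>v\<in>black t \<union> white t. degree t v = 1 \<longrightarrow> v \<in> white t)}"

definition graph_iso :: "bigraph \<Rightarrow> bigraph \<Rightarrow> (int \<Rightarrow> int) \<times> (int \<Rightarrow> int) \<Rightarrow> bool" where
  "graph_iso t t' = (\<lambda>(\<sigma>, \<tau>).
     num_black t = num_black t' \<and> num_white t = num_white t' \<and>
     \<sigma> permutes black t \<and> \<tau> permutes white t \<and>
     image_mset (map_prod \<sigma> \<tau>) (edges t) = edges t')"

definition automorphisms :: "bigraph \<Rightarrow> ((int \<Rightarrow> int) \<times> (int \<Rightarrow> int)) set" where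
  "automorphisms t = {p. graph_iso t t p}"

definition tree_iso :: "(bigraph \<times> bigraph) set" where
  "tree_iso = {(t, t'). t \<in> white_leaf_trees \<and> t' \<in> white_leaf_trees \<and> (\<exists>p. graph_iso t t' p)}"

section \<open>The expression attached to a tree\<close>

definition edge_list :: "bigraph \<Rightarrow> int \<Rightarrow> (int \<times> int) list" where
  "edge_list t v = (SOME es. mset es = incident_edges t v)"

text \<open>\<open>\<iota>\<close> runs over the values of the dummy indices attached to the edges.  It is a function
  on the set of edges because a tree has no repeated edges.\<close>
definition tree_pairing ::
  "('m::finite, 'n::finite) generating_function \<Rightarrow> (real^'n \<Rightarrow> real) \<Rightarrow> bigraph \<Rightarrow> real^'m \<Rightarrow> real" where
  "tree_pairing S g t x =
     (\<Sum>\<iota> \<in> set_mset (edges t) \<rightarrow>\<^sub>E (UNIV :: 'n set).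
        (\<Prod>v\<in>black t. fact (degree t v) * S (map \<iota> (edge_list t v)) x) *
        (\<Prod>w\<in>white t. iter_partial (map \<iota> (edge_list t w)) g (base_map S x)))"

text \<open>\<open>tree_pairing\<close> is homogeneous in \<open>g\<close> of degree the number of white vertices;
  this is its value after replacing \<open>g\<close> by \<open>\<epsilon> g\<close>.\<close>
definition tree_term ::
  "('m::finite, 'n::finite) generating_function \<Rightarrow> (real^'n \<Rightarrow> real) \<Rightarrow> bigraph \<Rightarrow> real^'m \<Rightarrow> real fps" where
  "tree_term S g t x = fps_const (tree_pairing S g t x) * fps_X ^ num_white t"

end

(* Let G_a and B_a be the generating series of trees with a white, respectively black, root that
   carries additional indices a and is not counted itself.  Differentiating in epsilon marks a
   white vertex other than the root; cutting the edge at the root towards the marked vertex gives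
     G_a' = sum_i G_{a+i} B_i'   and   B_a' = sum_i B_{a+i} (epsilon G_i)'.
   By the chain rule, the a-th derivatives of g at ybar and of S at qbar satisfy the same system
   with the same initial values, and this system determines its solution coefficient by
   coefficient.  So the trees solve the equations for (qbar, ybar), and uniquely.  The pullback is
   stationary in qbar and ybar, hence its derivative in epsilon is g(ybar) = G_{}, the series of
   trees rooted at a white vertex.  Replacing the linear part of S by 0 (and y by y - phi(x))
   discards the trees with black leaves without changing the system.  The sum over isomorphism
   classes then follows from orbit-stabilizer. *)
theory Submission imports Defs begin

text \<open>The obstacle is that epsilon counts only white vertices. If black leaves are allowed,
  trees with a given number of white vertices can have arbitrarily many black ones, and a
  coefficient would be an infinite sum. Measuring y from \<phi>(x) makes \<sigma> vanish at single
  indices; then each black vertex other than the root needs a white child of its own, so the white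
  vertices bound the black ones (\<open>rooted_eq_0\<close>). This bound is read off the recursions
  for weighted tree sums and carried over to single trees by weights that cannot cancel. The extra
  indices at the root close the system: cutting an edge there leaves its index behind as one more
  argument of the root tensor, so all orders have to be treated at once. Differentiating cuts off
  one branch at a time, so binomial coefficients suffice and no set partitions appear. Integrating
  divides by the number of white vertices, which turns the weight of a tree rooted at a fixed white
  label into the symmetric factorial weight. The constant of integration is the lone black
  vertex.\<close>

section \<open>Symmetry of iterated partial derivatives\<close>

lemma has_real_derivative_along_axis:
  fixes f :: "real^'n::finite \<Rightarrow> real"
  assumes "f differentiable (at (p + s *\<^sub>R axis i 1))"
  shows "((\<lambda>s. f (p + s *\<^sub>R axis i 1)) has_real_derivative partial_deriv i f (p + s *\<^sub>R axis i 1)) (at s)"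
proof -
  let ?D = "frechet_derivative f (at (p + s *\<^sub>R axis i 1))"
  have "(f has_derivative ?D) (at (p + s *\<^sub>R axis i 1))"
    using assms frechet_derivative_works by blast
  moreover have "((\<lambda>s. p + s *\<^sub>R axis i 1) has_derivative (\<lambda>h. h *\<^sub>R axis i 1)) (at s)"
    by (auto intro!: derivative_eq_intros)
  ultimately have "((\<lambda>s. f (p + s *\<^sub>R axis i 1)) has_derivative (\<lambda>h. ?D (h *\<^sub>R axis i 1))) (at s)"
    using has_derivative_compose[of "\<lambda>s. p + s *\<^sub>R axis i 1" _ s UNIV f ?D] by simp
  moreover have "linear ?D"
    using assms by (rule linear_frechet_derivative)
  ultimately show ?thesis
    by (simp add: has_field_derivative_def partial_deriv_def linear_scale mult_commute_abs)
qed

text \<open>The second difference of \<open>f\<close> along the axes \<open>i\<close> and \<open>j\<close> is a mixed derivative at a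
  nearby point; it is symmetric in \<open>i\<close> and \<open>j\<close>, which is why the mixed derivatives agree.\<close>
lemma second_difference_mean_value:
  fixes f :: "real^'n::finite \<Rightarrow> real"
  assumes "t > 0"
    and f: "\<And>p. p \<in> ball y (3 * t) \<Longrightarrow> f differentiable (at p)"
    and fi: "\<And>p. p \<in> ball y (3 * t) \<Longrightarrow> partial_deriv i f differentiable (at p)"
  obtains p where "p \<in> ball y (3 * t)"
    "f (y + t *\<^sub>R axis i 1 + t *\<^sub>R axis j 1) - f (y + t *\<^sub>R axis i 1)
      - f (y + t *\<^sub>R axis j 1) + f y = t\<^sup>2 * partial_deriv j (partial_deriv i f) p"
proof -
  have near: "y + s *\<^sub>R axis i 1 + r *\<^sub>R axis j 1 \<in> ball y (3 * t)"
    if "0 \<le> s" "s \<le> t" "0 \<le> r" "r \<le> t" for s r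
  proof -
    have "norm (s *\<^sub>R axis i 1 + r *\<^sub>R axis j (1::real)) \<le> s + r"
      using norm_triangle_ineq[of "s *\<^sub>R axis i 1" "r *\<^sub>R axis j (1::real)"] that by (simp add: norm_axis_1)
    also have "\<dots> < 3 * t" using that \<open>t > 0\<close> by simp
    finally show ?thesis by (simp add: dist_norm algebra_simps norm_minus_commute)
  qed
  \<comment> \<open>The second difference is \<open>u t - u 0\<close>; the mean value theorem along
    \<open>i\<close>, and then along \<open>j\<close>, turns it into a mixed derivative.\<close>
  define u where "u s = f (y + t *\<^sub>R axis j 1 + s *\<^sub>R axis i 1) - f (y + s *\<^sub>R axis i 1)" for s
  have "\<exists>s. 0 < s \<and> s < t \<and> u t - u 0 = (t - 0) *
      (partial_deriv i f (y + t *\<^sub>R axis j 1 + s *\<^sub>R axis i 1) - partial_deriv i f (y + s *\<^sub>R axis i 1))"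
  proof (rule MVT2[OF \<open>t > 0\<close>])
    fix s assume "0 \<le> s" "s \<le> t"
    then have "f differentiable (at (y + t *\<^sub>R axis j 1 + s *\<^sub>R axis i 1))"
      "f differentiable (at (y + s *\<^sub>R axis i 1))"
      using f[OF near[of s t]] f[OF near[of s 0]] \<open>t > 0\<close> by (simp_all add: add_ac)
    then show "(u has_real_derivative partial_deriv i f (y + t *\<^sub>R axis j 1 + s *\<^sub>R axis i 1)
        - partial_deriv i f (y + s *\<^sub>R axis i 1)) (at s)"
      unfolding u_def by (intro DERIV_diff has_real_derivative_along_axis)
  qed
  then obtain s where s: "0 < s" "s < t" and us: "u t - u 0 = t *
      (partial_deriv i f (y + t *\<^sub>R axis j 1 + s *\<^sub>R axis i 1) - partial_deriv i f (y + s *\<^sub>R axis i 1))"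
    by auto
  have "\<exists>r. 0 < r \<and> r < t \<and> partial_deriv i f (y + s *\<^sub>R axis i 1 + t *\<^sub>R axis j 1)
      - partial_deriv i f (y + s *\<^sub>R axis i 1 + 0 *\<^sub>R axis j 1) =
      (t - 0) * partial_deriv j (partial_deriv i f) (y + s *\<^sub>R axis i 1 + r *\<^sub>R axis j 1)"
  proof (rule MVT2[OF \<open>t > 0\<close>])
    fix r assume "0 \<le> r" "r \<le> t"
    then show "((\<lambda>r. partial_deriv i f (y + s *\<^sub>R axis i 1 + r *\<^sub>R axis j 1)) has_real_derivative
        partial_deriv j (partial_deriv i f) (y + s *\<^sub>R axis i 1 + r *\<^sub>R axis j 1)) (at r)"
      using fi[OF near[of s r]] s by (intro has_real_derivative_along_axis) auto
  qed
  then obtain r where r: "0 < r" "r < t" and "partial_deriv i f (y + s *\<^sub>R axis i 1 + t *\<^sub>R axis j 1)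
      - partial_deriv i f (y + s *\<^sub>R axis i 1) =
      t * partial_deriv j (partial_deriv i f) (y + s *\<^sub>R axis i 1 + r *\<^sub>R axis j 1)"
    by auto
  with us have "u t - u 0 = t\<^sup>2 * partial_deriv j (partial_deriv i f) (y + s *\<^sub>R axis i 1 + r *\<^sub>R axis j 1)"
    by (simp add: power2_eq_square add_ac)
  then show ?thesis
    using that[OF near[of s r]] s r by (simp add: u_def algebra_simps)
qed

text \<open>For every small t, both mixed derivatives take the same value, the second difference
  divided by t squared, at points near y. Both are continuous at y, being differentiable there, so
  their values at y cannot differ.\<close>

lemma mixed_partial_derivs_commute:
  fixes f :: "real^'n::finite \<Rightarrow> real"
  assumes "open V" "smooth_on V f" "y \<in> V"
  shows "partial_deriv i (partial_deriv j f) y = partial_deriv j (partial_deriv i f) y"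
proof (rule ccontr)
  assume ne: "\<not> ?thesis"
  have diff: "p \<in> V \<Longrightarrow> iter_partial is f differentiable (at p)" for p "is"
    using assms by (auto simp: smooth_on_def)
  have f: "f differentiable (at p)" "partial_deriv k f differentiable (at p)"
    "partial_deriv l (partial_deriv k f) differentiable (at p)" if "p \<in> V" for p k l
    using diff[OF that, of "[]"] diff[OF that, of "[k]"] diff[OF that, of "[l, k]"]
    by (simp_all add: iter_partial_def)
  let ?a = "partial_deriv i (partial_deriv j f)" and ?b = "partial_deriv j (partial_deriv i f)"
  define e where "e = \<bar>?a y - ?b y\<bar> / 2"
  have "e > 0" using ne by (simp add: e_def)
  have "isCont ?a y" "isCont ?b y"
    using f(3)[OF \<open>y \<in> V\<close>] differentiable_imp_continuous_within by blast+
  then obtain d1 d2 where d: "d1 > 0" "d2 > 0"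
    "\<And>p. dist p y < d1 \<Longrightarrow> dist (?a p) (?a y) < e" "\<And>p. dist p y < d2 \<Longrightarrow> dist (?b p) (?b y) < e"
    unfolding continuous_at_eps_delta using \<open>e > 0\<close> by metis
  obtain d3 where d3: "d3 > 0" "ball y d3 \<subseteq> V"
    using assms openE by blast
  \<comment> \<open>The mean value points lie within 3 t of y; this ball has to fit into both
    continuity radii and into \<open>V\<close>.\<close>
  define t where "t = min d1 (min d2 d3) / 3"
  have t: "t > 0" "3 * t \<le> d1" "3 * t \<le> d2" "3 * t \<le> d3"
    using d d3 by (auto simp: t_def)
  have V: "p \<in> ball y (3 * t) \<Longrightarrow> p \<in> V" for p
    using d3 t by (auto simp: subset_iff)
  obtain p where p: "p \<in> ball y (3 * t)"
    "f (y + t *\<^sub>R axis i 1 + t *\<^sub>R axis j 1) - f (y + t *\<^sub>R axis i 1)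
      - f (y + t *\<^sub>R axis j 1) + f y = t\<^sup>2 * ?b p"
    using second_difference_mean_value[OF t(1), of y f i j] f V by metis
  obtain q where q: "q \<in> ball y (3 * t)"
    "f (y + t *\<^sub>R axis j 1 + t *\<^sub>R axis i 1) - f (y + t *\<^sub>R axis j 1)
      - f (y + t *\<^sub>R axis i 1) + f y = t\<^sup>2 * ?a q"
    using second_difference_mean_value[OF t(1), of y f j i] f V by metis
  have "y + t *\<^sub>R axis i 1 + t *\<^sub>R axis j 1 = y + t *\<^sub>R axis j 1 + t *\<^sub>R axis i 1"
    by (simp add: add_ac)
  then have "f (y + t *\<^sub>R axis i 1 + t *\<^sub>R axis j 1) = f (y + t *\<^sub>R axis j 1 + t *\<^sub>R axis i 1)"
    by (rule arg_cong)
  then have "t\<^sup>2 * ?b p = t\<^sup>2 * ?a q"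
    using p(2) q(2) by linarith
  then have "?b p = ?a q" using t(1) by simp
  moreover have "dist (?b p) (?b y) < e" "dist (?a q) (?a y) < e"
    using p(1) q(1) t by (auto intro!: d(3,4) simp: dist_commute)
  ultimately show False by (auto simp: dist_real_def e_def abs_if split: if_splits)
qed

lemma iter_partial_Nil [simp]: "iter_partial [] f = f"
  and iter_partial_Cons [simp]: "iter_partial (i # is) f = partial_deriv i (iter_partial is f)"
  and iter_partial_append: "iter_partial (is @ js) f = iter_partial is (iter_partial js f)"
  by (simp_all add: iter_partial_def)

lemma smooth_on_iter_partial: "smooth_on V f \<Longrightarrow> smooth_on V (iter_partial is f)"
  by (simp add: smooth_on_def flip: iter_partial_append)

text \<open>Derivatives can be permuted only at points of \<open>V\<close>; openness allows such an
  equality to be differentiated once more.\<close>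

lemma partial_deriv_cong_open:
  assumes "open V" "y \<in> V" "f differentiable (at y)" "\<And>p. p \<in> V \<Longrightarrow> f p = h p"
  shows "partial_deriv i f y = partial_deriv i h y"
  using frechet_derivative_transform_within_open[of f y V h] assms
  by (simp add: partial_deriv_def)

lemma iter_partial_move_to_front:
  assumes "open V" "smooth_on V f" "y \<in> V"
  shows "iter_partial (is @ i # js) f y = iter_partial (i # is @ js) f y"
  using \<open>y \<in> V\<close>
proof (induction "is" arbitrary: y)
  case (Cons k "is")
  have "iter_partial ((k # is) @ i # js) f y = partial_deriv k (iter_partial (i # is @ js) f) y"
    using assms Cons unfolding append_Cons iter_partial_Cons[of k]
    by (intro partial_deriv_cong_open[of V]) (auto simp: smooth_on_def)
  also have "\<dots> = partial_deriv i (partial_deriv k (iter_partial (is @ js) f)) y"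
    using mixed_partial_derivs_commute[OF assms(1) smooth_on_iter_partial[OF assms(2)] Cons.prems]
    by simp
  finally show ?case by simp
qed simp

text \<open>Lets the Taylor coefficients of g be indexed by multisets. The point stays general in
  the induction because the induction hypothesis gets differentiated and so must hold on all of
  \<open>V\<close>.\<close>

lemma iter_partial_mset_cong:
  assumes "open V" "smooth_on V f" "y \<in> V" "mset is = mset js"
  shows "iter_partial is f y = iter_partial js f y"
  using assms(3,4)
proof (induction "is" arbitrary: js y)
  case (Cons i "is")
  then have "i \<in> set js" by (metis list.set_intros(1) mset_eq_setD)
  then obtain js1 js2 where js: "js = js1 @ i # js2" by (meson split_list)
  then have "mset is = mset (js1 @ js2)" using Cons.prems by simp
  then have "iter_partial (i # is) f y = iter_partial (i # js1 @ js2) f y"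
    using assms Cons unfolding iter_partial_Cons
    by (intro partial_deriv_cong_open[of V]) (auto simp: smooth_on_def)
  then show ?case
    using iter_partial_move_to_front[OF assms(1,2) Cons.prems(1)] js by metis
qed simp

section \<open>Evaluation of symmetric formal power series\<close>

unbundle no vec_syntax
unbundle fps_syntax

text \<open>Convergence in the epsilon-adic topology means that every coefficient is eventually
  constant, which holds as soon as finitely many terms reach it.\<close>

lemma fps_has_sumI:
  fixes f :: "'a \<Rightarrow> real fps"
  assumes "\<And>k. finite {a \<in> A. f a $ k \<noteq> 0}"
    and "\<And>k. F $ k = (\<Sum>a | a \<in> A \<and> f a $ k \<noteq> 0. f a $ k)"
  shows "(f has_sum F) A"
  unfolding has_sum_def
proof (rule tendsto_fpsI)
  fix k
  let ?B = "{a \<in> A. f a $ k \<noteq> 0}"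
  have "\<forall>\<^sub>F X in finite_subsets_at_top A. finite X \<and> X \<subseteq> A \<and> ?B \<subseteq> X"
    unfolding eventually_finite_subsets_at_top using assms(1)[of k] by blast
  then show "\<forall>\<^sub>F X in finite_subsets_at_top A. sum f X $ k = F $ k"
  proof eventually_elim
    case (elim X)
    then show ?case
      by (subst assms(2)) (auto simp: fps_sum_nth intro!: sum.mono_neutral_right)
  qed
qed

text \<open>The symmetric tensor \<tau> in degree m with all its slots filled by q. Filling one slot
  per step makes the product rule available by induction.\<close>

primrec homog_part :: "('n::finite multiset \<Rightarrow> real) \<Rightarrow> ('n \<Rightarrow> real fps) \<Rightarrow> nat \<Rightarrow> real fps" where
  "homog_part \<tau> q 0 = fps_const (\<tau> {#})"
| "homog_part \<tau> q (Suc m) = (\<Sum>i\<in>UNIV. q i * homog_part (\<lambda>M. \<tau> (add_mset i M)) q m)"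

lemma homog_part_eq_sum_lists:
  "homog_part \<tau> q m = (\<Sum>a | length a = m. fps_const (\<tau> (mset a)) * (\<Prod>i\<leftarrow>a. q i))"
proof (induction m arbitrary: \<tau>)
  case (Suc m)
  have "homog_part \<tau> q (Suc m) = (\<Sum>i\<in>UNIV. \<Sum>a | length a = m.
      q i * (fps_const (\<tau> (add_mset i (mset a))) * (\<Prod>i\<leftarrow>a. q i)))"
    by (simp add: Suc.IH sum_distrib_left)
  also have "\<dots> = (\<Sum>(i, a)\<in>UNIV \<times> {a. length a = m}.
      q i * (fps_const (\<tau> (add_mset i (mset a))) * (\<Prod>i\<leftarrow>a. q i)))"
    by (simp add: sum.cartesian_product)
  also have "\<dots> = (\<Sum>a | length a = Suc m. fps_const (\<tau> (mset a)) * (\<Prod>i\<leftarrow>a. q i))"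
    by (rule sum.reindex_bij_witness[of _ "\<lambda>a. (hd a, tl a)" "\<lambda>(i, a). i # a"])
      (auto simp: length_Suc_conv algebra_simps)
  finally show ?case .
qed simp

lemma homog_part_nth_eq_0:
  assumes "\<And>i. q i $ 0 = 0" "k < m"
  shows "homog_part \<tau> q m $ k = 0"
  using \<open>k < m\<close>
proof (induction m arbitrary: \<tau> k)
  case (Suc m)
  have "(q i * homog_part (\<lambda>M. \<tau> (add_mset i M)) q m) $ k = 0" for i
    unfolding fps_mult_nth
  proof (intro sum.neutral ballI)
    fix j assume "j \<in> {0..k}"
    then show "q i $ j * homog_part (\<lambda>M. \<tau> (add_mset i M)) q m $ (k - j) = 0"
      using Suc assms(1) by (cases j) auto
  qed
  then show ?case by (simp add: fps_sum_nth)
qed simp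

text \<open>By the product rule each of the m + 1 slots is differentiated once; the slots are
  interchangeable since \<tau> is indexed by multisets, so all contributions agree.\<close>

lemma fps_deriv_homog_part:
  "fps_deriv (homog_part \<tau> q (Suc m)) =
     of_nat (Suc m) * (\<Sum>i\<in>UNIV. fps_deriv (q i) * homog_part (\<lambda>M. \<tau> (add_mset i M)) q m)"
proof (induction m arbitrary: \<tau>)
  case (Suc m)
  let ?\<tau> = "\<lambda>i M. \<tau> (add_mset i M)" and ?\<tau>2 = "\<lambda>i j M. \<tau> (add_mset i (add_mset j M))"
  have "fps_deriv (homog_part \<tau> q (Suc (Suc m))) =
      (\<Sum>i\<in>UNIV. fps_deriv (q i) * homog_part (?\<tau> i) q (Suc m)) +
      (\<Sum>i\<in>UNIV. q i * fps_deriv (homog_part (?\<tau> i) q (Suc m)))"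
    unfolding homog_part.simps(2)[of \<tau>] by (simp add: sum.distrib fps_deriv_sum ac_simps)
  also have "(\<Sum>i\<in>UNIV. q i * fps_deriv (homog_part (?\<tau> i) q (Suc m))) =
      of_nat (Suc m) * (\<Sum>i\<in>UNIV. \<Sum>j\<in>UNIV. fps_deriv (q j) * (q i * homog_part (?\<tau>2 i j) q m))"
    unfolding Suc.IH sum_distrib_left by (simp only: ac_simps)
  also have "(\<Sum>i\<in>UNIV. \<Sum>j\<in>UNIV. fps_deriv (q j) * (q i * homog_part (?\<tau>2 i j) q m)) =
      (\<Sum>j\<in>UNIV. fps_deriv (q j) * homog_part (?\<tau> j) q (Suc m))"
    by (subst sum.swap) (simp add: sum_distrib_left add_mset_commute)
  finally show ?case by (simp add: algebra_simps)
qed (simp add: fps_deriv_sum mult.commute)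

text \<open>The truncation at \<open>k\<close> is harmless when all \<open>q i\<close> have no constant term.\<close>
definition ev :: "('n::finite multiset \<Rightarrow> real) \<Rightarrow> ('n \<Rightarrow> real fps) \<Rightarrow> real fps" where
  "ev \<tau> q = Abs_fps (\<lambda>k. \<Sum>m\<le>k. homog_part \<tau> q m $ k / fact m)"

text \<open>A common bound \<open>N\<close> serves all the coefficients that meet in a Cauchy
  product, so that sums over m can be exchanged with it.\<close>

lemma ev_nth:
  assumes "\<And>i. q i $ 0 = 0" "k \<le> N"
  shows "ev \<tau> q $ k = (\<Sum>m\<le>N. homog_part \<tau> q m $ k / fact m)"
  unfolding ev_def fps_nth_Abs_fps
  by (rule sum.mono_neutral_left) (simp_all add: homog_part_nth_eq_0[OF assms(1)] assms(2))

lemma ev_nth_0: "ev \<tau> q $ 0 = \<tau> {#}"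
  by (simp add: ev_def)

text \<open>The chain rule. The factor m + 1 of \<open>fps_deriv_homog_part\<close> turns the
  factorial of m + 1 into that of m, so with this normalisation a derivative is one more index on
  \<tau>, without a constant.\<close>

lemma fps_deriv_ev:
  assumes q: "\<And>i. q i $ 0 = 0"
  shows "fps_deriv (ev \<tau> q) = (\<Sum>i\<in>UNIV. ev (\<lambda>M. \<tau> (add_mset i M)) q * fps_deriv (q i))"
proof (rule fps_ext)
  fix k
  let ?\<tau> = "\<lambda>i M. \<tau> (add_mset i M)"
  have "fps_deriv (ev \<tau> q) $ k = (\<Sum>m\<le>Suc k. fps_deriv (homog_part \<tau> q m) $ k / fact m)"
    by (simp add: ev_nth[where N = "Suc k"] q sum_distrib_left mult.commute del: sum.atMost_Suc)
  also have "\<dots> = (\<Sum>m\<le>k. fps_deriv (homog_part \<tau> q (Suc m)) $ k / fact (Suc m))"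
    by (subst sum.atMost_Suc_shift) simp
  also have "\<dots> = (\<Sum>m\<le>k. (\<Sum>i\<in>UNIV. (fps_deriv (q i) * homog_part (?\<tau> i) q m) $ k) / fact m)"
  proof (intro sum.cong refl)
    fix m
    have "fps_deriv (homog_part \<tau> q (Suc m)) $ k =
        real (Suc m) * (\<Sum>i\<in>UNIV. (fps_deriv (q i) * homog_part (?\<tau> i) q m) $ k)"
      unfolding fps_deriv_homog_part fps_sum_nth[symmetric] fps_of_nat[symmetric]
        fps_mult_left_const_nth ..
    then show "fps_deriv (homog_part \<tau> q (Suc m)) $ k / fact (Suc m) =
        (\<Sum>i\<in>UNIV. (fps_deriv (q i) * homog_part (?\<tau> i) q m) $ k) / fact m"
      by (simp del: of_nat_Suc)
  qed
  also have "\<dots> = (\<Sum>i\<in>UNIV. \<Sum>m\<le>k. (fps_deriv (q i) * homog_part (?\<tau> i) q m) $ k / fact m)"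
    by (subst sum.swap) (simp add: sum_divide_distrib)
  also have "\<dots> = (\<Sum>i\<in>UNIV. \<Sum>j\<le>k. fps_deriv (q i) $ j * ev (?\<tau> i) q $ (k - j))"
  proof (rule sum.cong[OF refl])
    fix i
    have "(\<Sum>m\<le>k. (fps_deriv (q i) * homog_part (?\<tau> i) q m) $ k / fact m) =
       (\<Sum>m\<le>k. \<Sum>j\<le>k. fps_deriv (q i) $ j * (homog_part (?\<tau> i) q m $ (k - j) / fact m))"
      by (simp add: fps_mult_nth sum_divide_distrib atLeast0AtMost del: fps_deriv_nth)
    also have "\<dots> = (\<Sum>j\<le>k. fps_deriv (q i) $ j * ev (?\<tau> i) q $ (k - j))"
      by (subst sum.swap) (simp add: ev_nth[where N = k] q sum_distrib_left del: fps_deriv_nth)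
    finally show "(\<Sum>m\<le>k. (fps_deriv (q i) * homog_part (?\<tau> i) q m) $ k / fact m) =
        (\<Sum>j\<le>k. fps_deriv (q i) $ j * ev (?\<tau> i) q $ (k - j))" .
  qed
  also have "\<dots> = (\<Sum>i\<in>UNIV. fps_deriv (q i) * ev (?\<tau> i) q) $ k"
    by (simp add: fps_mult_nth fps_sum_nth atLeast0AtMost del: fps_deriv_nth)
  finally show "fps_deriv (ev \<tau> q) $ k = (\<Sum>i\<in>UNIV. ev (?\<tau> i) q * fps_deriv (q i)) $ k"
    by (simp only: mult.commute)
qed

lemma prod_list_fps_nth_eq_0:
  fixes q :: "'n \<Rightarrow> real fps"
  assumes "\<And>i. q i $ 0 = 0" "k < length a"
  shows "(\<Prod>i\<leftarrow>a. q i) $ k = 0"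
  using \<open>k < length a\<close>
proof (induction a arbitrary: k)
  case (Cons i a)
  show ?case
    unfolding list.map prod_list.Cons fps_mult_nth
  proof (intro sum.neutral ballI)
    fix j assume "j \<in> {0..k}"
    then show "q i $ j * (\<Prod>i\<leftarrow>a. q i) $ (k - j) = 0"
      using Cons assms(1) by (cases j) auto
  qed
qed simp

text \<open>Lists are grouped by length, and only those of length at most k reach coefficient k. As
  S is given without factorials, \<tau> has to absorb them; this is where the factor
  \<open>fact (degree t v)\<close> at a black vertex comes from.\<close>

lemma subst_series_eq_ev:
  fixes q :: "'n::finite \<Rightarrow> real fps"
  assumes q: "\<And>i. q i $ 0 = 0" and T: "\<And>a. T a = \<tau> (mset a) / fact (length a)"
  shows "subst_series T q = ev \<tau> q"
  unfolding subst_series_def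
proof (intro infsumI fps_has_sumI)
  fix k
  let ?f = "\<lambda>a. fps_const (T a) * (\<Prod>i\<leftarrow>a. q i)"
  have sub: "{a \<in> UNIV. ?f a $ k \<noteq> 0} \<subseteq> {a. length a \<le> k}"
    using prod_list_fps_nth_eq_0[where q = q, OF q] by (auto simp: not_less[symmetric])
  moreover have fin: "finite {a :: 'n list. length a \<le> k}"
    using finite_lists_length_le[of "UNIV :: 'n set" k] by simp
  ultimately show "finite {a \<in> UNIV. ?f a $ k \<noteq> 0}"
    by (rule finite_subset)
  have "ev \<tau> q $ k = (\<Sum>m\<le>k. \<Sum>a | a \<in> {a. length a \<le> k} \<and> length a = m. ?f a $ k)"
    unfolding ev_def by (auto simp: homog_part_eq_sum_lists fps_sum_nth sum_divide_distrib T
        intro!: sum.cong)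
  also have "\<dots> = (\<Sum>a | length a \<le> k. ?f a $ k)"
    using fin by (intro sum.group) auto
  also have "\<dots> = (\<Sum>a | a \<in> UNIV \<and> ?f a $ k \<noteq> 0. ?f a $ k)"
    using sub fin by (intro sum.mono_neutral_right) auto
  finally show "ev \<tau> q $ k = \<dots>" .
qed

text \<open>All \<open>length a + 1\<close> positions give the same value, which cancels one factor
  of the factorial: differentiating in q only adds an index to \<tau>.\<close>

lemma dq_symmetric:
  assumes "\<And>a. T a = \<tau> (mset a) / fact (length a)"
  shows "dq i T a = \<tau> (add_mset i (mset a)) / fact (length a)"
proof -
  have "mset (take j a @ i # drop j a) = add_mset i (mset a)" for j
    by (metis append_take_drop_id mset.simps(2) mset_append union_mset_add_mset_right)
  then have "dq i T a = (\<Sum>j\<le>length a. \<tau> (add_mset i (mset a)) / fact (Suc (length a)))"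
    unfolding dq_def assms by (intro sum.cong) auto
  then show ?thesis by (simp del: of_nat_Suc)
qed

section \<open>The critical value\<close>

text \<open>Here \<sigma> and \<gamma> hold the derivatives of S at q = 0 and of g at \<phi>(x), and
  z is y - \<phi>(x). The last two conditions say that the derivatives of
  \<open>critical_value\<close> in z and in q vanish.\<close>

definition critical_equations ::
  "('n::finite multiset \<Rightarrow> real) \<Rightarrow> ('n multiset \<Rightarrow> real) \<Rightarrow> ('n \<Rightarrow> real fps) \<Rightarrow> ('n \<Rightarrow> real fps) \<Rightarrow> bool" where
  "critical_equations \<sigma> \<gamma> q z \<longleftrightarrow>
     (\<forall>i. q i $ 0 = 0) \<and> (\<forall>i. z i $ 0 = 0) \<and>
     (\<forall>i. q i = fps_X * ev (\<lambda>M. \<gamma> (add_mset i M)) z) \<and>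
     (\<forall>i. z i = ev (\<lambda>M. \<sigma> (add_mset i M)) q)"

definition critical_value ::
  "('n::finite multiset \<Rightarrow> real) \<Rightarrow> ('n multiset \<Rightarrow> real) \<Rightarrow> ('n \<Rightarrow> real fps) \<Rightarrow> ('n \<Rightarrow> real fps) \<Rightarrow> real fps" where
  "critical_value \<sigma> \<gamma> q z = fps_X * ev \<gamma> z + ev \<sigma> q - (\<Sum>i\<in>UNIV. z i * q i)"

text \<open>The value is stationary in \<open>q\<close> and \<open>z\<close>, so only the explicit dependence on \<open>\<epsilon>\<close>
  contributes to the derivative.\<close>
lemma fps_deriv_critical_value:
  assumes "critical_equations \<sigma> \<gamma> q z"
  shows "fps_deriv (critical_value \<sigma> \<gamma> q z) = ev \<gamma> z"
proof -
  have q: "\<And>i. q i $ 0 = 0" and z: "\<And>i. z i $ 0 = 0"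
    and qe: "\<And>i. fps_X * ev (\<lambda>M. \<gamma> (add_mset i M)) z = q i"
    and ze: "\<And>i. ev (\<lambda>M. \<sigma> (add_mset i M)) q = z i"
    using assms by (auto simp: critical_equations_def)
  have "fps_X * fps_deriv (ev \<gamma> z) = (\<Sum>i\<in>UNIV. q i * fps_deriv (z i))"
    by (simp add: fps_deriv_ev[OF z] sum_distrib_left mult.assoc[symmetric] qe)
  moreover have "fps_deriv (ev \<sigma> q) = (\<Sum>i\<in>UNIV. z i * fps_deriv (q i))"
    by (simp add: fps_deriv_ev[OF q] ze)
  ultimately show ?thesis
    by (simp add: critical_value_def fps_deriv_sum sum.distrib algebra_simps)
qed

lemma critical_value_nth_0:
  "critical_equations \<sigma> \<gamma> q z \<Longrightarrow> critical_value \<sigma> \<gamma> q z $ 0 = \<sigma> {#}"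
  by (simp add: critical_value_def critical_equations_def ev_nth_0 fps_sum_nth)

text \<open>The case of a prescribed \<open>p\<close>; it shows that the tree series do satisfy the
  critical equations.\<close>

lemma linear_system_unique:
  fixes H :: "'n::finite multiset \<Rightarrow> real fps"
  assumes "\<And>a. fps_deriv (H a) = (\<Sum>i\<in>UNIV. H (add_mset i a) * p i)"
    and "\<And>a. fps_deriv (K a) = (\<Sum>i\<in>UNIV. K (add_mset i a) * p i)"
    and "\<And>a. H a $ 0 = K a $ 0"
  shows "H a = K a"
proof (rule fps_ext)
  show "H a $ k = K a $ k" for k
  proof (induction k arbitrary: a rule: less_induct)
    case (less k)
    show ?case
    proof (cases k)
      case 0
      then show ?thesis using assms(3) by simp
    next
      case (Suc l)
      have "(H b * p i) $ l = (K b * p i) $ l" for b i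
        unfolding fps_mult_nth by (intro sum.cong) (auto simp: less Suc)
      then have "fps_deriv (H a) $ l = fps_deriv (K a) $ l"
        unfolding assms(1,2) fps_sum_nth by simp
      then show ?thesis using Suc by (simp del: of_nat_Suc)
    qed
  qed
qed

lemma coupled_system_unique:
  fixes G B :: "'n::finite multiset \<Rightarrow> real fps"
  assumes "\<And>a. fps_deriv (G a) = (\<Sum>i\<in>UNIV. G (add_mset i a) * fps_deriv (B {#i#}))"
    and "\<And>a. fps_deriv (B a) = (\<Sum>i\<in>UNIV. B (add_mset i a) * fps_deriv (fps_X * G {#i#}))"
    and "\<And>a. fps_deriv (G' a) = (\<Sum>i\<in>UNIV. G' (add_mset i a) * fps_deriv (B' {#i#}))"
    and "\<And>a. fps_deriv (B' a) = (\<Sum>i\<in>UNIV. B' (add_mset i a) * fps_deriv (fps_X * G' {#i#}))"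
    and "\<And>a. G a $ 0 = G' a $ 0" "\<And>a. B a $ 0 = B' a $ 0"
  shows "G a = G' a \<and> B a = B' a"
proof -
  have "\<forall>a. G a $ k = G' a $ k \<and> B a $ k = B' a $ k" for k
  proof (induction k rule: less_induct)
    case (less k)
    show ?case
    proof (cases k)
      case 0
      then show ?thesis using assms(5,6) by simp
    next
      case (Suc l)
      \<comment> \<open>Coefficient j of this derivative is j + 1 times coefficient j of
        \<open>G\<close>: the factor \<open>fps_X\<close> makes up for the order lost by
        differentiating. So \<open>B\<close> advances to order k from lower orders alone, and
        \<open>G\<close> follows using the new order of \<open>B\<close>.\<close>
      have XG: "fps_deriv (fps_X * G {#i#}) $ j = fps_deriv (fps_X * G' {#i#}) $ j" if "j \<le> l" for i j
        using less[of j] that Suc by simp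
      have "(B b * fps_deriv (fps_X * G {#i#})) $ l = (B' b * fps_deriv (fps_X * G' {#i#})) $ l" for b i
        unfolding fps_mult_nth using less Suc XG by (intro sum.cong) auto
      then have "fps_deriv (B a) $ l = fps_deriv (B' a) $ l" for a
        unfolding assms(2,4) fps_sum_nth by simp
      then have B: "B a $ k = B' a $ k" for a using Suc by (simp del: of_nat_Suc)
      have "B a $ j = B' a $ j" if "j \<le> k" for a j
        using that B less by (cases "j = k") auto
      then have dB: "fps_deriv (B {#i#}) $ j = fps_deriv (B' {#i#}) $ j" if "j \<le> l" for i j
        using that Suc by simp
      have "(G b * fps_deriv (B {#i#})) $ l = (G' b * fps_deriv (B' {#i#})) $ l" for b i
        unfolding fps_mult_nth using less Suc dB by (intro sum.cong) auto
      then have "fps_deriv (G a) $ l = fps_deriv (G' a) $ l" for a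
        unfolding assms(1,3) fps_sum_nth by simp
      then have "G a $ k = G' a $ k" for a using Suc by (simp del: of_nat_Suc)
      with B show ?thesis by simp
    qed
  qed
  then show ?thesis by (auto intro: fps_ext)
qed

text \<open>Uniqueness: a critical point yields, by the chain rule, a second solution of the coupled
  system. Existence needs no fixed point argument: the series are already given and only have to be
  recognised as derivatives of \<gamma> and \<sigma>.\<close>

lemma critical_equations_iff_coupled_system:
  fixes G B :: "'n::finite multiset \<Rightarrow> real fps"
  assumes G: "\<And>a. fps_deriv (G a) = (\<Sum>i\<in>UNIV. G (add_mset i a) * fps_deriv (B {#i#}))"
    and B: "\<And>a. fps_deriv (B a) = (\<Sum>i\<in>UNIV. B (add_mset i a) * fps_deriv (fps_X * G {#i#}))"
    and G0: "\<And>a. G a $ 0 = \<gamma> a" and B0: "\<And>a. B a $ 0 = \<sigma> a" and \<sigma>: "\<And>i. \<sigma> {#i#} = 0"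
  shows "critical_equations \<sigma> \<gamma> q z \<longleftrightarrow> q = (\<lambda>i. fps_X * G {#i#}) \<and> z = (\<lambda>i. B {#i#})"
    and "critical_equations \<sigma> \<gamma> q z \<Longrightarrow> ev \<gamma> z = G {#}"
proof -
  \<comment> \<open>The derivative of order \<open>a\<close> of the function with Taylor tensor
    \<tau>, evaluated at \<open>p\<close>.\<close>
  define E where "E \<tau> p a = ev (\<lambda>M. \<tau> (M + a)) p"
    for \<tau> :: "'n multiset \<Rightarrow> real" and p and a
  have E0: "E \<tau> p a $ 0 = \<tau> a" for \<tau> p a
    by (simp add: E_def ev_nth_0)
  have dE: "fps_deriv (E \<tau> p a) = (\<Sum>i\<in>UNIV. E \<tau> p (add_mset i a) * fps_deriv (p i))"
    if "\<And>i. p i $ 0 = 0" for \<tau> p a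
    unfolding E_def by (subst fps_deriv_ev[OF that]) simp_all
  have crit: "critical_equations \<sigma> \<gamma> q z \<longleftrightarrow> (\<forall>i. q i $ 0 = 0) \<and> (\<forall>i. z i $ 0 = 0) \<and>
      q = (\<lambda>i. fps_X * E \<gamma> z {#i#}) \<and> z = (\<lambda>i. E \<sigma> q {#i#})" for q z
    by (simp add: critical_equations_def E_def fun_eq_iff)
  have sol: "G a = E \<gamma> z a \<and> B a = E \<sigma> q a" if "critical_equations \<sigma> \<gamma> q z" for q z a
  proof (rule coupled_system_unique[OF G B])
    have q: "\<And>i. q i $ 0 = 0" and z: "\<And>i. z i $ 0 = 0"
      and qe: "fps_X * E \<gamma> z {#i#} = q i" and ze: "E \<sigma> q {#i#} = z i" for i
      using that unfolding crit by metis+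
    show "fps_deriv (E \<gamma> z a) = (\<Sum>i\<in>UNIV. E \<gamma> z (add_mset i a) * fps_deriv (E \<sigma> q {#i#}))" for a
      unfolding ze by (rule dE[OF z])
    show "fps_deriv (E \<sigma> q a) =
        (\<Sum>i\<in>UNIV. E \<sigma> q (add_mset i a) * fps_deriv (fps_X * E \<gamma> z {#i#}))" for a
      unfolding qe by (rule dE[OF q])
  qed (simp_all add: E0 G0 B0)
  show "critical_equations \<sigma> \<gamma> q z \<Longrightarrow> ev \<gamma> z = G {#}"
    using sol[of q z "{#}"] by (simp add: E_def)
  show "critical_equations \<sigma> \<gamma> q z \<longleftrightarrow> q = (\<lambda>i. fps_X * G {#i#}) \<and> z = (\<lambda>i. B {#i#})"
  proof
    assume "critical_equations \<sigma> \<gamma> q z"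
    then show "q = (\<lambda>i. fps_X * G {#i#}) \<and> z = (\<lambda>i. B {#i#})"
      using sol[of q z] unfolding crit by metis
  next
    assume qz: "q = (\<lambda>i. fps_X * G {#i#}) \<and> z = (\<lambda>i. B {#i#})"
    then have q: "q i $ 0 = 0" and z: "z i $ 0 = 0" for i
      by (simp_all add: B0 \<sigma>)
    \<comment> \<open>As z is now fixed, \<open>G\<close> and the derivatives of \<gamma> at z solve
      the same linear system. Substituting z makes sense because its constant term is \<sigma> at a
      single index, that is 0.\<close>
    have GE: "G a = E \<gamma> z a" for a
    proof (rule linear_system_unique)
      show "fps_deriv (G a) = (\<Sum>i\<in>UNIV. G (add_mset i a) * fps_deriv (z i))" for a
        using G[of a] qz by simp
      show "fps_deriv (E \<gamma> z a) = (\<Sum>i\<in>UNIV. E \<gamma> z (add_mset i a) * fps_deriv (z i))" for a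
        by (rule dE[OF z])
    qed (simp add: E0 G0)
    have BE: "B a = E \<sigma> q a" for a
    proof (rule linear_system_unique)
      show "fps_deriv (B a) = (\<Sum>i\<in>UNIV. B (add_mset i a) * fps_deriv (q i))" for a
        by (subst B) (simp only: qz)
      show "fps_deriv (E \<sigma> q a) = (\<Sum>i\<in>UNIV. E \<sigma> q (add_mset i a) * fps_deriv (q i))" for a
        by (rule dE[OF q])
    qed (simp add: E0 B0)
    show "critical_equations \<sigma> \<gamma> q z"
      unfolding crit GE[symmetric] BE[symmetric] using q z qz by blast
  qed
qed

section \<open>Trees as edge sets\<close>

definition conn :: "('v \<times> 'v) set \<Rightarrow> ('v \<times> 'v) set" where
  "conn E = (E \<union> E\<inverse>)\<^sup>*"

lemma conn_refl [simp]: "(u, u) \<in> conn E"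
  by (simp add: conn_def)

lemma conn_sym: "(u, v) \<in> conn E \<Longrightarrow> (v, u) \<in> conn E"
  unfolding conn_def by (metis converse_Un converse_converse rtrancl_converseI sup_commute)

lemma conn_trans: "(u, v) \<in> conn E \<Longrightarrow> (v, w) \<in> conn E \<Longrightarrow> (u, w) \<in> conn E"
  unfolding conn_def by (rule rtrancl_trans)

lemma conn_edge: "(u, v) \<in> E \<Longrightarrow> (u, v) \<in> conn E"
  by (auto simp: conn_def)

lemma conn_adj: "(u, x) \<in> conn E \<Longrightarrow> (x, y) \<in> E \<or> (y, x) \<in> E \<Longrightarrow> (u, y) \<in> conn E"
  using conn_edge conn_sym conn_trans by metis

lemma conn_induct [consumes 1, case_names refl step]:
  assumes "(u, v) \<in> conn E" "P u"
    and "\<And>x y. (u, x) \<in> conn E \<Longrightarrow> (x, y) \<in> E \<or> (y, x) \<in> E \<Longrightarrow> P x \<Longrightarrow> P y"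
  shows "P v"
  using assms(1) unfolding conn_def
proof (induction rule: rtrancl_induct)
  case (step y z)
  then show ?case using assms(3)[of y z] by (auto simp: conn_def)
qed (rule assms(2))

text \<open>An edge may go to a walk and in particular collapse to a point, as it does under the
  retractions in \<open>is_tree_insert_edge\<close>.\<close>

lemma conn_image:
  assumes "(u, v) \<in> conn E" "\<And>x y. (x, y) \<in> E \<Longrightarrow> (f x, f y) \<in> conn E'"
  shows "(f u, f v) \<in> conn E'"
  using assms(1)
proof (induction rule: conn_induct)
  case (step x y)
  then show ?case using assms(2) by (metis conn_sym conn_trans)
qed simp

lemma conn_mono: "(u, v) \<in> conn E \<Longrightarrow> E \<subseteq> E' \<Longrightarrow> (u, v) \<in> conn E'"
  using conn_image[of u v E "\<lambda>x. x" E'] by (auto intro: conn_edge)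

lemma conn_invariant:
  assumes "(u, v) \<in> conn E" "u \<in> A" "\<And>x y. (x, y) \<in> E \<Longrightarrow> x \<in> A \<longleftrightarrow> y \<in> A"
  shows "v \<in> A"
  using assms(1) by (induction rule: conn_induct) (use assms in auto)

text \<open>A walk from u never leaves the component of u. This turns connectivity after removing
  one edge into connectivity inside a branch.\<close>

lemma conn_component:
  assumes "(u, v) \<in> conn E"
  shows "(u, v) \<in> conn {(x, y) \<in> E. (u, x) \<in> conn E \<and> (u, y) \<in> conn E}"
  using assms
proof (induction rule: conn_induct)
  case (step x y)
  have "(u, y) \<in> conn E" using step(1,2) by (rule conn_adj)
  with step show ?case by (intro conn_adj[OF step(3)]) auto
qed simp

text \<open>Signs encode the colour: positive integers are black and negative ones white.\<close>
definition bip :: "int set \<Rightarrow> (int \<times> int) set" where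
  "bip V = {(b, w). b \<in> V \<and> w \<in> V \<and> 0 < b \<and> w < 0}"

definition opp :: "int \<Rightarrow> int \<Rightarrow> bool" where
  "opp u v \<longleftrightarrow> u < 0 \<and> 0 < v \<or> 0 < u \<and> v < 0"

text \<open>The positive, black end comes first; with \<open>ed\<close> an edge can be named by root
  and branch vertex whatever the colour of the root.\<close>

definition ed :: "int \<Rightarrow> int \<Rightarrow> int \<times> int" where
  "ed u v = (max u v, min u v)"

lemma ed_commute: "ed u v = ed v u"
  by (simp add: ed_def max.commute min.commute)

lemma ed_in_bip: "ed u v \<in> bip V \<longleftrightarrow> u \<in> V \<and> v \<in> V \<and> opp u v"
  by (auto simp: ed_def bip_def opp_def max_def min_def)

lemma conn_ed: "ed u v \<in> E \<Longrightarrow> (u, v) \<in> conn E"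
  by (cases "u \<le> v") (auto simp: ed_def dest: conn_edge conn_sym)

text \<open>Acyclicity is stated as "every edge is a bridge", which behaves well under cutting and
  joining trees. The vertex 0 is excluded because it has no colour.\<close>

definition is_tree :: "int set \<Rightarrow> (int \<times> int) set \<Rightarrow> bool" where
  "is_tree V E \<longleftrightarrow> finite V \<and> V \<noteq> {} \<and> 0 \<notin> V \<and> E \<subseteq> bip V \<and> (\<forall>u\<in>V. \<forall>v\<in>V. (u, v) \<in> conn E) \<and>
     (\<forall>u v. (u, v) \<in> E \<longrightarrow> (u, v) \<notin> conn (E - {(u, v)}))"

lemma finite_bip: "finite V \<Longrightarrow> finite (bip V)"
  by (rule finite_subset[of _ "V \<times> V"]) (auto simp: bip_def)

lemma is_tree_finite: "is_tree V E \<Longrightarrow> finite E"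
  unfolding is_tree_def by (meson finite_bip finite_subset)

lemma finite_trees: "finite V \<Longrightarrow> finite {E. is_tree V E}"
  by (rule finite_subset[of _ "Pow (bip V)"]) (auto simp: is_tree_def finite_bip)

lemma is_tree_bridge:
  assumes "is_tree V E" "ed u v \<in> E"
  shows "(u, v) \<notin> conn (E - {ed u v})"
proof -
  have "ed u v = (u, v) \<or> ed u v = (v, u)"
    by (auto simp: ed_def max_def min_def)
  then show ?thesis
    using assms conn_sym unfolding is_tree_def by metis
qed

text \<open>The new edge is a bridge because no other edge leaves \<open>V1\<close>. An old edge
  stays a bridge because collapsing the other tree to the near end of the new edge turns a detour
  around it into a detour inside its own tree.\<close>

lemma is_tree_insert_edge:
  assumes t: "is_tree V1 E1" "is_tree V2 E2" and disj: "V1 \<inter> V2 = {}"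
    and rc: "r \<in> V1" "c \<in> V2" "opp r c"
  shows "is_tree (V1 \<union> V2) (insert (ed r c) (E1 \<union> E2))"
proof -
  let ?E = "insert (ed r c) (E1 \<union> E2)"
  have E12: "E1 \<subseteq> bip V1" "E2 \<subseteq> bip V2"
    using t by (auto simp: is_tree_def)
  have "?E \<subseteq> bip (V1 \<union> V2)"
    using E12 rc by (auto simp: ed_in_bip) (auto simp: bip_def)
  moreover have "(u, v) \<in> conn ?E" if "u \<in> V1 \<union> V2" "v \<in> V1 \<union> V2" for u v
  proof -
    have "(u, r) \<in> conn ?E" if "u \<in> V1 \<union> V2" for u
    proof (cases "u \<in> V1")
      case True
      then have "(u, r) \<in> conn E1" using t rc by (auto simp: is_tree_def)
      then show ?thesis by (rule conn_mono) auto
    next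
      case False
      then have "(u, c) \<in> conn E2" using t rc that by (auto simp: is_tree_def)
      then have "(u, c) \<in> conn ?E" by (rule conn_mono) auto
      moreover have "(c, r) \<in> conn ?E" by (rule conn_ed) (simp add: ed_commute)
      ultimately show ?thesis by (rule conn_trans)
    qed
    then show ?thesis using that conn_sym conn_trans by metis
  qed
  moreover have "(u, v) \<notin> conn (?E - {(u, v)})" if "(u, v) \<in> ?E" for u v
  proof -
    have e_notin: "ed r c \<notin> E1 \<union> E2"
      using E12 rc disj by (auto simp: ed_def bip_def max_def min_def opp_def)
    consider (e) "(u, v) = ed r c" | (E1) "(u, v) \<in> E1" | (E2) "(u, v) \<in> E2"
      using \<open>(u, v) \<in> ?E\<close> by auto
    then show ?thesis
    proof cases
      case e
      have "(r, c) \<notin> conn (E1 \<union> E2)"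
        using conn_invariant[of r c "E1 \<union> E2" V1] E12 rc disj by (auto simp: bip_def)
      moreover have "?E - {(u, v)} = E1 \<union> E2"
        using e e_notin by auto
      moreover have "(u, v) = (r, c) \<or> (u, v) = (c, r)"
        using e by (auto simp: ed_def max_def min_def split: if_splits)
      ultimately show ?thesis using conn_sym by (metis prod.inject)
    next
      case E1
      let ?f = "\<lambda>x. if x \<in> V2 then r else x"
      have uv: "u \<in> V1" "v \<in> V1" using E1 E12 by (auto simp: bip_def)
      show ?thesis
      proof
        assume "(u, v) \<in> conn (?E - {(u, v)})"
        then have "(?f u, ?f v) \<in> conn (E1 - {(u, v)})"
        proof (rule conn_image)
          fix x y assume xy: "(x, y) \<in> ?E - {(u, v)}"
          then consider "(x, y) = ed r c" | "(x, y) \<in> E1 - {(u, v)}" | "(x, y) \<in> E2" by auto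
          then show "(?f x, ?f y) \<in> conn (E1 - {(u, v)})"
          proof cases
            case 1
            then have "{x, y} = {r, c}" by (auto simp: ed_def max_def min_def split: if_splits)
            then show ?thesis using rc disj by (auto simp: doubleton_eq_iff)
          next
            case 2
            then have "x \<notin> V2" "y \<notin> V2" using E12 disj by (auto simp: bip_def)
            with 2 show ?thesis by (simp add: conn_edge)
          next
            case 3
            then show ?thesis using E12 by (auto simp: bip_def)
          qed
        qed
        moreover have "?f u = u" "?f v = v" using uv disj by auto
        ultimately show False using t(1) E1 by (simp add: is_tree_def)
      qed
    next
      case E2
      let ?f = "\<lambda>x. if x \<in> V1 then c else x"
      have uv: "u \<in> V2" "v \<in> V2" using E2 E12 by (auto simp: bip_def)
      show ?thesis
      proof
        assume "(u, v) \<in> conn (?E - {(u, v)})"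
        then have "(?f u, ?f v) \<in> conn (E2 - {(u, v)})"
        proof (rule conn_image)
          fix x y assume xy: "(x, y) \<in> ?E - {(u, v)}"
          then consider "(x, y) = ed r c" | "(x, y) \<in> E2 - {(u, v)}" | "(x, y) \<in> E1" by auto
          then show "(?f x, ?f y) \<in> conn (E2 - {(u, v)})"
          proof cases
            case 1
            then have "{x, y} = {r, c}" by (auto simp: ed_def max_def min_def split: if_splits)
            then show ?thesis using rc disj by (auto simp: doubleton_eq_iff)
          next
            case 2
            then have "x \<notin> V1" "y \<notin> V1" using E12 disj by (auto simp: bip_def)
            with 2 show ?thesis by (simp add: conn_edge)
          next
            case 3
            then show ?thesis using E12 by (auto simp: bip_def)
          qed
        qed
        moreover have "?f u = u" "?f v = v" using uv disj by auto
        ultimately show False using t(2) E2 by (simp add: is_tree_def)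
      qed
    qed
  qed
  ultimately show ?thesis
    using t by (auto simp: is_tree_def)
qed

lemma is_tree_remove_edge:
  assumes t: "is_tree V E" and e: "ed r c \<in> E"
    and V2: "V2 = {v. (c, v) \<in> conn (E - {ed r c})}"
    and E1: "E1 = E \<inter> ((V - V2) \<times> (V - V2))" and E2: "E2 = E \<inter> (V2 \<times> V2)"
  shows "r \<in> V - V2" "c \<in> V2" "V2 \<subseteq> V" "opp r c" "E = insert (ed r c) (E1 \<union> E2)"
    "is_tree (V - V2) E1" "is_tree V2 E2"
proof -
  let ?e = "ed r c"
  have EV: "E \<subseteq> bip V" and fin: "finite V" "0 \<notin> V"
    and conn: "\<And>u v. u \<in> V \<Longrightarrow> v \<in> V \<Longrightarrow> (u, v) \<in> conn E"
    using t by (auto simp: is_tree_def)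
  have rc: "r \<in> V" "c \<in> V" and "opp r c" using e EV ed_in_bip by blast+
  then show "opp r c" by blast
  have "r \<notin> V2"
    using is_tree_bridge[OF t e] conn_sym[of c r] by (auto simp: V2)
  with rc show r: "r \<in> V - V2" by blast
  show c: "c \<in> V2" by (simp add: V2)
  show sub: "V2 \<subseteq> V"
    using conn_invariant[of c _ "E - {?e}" V] EV rc by (auto simp: V2 bip_def)
  have same: "x \<in> V2 \<longleftrightarrow> y \<in> V2" if "(x, y) \<in> E - {?e}" for x y
    using that conn_adj[of c x "E - {?e}" y] conn_adj[of c y "E - {?e}" x] by (auto simp: V2)
  have cross: "(x, y) \<in> E1 \<union> E2" if "(x, y) \<in> E - {?e}" for x y
    using same[OF that] that EV by (auto simp: E1 E2 bip_def)
  then show Eeq: "E = insert ?e (E1 \<union> E2)" using e by (auto simp: E1 E2)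
  have bridge: "(u, v) \<notin> conn (F - {(u, v)})" if "(u, v) \<in> F" "F \<subseteq> E" for u v F
    using t that conn_mono[of u v "F - {(u, v)}" "E - {(u, v)}"] unfolding is_tree_def by blast
  have conn1: "(r, v) \<in> conn E1" if "v \<in> V - V2" for v
  proof -
    have "(r, v) \<in> conn E" using that rc conn by blast
    \<comment> \<open>The walk may pass through \<open>V2\<close>, where nothing is claimed. It can
      leave \<open>V2\<close> only across the cut edge, which puts it back at
      \<open>r\<close>.\<close>
    then have "v \<in> V2 \<or> (r, v) \<in> conn E1"
    proof (induction rule: conn_induct)
      case (step x y)
      show ?case
      proof (cases "y \<in> V2")
        case False
        obtain p q where pq: "(p, q) \<in> E" "{p, q} = {x, y}" using step(2) by blast
        show ?thesis
        proof (cases "(p, q) = ?e")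
          case True
          then have "{x, y} = {r, c}"
            using pq by (auto simp: ed_def max_def min_def split: if_splits)
          then show ?thesis using False c by (auto simp: doubleton_eq_iff)
        next
          case neq: False
          then have "x \<notin> V2" using same[of p q] pq False by (auto simp: doubleton_eq_iff)
          then have "(p, q) \<in> E1" using cross[of p q] neq pq False
            by (auto simp: E2 doubleton_eq_iff)
          moreover have "(r, x) \<in> conn E1" using step \<open>x \<notin> V2\<close> by blast
          ultimately have "(r, y) \<in> conn E1"
            using pq by (intro conn_adj[of r x E1 y]) (auto simp: doubleton_eq_iff)
          then show ?thesis by blast
        qed
      qed simp
    qed simp
    then show ?thesis using that by blast
  qed
  have conn2: "(c, v) \<in> conn E2" if "v \<in> V2" for v
    using conn_component[of c v "E - {?e}"] that unfolding V2 E2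
    by (auto elim: conn_mono)
  have "(u, v) \<in> conn E1" if "u \<in> V - V2" "v \<in> V - V2" for u v
    using conn_trans[OF conn_sym[OF conn1[OF that(1)]] conn1[OF that(2)]] .
  then show "is_tree (V - V2) E1"
    unfolding is_tree_def using fin r EV bridge[of _ _ E1] by (auto simp: E1 bip_def)
  have "(u, v) \<in> conn E2" if "u \<in> V2" "v \<in> V2" for u v
    using conn_trans[OF conn_sym[OF conn2[OF that(1)]] conn2[OF that(2)]] .
  then show "is_tree V2 E2"
    unfolding is_tree_def using fin c sub EV bridge[of _ _ E2] finite_subset
    by (auto simp: E2 bip_def)
qed

text \<open>The branches at \<open>r\<close> are the components left by removing all edges at
  \<open>r\<close>. The last departure from \<open>r\<close> on a walk to \<open>m\<close> gives a
  branch; if two branches reached \<open>m\<close>, joining them would bypass a bridge.\<close>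

lemma is_tree_branch_unique:
  assumes t: "is_tree V E" and "r \<in> V" "m \<in> V" "m \<noteq> r"
  shows "\<exists>!c. ed r c \<in> E \<and> (c, m) \<in> conn (E - {ed r c})"
proof -
  define F where "F = {(x, y) \<in> E. x \<noteq> r \<and> y \<noteq> r}"
  have F_sub: "F \<subseteq> E - {ed r c}" for c
    by (auto simp: F_def ed_def max_def min_def)
  have "(r, m) \<in> conn E" using assms by (auto simp: is_tree_def)
  then have "m = r \<or> (\<exists>c. ed r c \<in> E \<and> (c, m) \<in> conn F)"
  proof (induction rule: conn_induct)
    case (step x y)
    obtain p q where pq: "(p, q) \<in> E" "{p, q} = {x, y}" using step(2) by blast
    then have xy: "(p, q) = ed x y"
      using t by (auto simp: is_tree_def bip_def ed_def doubleton_eq_iff max_def min_def)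
    show ?case
    proof (cases "y = r \<or> x = r")
      case True
      then show ?thesis using pq xy by auto
    next
      case False
      then have "(p, q) \<in> F" using pq by (auto simp: F_def doubleton_eq_iff)
      then have "(x, y) \<in> conn F" using xy conn_ed by metis
      with step False show ?thesis using conn_trans by metis
    qed
  qed simp
  then obtain c where c: "ed r c \<in> E" "(c, m) \<in> conn F" using \<open>m \<noteq> r\<close> by blast
  \<comment> \<open>A walk from \<open>d\<close> through \<open>r\<close> would bypass the bridge
    from \<open>r\<close> to \<open>d\<close>, so the walk to \<open>m\<close> uses no edge at
    \<open>r\<close>.\<close>
  have avoid: "(d, m) \<in> conn F" if "ed r d \<in> E" "(d, m) \<in> conn (E - {ed r d})" for d
  proof -
    have "(d, r) \<notin> conn (E - {ed r d})"
      using is_tree_bridge[OF t that(1)] conn_sym by metis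
    then show ?thesis
      using conn_component[OF that(2)] by (auto simp: F_def elim!: conn_mono)
  qed
  show ?thesis
  proof (rule ex1I[of _ c])
    show "ed r c \<in> E \<and> (c, m) \<in> conn (E - {ed r c})"
      using c conn_mono[OF c(2) F_sub] by blast
  next
    fix d assume d: "ed r d \<in> E \<and> (d, m) \<in> conn (E - {ed r d})"
    show "d = c"
    proof (rule ccontr)
      assume "d \<noteq> c"
      have "(c, d) \<in> conn F" using avoid[of d] d c conn_sym conn_trans by metis
      then have "(c, d) \<in> conn (E - {ed r c})" using F_sub by (rule conn_mono)
      moreover have "ed r d \<noteq> ed r c"
        using \<open>d \<noteq> c\<close> by (auto simp: ed_def max_def min_def split: if_splits)
      then have "(r, d) \<in> conn (E - {ed r c})" using d by (intro conn_ed) auto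
      ultimately have "(r, c) \<in> conn (E - {ed r c})" using conn_sym conn_trans by metis
      then show False using is_tree_bridge[OF t c(1)] by blast
    qed
  qed
qed

lemma is_tree_image:
  assumes t: "is_tree V E" and inj: "inj_on \<pi> V" and sgn: "\<And>v. v \<in> V \<Longrightarrow> sgn (\<pi> v) = sgn v"
  shows "is_tree (\<pi> ` V) (map_prod \<pi> \<pi> ` E)"
proof -
  let ?E = "map_prod \<pi> \<pi> ` E"
  have EV: "E \<subseteq> bip V" using t by (simp add: is_tree_def)
  have "\<pi> v \<noteq> 0" if "v \<in> V" for v
    using sgn[OF that] t that by (auto simp: is_tree_def sgn_0_0)
  then have "0 \<notin> \<pi> ` V" by force
  moreover have "?E \<subseteq> bip (\<pi> ` V)"
  proof -
    have "0 < \<pi> b" if "b \<in> V" "0 < b" for b using sgn[OF that(1)] that(2) by (simp add: sgn_1_pos)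
    moreover have "\<pi> b < 0" if "b \<in> V" "b < 0" for b using sgn[OF that(1)] that(2) by (simp add: sgn_1_neg)
    ultimately show ?thesis using EV by (auto simp: bip_def)
  qed
  moreover have "(\<pi> u, \<pi> v) \<in> conn ?E" if "u \<in> V" "v \<in> V" for u v
  proof (rule conn_image[of u v E \<pi>])
    show "(u, v) \<in> conn E" using t that by (simp add: is_tree_def)
    show "(\<pi> x, \<pi> y) \<in> conn ?E" if "(x, y) \<in> E" for x y
      by (rule conn_edge) (use that in force)
  qed
  moreover have "(u, v) \<notin> conn (?E - {(u, v)})" if uv: "(u, v) \<in> ?E" for u v
  proof
    assume conn: "(u, v) \<in> conn (?E - {(u, v)})"
    let ?\<rho> = "inv_into V \<pi>"
    obtain x y where xy: "(x, y) \<in> E" "u = \<pi> x" "v = \<pi> y" using uv by auto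
    have "(?\<rho> u, ?\<rho> v) \<in> conn (E - {(x, y)})"
      using conn
    proof (rule conn_image)
      fix p q assume "(p, q) \<in> ?E - {(u, v)}"
      then obtain x' y' where "(x', y') \<in> E - {(x, y)}" "p = \<pi> x'" "q = \<pi> y'"
        using xy by auto
      then show "(?\<rho> p, ?\<rho> q) \<in> conn (E - {(x, y)})"
        using EV inj by (intro conn_edge) (auto simp: bip_def subset_iff)
    qed
    moreover have "?\<rho> u = x" "?\<rho> v = y" using xy EV inj by (auto simp: bip_def subset_iff)
    ultimately show False using t xy unfolding is_tree_def by blast
  qed
  moreover have "finite (\<pi> ` V)" "\<pi> ` V \<noteq> {}" using t by (simp_all add: is_tree_def)
  ultimately show ?thesis unfolding is_tree_def by blast
qed

section \<open>Sums over trees\<close>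

definition inc :: "(int \<times> int) set \<Rightarrow> int \<Rightarrow> (int \<times> int) set" where
  "inc E v = {e \<in> E. fst e = v \<or> snd e = v}"

definition vertex_weight ::
  "('n multiset \<Rightarrow> real) \<Rightarrow> ('n multiset \<Rightarrow> real) \<Rightarrow> int \<Rightarrow> 'n multiset \<Rightarrow> real" where
  "vertex_weight \<sigma> \<gamma> v = (if 0 < v then \<sigma> else \<gamma>)"

text \<open>\<open>x v\<close> are the indices at \<open>v\<close> that do not come from edges of \<open>E\<close>.\<close>
definition graph_weight ::
  "('n::finite multiset \<Rightarrow> real) \<Rightarrow> ('n multiset \<Rightarrow> real) \<Rightarrow> int set \<Rightarrow> (int \<times> int) set \<Rightarrow>
   (int \<Rightarrow> 'n multiset) \<Rightarrow> real" where
  "graph_weight \<sigma> \<gamma> V E x = (\<Sum>\<iota>\<in>E \<rightarrow>\<^sub>E UNIV.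
     \<Prod>v\<in>V. vertex_weight \<sigma> \<gamma> v (x v + image_mset \<iota> (mset_set (inc E v))))"

definition tree_sum ::
  "('n::finite multiset \<Rightarrow> real) \<Rightarrow> ('n multiset \<Rightarrow> real) \<Rightarrow> int set \<Rightarrow> int \<Rightarrow> 'n multiset \<Rightarrow> real" where
  "tree_sum \<sigma> \<gamma> V r a = (\<Sum>E | is_tree V E. graph_weight \<sigma> \<gamma> V E ((\<lambda>_. {#})(r := a)))"

lemma graph_weight_cong:
  "(\<And>v. v \<in> V \<Longrightarrow> x v = y v) \<Longrightarrow> graph_weight \<sigma> \<gamma> V E x = graph_weight \<sigma> \<gamma> V E y"
  by (simp add: graph_weight_def)

lemma finite_inc: "finite E \<Longrightarrow> finite (inc E v)"
  by (simp add: inc_def)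

lemma inc_insert_Un:
  "inc (insert e (E1 \<union> E2)) v = (if fst e = v \<or> snd e = v then {e} else {}) \<union> inc E1 v \<union> inc E2 v"
  by (auto simp: inc_def)

text \<open>With the value i on the joining edge fixed, i is an extra index at both its ends, and
  the sum over the other indices factors into the two sides.\<close>

lemma graph_weight_insert_edge:
  assumes V: "finite V1" "finite V2" "V1 \<inter> V2 = {}" and E: "E1 \<subseteq> bip V1" "E2 \<subseteq> bip V2"
    and rc: "r \<in> V1" "c \<in> V2" "opp r c"
  shows "graph_weight \<sigma> \<gamma> (V1 \<union> V2) (insert (ed r c) (E1 \<union> E2)) x =
    (\<Sum>i\<in>UNIV. graph_weight \<sigma> \<gamma> V1 E1 (x(r := add_mset i (x r))) *
                 graph_weight \<sigma> \<gamma> V2 E2 (x(c := add_mset i (x c))))"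
proof -
  let ?e = "ed r c" and ?E = "insert (ed r c) (E1 \<union> E2)"
  let ?w = "\<lambda>V E x \<iota>. \<Prod>v\<in>V. vertex_weight \<sigma> \<gamma> v (x v + image_mset \<iota> (mset_set (inc E v)))"
  have fin: "finite E1" "finite E2"
    using E V finite_bip finite_subset by metis+
  have e: "?e \<notin> E1" "?e \<notin> E2"
    using E ed_in_bip V rc by blast+
  have E12: "E1 \<inter> E2 = {}" using E V by (auto simp: bip_def)
  have vert: "fst ?e = v \<or> snd ?e = v \<longleftrightarrow> v = r \<or> v = c" for v
    by (auto simp: ed_def max_def min_def)
  have no: "inc E2 v = {}" if "v \<in> V1" for v
    using that V E by (auto simp: inc_def bip_def)
  have no': "inc E1 v = {}" if "v \<in> V2" for v
    using that V E by (auto simp: inc_def bip_def)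
  have inc1: "inc ?E v = (if v = r then insert ?e (inc E1 v) else inc E1 v)" if "v \<in> V1" for v
    using that rc V(3) unfolding inc_insert_Un vert no[OF that] by auto
  have inc2: "inc ?E v = (if v = c then insert ?e (inc E2 v) else inc E2 v)" if "v \<in> V2" for v
    using that rc V(3) unfolding inc_insert_Un vert no'[OF that] by auto
  \<comment> \<open>Reassembles a labelling from its value on the new edge and its restrictions to
    both sides; \<open>undefined\<close> elsewhere keeps it in the extensional function
    space.\<close>
  define join where "join i \<iota>1 \<iota>2 = (\<lambda>e. if e = ?e then i else if e \<in> E1 then \<iota>1 e
      else if e \<in> E2 then \<iota>2 e else undefined)" for i :: 'a and \<iota>1 \<iota>2
  have im1: "image_mset (join i \<iota>1 \<iota>2) (mset_set (inc E1 v)) = image_mset \<iota>1 (mset_set (inc E1 v))"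
    for i \<iota>1 \<iota>2 v
    using e fin by (intro image_mset_cong) (auto simp: join_def finite_inc inc_def)
  have im2: "image_mset (join i \<iota>1 \<iota>2) (mset_set (inc E2 v)) = image_mset \<iota>2 (mset_set (inc E2 v))"
    for i \<iota>1 \<iota>2 v
    using e fin E12 by (intro image_mset_cong) (auto simp: join_def finite_inc inc_def)
  have w: "?w (V1 \<union> V2) ?E x (join i \<iota>1 \<iota>2) =
      ?w V1 E1 (x(r := add_mset i (x r))) \<iota>1 * ?w V2 E2 (x(c := add_mset i (x c))) \<iota>2" for i \<iota>1 \<iota>2
  proof -
    have notin: "?e \<notin> inc E1 v" "?e \<notin> inc E2 v" for v using e by (auto simp: inc_def)
    have "?w V1 ?E x (join i \<iota>1 \<iota>2) = ?w V1 E1 (x(r := add_mset i (x r))) \<iota>1"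
      by (intro prod.cong refl) (simp add: inc1 im1 notin fin finite_inc, simp add: join_def)
    moreover have "?w V2 ?E x (join i \<iota>1 \<iota>2) = ?w V2 E2 (x(c := add_mset i (x c))) \<iota>2"
      by (intro prod.cong refl) (simp add: inc2 im2 notin fin finite_inc, simp add: join_def)
    ultimately show ?thesis using V by (simp add: prod.union_disjoint)
  qed
  have "(\<Sum>i\<in>UNIV. graph_weight \<sigma> \<gamma> V1 E1 (x(r := add_mset i (x r))) *
          graph_weight \<sigma> \<gamma> V2 E2 (x(c := add_mset i (x c)))) =
      (\<Sum>i\<in>UNIV. \<Sum>\<iota>1\<in>E1 \<rightarrow>\<^sub>E UNIV. \<Sum>\<iota>2\<in>E2 \<rightarrow>\<^sub>E UNIV. ?w (V1 \<union> V2) ?E x (join i \<iota>1 \<iota>2))"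
    unfolding w by (simp add: graph_weight_def sum_product)
  also have "\<dots> = (\<Sum>(i, \<iota>1, \<iota>2)\<in>UNIV \<times> (E1 \<rightarrow>\<^sub>E UNIV) \<times> (E2 \<rightarrow>\<^sub>E UNIV).
      ?w (V1 \<union> V2) ?E x (join i \<iota>1 \<iota>2))"
    by (simp only: sum.cartesian_product)
  also have "\<dots> = graph_weight \<sigma> \<gamma> (V1 \<union> V2) ?E x"
    unfolding graph_weight_def
  proof (rule sum.reindex_bij_witness[of _ "\<lambda>\<iota>. (\<iota> ?e, restrict \<iota> E1, restrict \<iota> E2)"
        "\<lambda>(i, \<iota>1, \<iota>2). join i \<iota>1 \<iota>2"], goal_cases)
    case (1 p)
    then obtain i \<iota>1 \<iota>2 where p: "p = (i, \<iota>1, \<iota>2)" "\<iota>1 \<in> E1 \<rightarrow>\<^sub>E UNIV" "\<iota>2 \<in> E2 \<rightarrow>\<^sub>E UNIV" by auto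
    have "restrict (join i \<iota>1 \<iota>2) E1 = \<iota>1"
      by (rule PiE_ext[OF _ p(2)]) (use e in \<open>auto simp: join_def\<close>)
    moreover have "restrict (join i \<iota>1 \<iota>2) E2 = \<iota>2"
      by (rule PiE_ext[OF _ p(3)]) (use e E12 in \<open>auto simp: join_def\<close>)
    ultimately show ?case by (simp add: p(1)) (simp add: join_def)
  next
    case (2 p)
    then show ?case by (auto simp: join_def PiE_def extensional_def)
  next
    case (3 \<iota>)
    then show ?case by (auto simp: join_def fun_eq_iff PiE_def extensional_def)
  next
    case (4 \<iota>)
    then show ?case by auto
  next
    case (5 p)
    then show ?case by auto
  qed
  finally show ?thesis by simp
qed

text \<open>Cutting the edge at the root \<open>r\<close> that leads to the marked vertex \<open>m\<close>.\<close>
lemma tree_sum_branch: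
  assumes V: "finite V" and rm: "r \<in> V" "m \<in> V" "m \<noteq> r"
  shows "tree_sum \<sigma> \<gamma> V r a = (\<Sum>V2 | V2 \<subseteq> V - {r} \<and> m \<in> V2. \<Sum>c | c \<in> V2 \<and> opp r c. \<Sum>i\<in>UNIV.
    tree_sum \<sigma> \<gamma> (V - V2) r (add_mset i a) * tree_sum \<sigma> \<gamma> V2 c {#i#})"
proof -
  let ?S = "\<lambda>V2 c. {E1. is_tree (V - V2) E1} \<times> {E2. is_tree V2 E2}"
  let ?D = "SIGMA V2 : {V2. V2 \<subseteq> V - {r} \<and> m \<in> V2}. SIGMA c : {c. c \<in> V2 \<and> opp r c}. ?S V2 c"
  let ?F = "\<lambda>(V2, c, E1, E2). insert (ed r c) (E1 \<union> E2)"
  \<comment> \<open>The data can be read off the assembled tree: \<open>c\<close> from the branch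
    that contains \<open>m\<close>, \<open>V2\<close> as its component, and the two edge sets by
    restriction. Injectivity of the assembly follows.\<close>
  have fact: "V2 = {v. (c, v) \<in> conn (E - {ed r c})}" "E2 = E \<inter> (V2 \<times> V2)"
    "E1 = E \<inter> ((V - V2) \<times> (V - V2))" "(c, m) \<in> conn (E - {ed r c})" "is_tree V E"
    if "(V2, c, E1, E2) \<in> ?D" and E: "E = insert (ed r c) (E1 \<union> E2)" for V2 c E1 E2 E
  proof -
    have d: "V2 \<subseteq> V" "r \<notin> V2" "m \<in> V2" "c \<in> V2" "opp r c" "is_tree (V - V2) E1" "is_tree V2 E2"
      using that by auto
    then have E12: "E1 \<subseteq> bip (V - V2)" "E2 \<subseteq> bip V2" by (auto simp: is_tree_def)
    have e: "ed r c \<notin> bip V2" "ed r c \<notin> bip (V - V2)"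
      using d by (auto simp: ed_in_bip)
    have Ee: "E - {ed r c} = E1 \<union> E2" using E e E12 by auto
    have conn2: "(c, v) \<in> conn (E1 \<union> E2)" if "v \<in> V2" for v
    proof (rule conn_mono)
      show "(c, v) \<in> conn E2" using d that by (simp add: is_tree_def)
    qed simp
    have "v \<in> V2" if "(c, v) \<in> conn (E1 \<union> E2)" for v
      using that d(4) by (rule conn_invariant) (use E12 in \<open>auto simp: bip_def\<close>)
    then show "V2 = {v. (c, v) \<in> conn (E - {ed r c})}" using conn2 Ee by auto
    show "(c, m) \<in> conn (E - {ed r c})" using conn2 Ee d by simp
    have "ed r c \<notin> V2 \<times> V2" "ed r c \<notin> (V - V2) \<times> (V - V2)"
      using d by (auto simp: ed_def max_def min_def)
    then show "E2 = E \<inter> (V2 \<times> V2)" "E1 = E \<inter> ((V - V2) \<times> (V - V2))"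
      using E E12 by (auto simp: bip_def)
    have "is_tree ((V - V2) \<union> V2) E"
      unfolding E using d rm by (intro is_tree_insert_edge) auto
    moreover have "(V - V2) \<union> V2 = V" using d(1) by blast
    ultimately show "is_tree V E" by simp
  qed
  have "bij_betw ?F ?D {E. is_tree V E}"
    unfolding bij_betw_def
  proof (intro conjI equalityI subsetI)
    show "inj_on ?F ?D"
    proof (rule inj_onI)
      fix d d' assume D: "d \<in> ?D" "d' \<in> ?D" and F: "?F d = ?F d'"
      obtain V2 c E1 E2 where d: "d = (V2, c, E1, E2)" by (cases d) auto
      obtain V2' c' E1' E2' where d': "d' = (V2', c', E1', E2')" by (cases d') auto
      define E where "E = ?F d"
      note f = fact[OF D(1)[unfolded d], of E] and f' = fact[OF D(2)[unfolded d'], of E]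
      have E: "E = insert (ed r c) (E1 \<union> E2)" "E = insert (ed r c') (E1' \<union> E2')"
        using F by (simp_all add: E_def d d')
      have "c = c'"
        using is_tree_branch_unique[OF f(5)[OF E(1)] rm] E f(4)[OF E(1)] f'(4)[OF E(2)] by blast
      moreover from this have "V2 = V2'" using f(1)[OF E(1)] f'(1)[OF E(2)] by simp
      ultimately show "d = d'"
        using f(2,3)[OF E(1)] f'(2,3)[OF E(2)] d d' by simp
    qed
  next
    fix E assume "E \<in> ?F ` ?D"
    then obtain V2 c E1 E2 where "(V2, c, E1, E2) \<in> ?D" "E = insert (ed r c) (E1 \<union> E2)" by auto
    from fact(5)[OF this] show "E \<in> {E. is_tree V E}" by simp
  next
    fix E assume "E \<in> {E. is_tree V E}"
    then have t: "is_tree V E" by simp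
    obtain c where c: "ed r c \<in> E" "(c, m) \<in> conn (E - {ed r c})"
      using is_tree_branch_unique[OF t rm] by blast
    note s = is_tree_remove_edge[OF t c(1) refl refl refl]
    let ?V2 = "{v. (c, v) \<in> conn (E - {ed r c})}"
    have "(?V2, c, E \<inter> ((V - ?V2) \<times> (V - ?V2)), E \<inter> (?V2 \<times> ?V2)) \<in> ?D"
      using s(1-4,6,7) c(2) by (intro SigmaI) blast+
    then show "E \<in> ?F ` ?D" by (rule rev_image_eqI) (use s(5) in simp)
  qed
  then have "tree_sum \<sigma> \<gamma> V r a = (\<Sum>d\<in>?D. graph_weight \<sigma> \<gamma> V (?F d) ((\<lambda>_. {#})(r := a)))"
    unfolding tree_sum_def by (rule sum.reindex_bij_betw[symmetric])
  also have "\<dots> = (\<Sum>(V2, c, E1, E2)\<in>?D. \<Sum>i\<in>UNIV.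
      graph_weight \<sigma> \<gamma> (V - V2) E1 ((\<lambda>_. {#})(r := add_mset i a)) *
      graph_weight \<sigma> \<gamma> V2 E2 ((\<lambda>_. {#})(c := {#i#})))"
  proof (rule sum.cong[OF refl], clarify)
    fix V2 c E1 E2
    assume d: "V2 \<subseteq> V - {r}" "m \<in> V2" "c \<in> V2" "opp r c" "is_tree (V - V2) E1" "is_tree V2 E2"
    have VV: "(V - V2) \<union> V2 = V" using d by auto
    have cr: "c \<noteq> r" using d by auto
    have "graph_weight \<sigma> \<gamma> ((V - V2) \<union> V2) (insert (ed r c) (E1 \<union> E2)) ((\<lambda>_. {#})(r := a)) =
       (\<Sum>i\<in>UNIV. graph_weight \<sigma> \<gamma> (V - V2) E1 ((\<lambda>_. {#})(r := a, r := add_mset i a)) *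
          graph_weight \<sigma> \<gamma> V2 E2 ((\<lambda>_. {#})(r := a, c := {#i#})))"
      using d V rm cr finite_subset[of V2 V] by (subst graph_weight_insert_edge) (auto simp: is_tree_def)
    also have "\<dots> = (\<Sum>i\<in>UNIV. graph_weight \<sigma> \<gamma> (V - V2) E1 ((\<lambda>_. {#})(r := add_mset i a)) *
          graph_weight \<sigma> \<gamma> V2 E2 ((\<lambda>_. {#})(c := {#i#})))"
      using d by (intro sum.cong refl arg_cong2[where f = "(*)"] graph_weight_cong) auto
    finally show "graph_weight \<sigma> \<gamma> V (insert (ed r c) (E1 \<union> E2)) ((\<lambda>_. {#})(r := a)) = \<dots>"
      by (simp only: VV)
  qed
  also have "\<dots> = (\<Sum>V2 | V2 \<subseteq> V - {r} \<and> m \<in> V2. \<Sum>c | c \<in> V2 \<and> opp r c.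
      \<Sum>(E1, E2)\<in>?S V2 c. \<Sum>i\<in>UNIV.
      graph_weight \<sigma> \<gamma> (V - V2) E1 ((\<lambda>_. {#})(r := add_mset i a)) *
      graph_weight \<sigma> \<gamma> V2 E2 ((\<lambda>_. {#})(c := {#i#})))"
  proof -
    have fin: "finite {V2. V2 \<subseteq> V - {r} \<and> m \<in> V2}"
      by (rule finite_subset[of _ "Pow V"]) (use V in auto)
    have fin2: "finite {c. c \<in> V2 \<and> opp r c}" "finite (?S V2 c)" if "V2 \<subseteq> V - {r} \<and> m \<in> V2" for V2 c
    proof -
      have "finite V2" using that V finite_subset by blast
      then show "finite {c. c \<in> V2 \<and> opp r c}" "finite (?S V2 c)"
        using V by (auto intro: finite_trees)
    qed
    show ?thesis
      using fin fin2 by (simp add: sum.Sigma finite_SigmaI)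
  qed
  also have "\<dots> = (\<Sum>V2 | V2 \<subseteq> V - {r} \<and> m \<in> V2. \<Sum>c | c \<in> V2 \<and> opp r c. \<Sum>i\<in>UNIV.
    tree_sum \<sigma> \<gamma> (V - V2) r (add_mset i a) * tree_sum \<sigma> \<gamma> V2 c {#i#})"
  proof (intro sum.cong refl)
    fix V2 c
    show "(\<Sum>(E1, E2)\<in>?S V2 c. \<Sum>i\<in>UNIV.
      graph_weight \<sigma> \<gamma> (V - V2) E1 ((\<lambda>_. {#})(r := add_mset i a)) *
      graph_weight \<sigma> \<gamma> V2 E2 ((\<lambda>_. {#})(c := {#i#}))) =
      (\<Sum>i\<in>UNIV. tree_sum \<sigma> \<gamma> (V - V2) r (add_mset i a) * tree_sum \<sigma> \<gamma> V2 c {#i#})"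
      unfolding tree_sum_def sum_product
      by (simp only: sum.cartesian_product[symmetric]) (subst sum.swap, rule sum.swap)
  qed
  finally show ?thesis .
qed

text \<open>The leaf sees a single index and contributes \<sigma> there. The condition on
  \<open>x v\<close> keeps out a root that carries extra indices.\<close>

lemma graph_weight_black_leaf:
  assumes "\<And>i. \<sigma> {#i#} = 0" "finite V" "v \<in> V" "0 < v" "card (inc E v) = 1" "x v = {#}"
  shows "graph_weight \<sigma> \<gamma> V E x = 0"
proof -
  obtain e where "inc E v = {e}" using assms(5) by (auto simp: card_1_singleton_iff)
  then have "vertex_weight \<sigma> \<gamma> v (x v + image_mset \<iota> (mset_set (inc E v))) = 0" for \<iota>
    using assms by (simp add: vertex_weight_def)
  then show ?thesis
    unfolding graph_weight_def using assms by (intro sum.neutral ballI prod_zero bexI[of _ v]) auto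
qed

section \<open>Invariance under colour-preserving relabelling\<close>

lemma inc_image:
  assumes E: "E \<subseteq> V \<times> V" and inj: "inj_on \<pi> V" and v: "v \<in> V"
  shows "inc (map_prod \<pi> \<pi> ` E) (\<pi> v) = map_prod \<pi> \<pi> ` inc E v"
proof -
  let ?p = "map_prod \<pi> \<pi>"
  have "fst (?p e) = \<pi> v \<or> snd (?p e) = \<pi> v \<longleftrightarrow> fst e = v \<or> snd e = v" if "e \<in> E" for e
    using that v inj_onD[OF inj] E by (cases e) auto
  then have "{e \<in> E. fst (?p e) = \<pi> v \<or> snd (?p e) = \<pi> v} = inc E v"
    by (auto simp: inc_def)
  moreover have "inc (?p ` E) (\<pi> v) = ?p ` {e \<in> E. fst (?p e) = \<pi> v \<or> snd (?p e) = \<pi> v}"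
    by (auto simp: inc_def)
  ultimately show ?thesis by simp
qed

lemma graph_weight_image:
  assumes V: "finite V" "E \<subseteq> bip V" and inj: "inj_on \<pi> V"
    and sgn: "\<And>v. v \<in> V \<Longrightarrow> sgn (\<pi> v) = sgn v"
  shows "graph_weight \<sigma> \<gamma> (\<pi> ` V) (map_prod \<pi> \<pi> ` E) x = graph_weight \<sigma> \<gamma> V E (x \<circ> \<pi>)"
proof -
  let ?p = "map_prod \<pi> \<pi>"
  have EVV: "E \<subseteq> V \<times> V" using V by (auto simp: bip_def)
  have injE: "inj_on ?p E"
    using map_prod_inj_on[OF inj inj] EVV by (rule inj_on_subset)
  note inc = inc_image[OF EVV inj]
  have vw: "vertex_weight \<sigma> \<gamma> (\<pi> v) = vertex_weight \<sigma> \<gamma> v" if "v \<in> V" for v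
    using sgn[OF that] sgn_1_pos unfolding vertex_weight_def by metis
  have w: "(\<Prod>v\<in>\<pi> ` V. vertex_weight \<sigma> \<gamma> v (x v + image_mset \<iota> (mset_set (inc (?p ` E) v)))) =
      (\<Prod>v\<in>V. vertex_weight \<sigma> \<gamma> v ((x \<circ> \<pi>) v + image_mset (restrict (\<iota> \<circ> ?p) E) (mset_set (inc E v))))"
    for \<iota>
  proof -
    have "image_mset \<iota> (mset_set (inc (?p ` E) (\<pi> v))) = image_mset (restrict (\<iota> \<circ> ?p) E) (mset_set (inc E v))"
      if "v \<in> V" for v
    proof -
      have "finite (inc E v)" using V finite_bip finite_subset finite_inc by metis
      moreover have "inj_on ?p (inc E v)" using injE by (rule inj_on_subset) (auto simp: inc_def)
      ultimately have "image_mset \<iota> (mset_set (inc (?p ` E) (\<pi> v))) = image_mset (\<iota> \<circ> ?p) (mset_set (inc E v))"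
        by (simp add: inc[OF that] image_mset_mset_set[symmetric] multiset.map_comp)
      also have "\<dots> = image_mset (restrict (\<iota> \<circ> ?p) E) (mset_set (inc E v))"
        using \<open>finite (inc E v)\<close> by (intro image_mset_cong) (auto simp: inc_def)
      finally show ?thesis .
    qed
    then show ?thesis
      by (subst prod.reindex[OF inj]) (auto simp: vw intro!: prod.cong)
  qed
  show ?thesis
    unfolding graph_weight_def w
  proof (rule sum.reindex_bij_witness[of _ "\<lambda>\<kappa>. restrict (\<kappa> \<circ> inv_into E ?p) (?p ` E)"
        "\<lambda>\<iota>. restrict (\<iota> \<circ> ?p) E"], goal_cases)
    case (1 \<iota>)
    show ?case
      by (rule PiE_ext[OF _ 1]) (use inv_into_into[of _ ?p E] f_inv_into_f[of _ ?p E] in force)+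
  next
    case (3 \<kappa>)
    show ?case
      by (rule PiE_ext[OF _ 3]) (use injE in auto)
  qed auto
qed

lemma tree_sum_image:
  assumes V: "finite V" and r: "r \<in> V" and inj: "inj_on \<pi> V"
    and sgn: "\<And>v. v \<in> V \<Longrightarrow> sgn (\<pi> v) = sgn v"
  shows "tree_sum \<sigma> \<gamma> (\<pi> ` V) (\<pi> r) a = tree_sum \<sigma> \<gamma> V r a"
proof -
  let ?\<rho> = "inv_into V \<pi>"
  have inj': "inj_on ?\<rho> (\<pi> ` V)" by (rule inj_on_inv_into) simp
  have sgn': "sgn (?\<rho> v) = sgn v" if "v \<in> \<pi> ` V" for v
    using sgn[of "?\<rho> v"] that by (simp add: inv_into_into f_inv_into_f)
  have VV: "?\<rho> ` \<pi> ` V = V" using inj by (rule inv_into_image_cancel) simp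
  have E: "E \<subseteq> V \<times> V" if "is_tree V E" for E V using that by (auto simp: is_tree_def bip_def)
  have "tree_sum \<sigma> \<gamma> V r a =
     (\<Sum>E | is_tree (\<pi> ` V) E. graph_weight \<sigma> \<gamma> (\<pi> ` V) E ((\<lambda>_. {#})(\<pi> r := a)))"
    unfolding tree_sum_def
  proof (rule sum.reindex_bij_witness[of _ "(`) (map_prod ?\<rho> ?\<rho>)" "(`) (map_prod \<pi> \<pi>)"], goal_cases)
    case (1 F)
    then have "F \<subseteq> V \<times> V" using E by simp
    then show ?case using inj by (force simp: image_image)
  next
    case (2 F)
    then show ?case using is_tree_image[OF _ inj sgn] by simp
  next
    case (3 F)
    then have "F \<subseteq> \<pi> ` V \<times> \<pi> ` V" using E by simp
    then show ?case by (force simp: image_image f_inv_into_f)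
  next
    case (4 F)
    then show ?case using is_tree_image[OF _ inj' sgn'] VV by simp
  next
    case (5 F)
    then have "F \<subseteq> bip V" by (simp add: is_tree_def)
    then have "graph_weight \<sigma> \<gamma> (\<pi> ` V) (map_prod \<pi> \<pi> ` F) ((\<lambda>_. {#})(\<pi> r := a)) =
       graph_weight \<sigma> \<gamma> V F ((\<lambda>_. {#})(\<pi> r := a) \<circ> \<pi>)"
      using V inj sgn by (intro graph_weight_image)
    also have "\<dots> = graph_weight \<sigma> \<gamma> V F ((\<lambda>_. {#})(r := a))"
      using inj r by (intro graph_weight_cong) (auto simp: inj_on_def)
    finally show ?case by simp
  qed
  then show ?thesis by (simp add: tree_sum_def)
qed

lemma bij_betw_with_point:
  assumes "finite A" "finite B" "card A = card B" "a \<in> A \<longleftrightarrow> b \<in> B"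
  obtains f where "bij_betw f A B" "a \<in> A \<Longrightarrow> f a = b"
proof (cases "a \<in> A")
  case True
  then have "card (A - {a}) = card (B - {b})" using assms by (metis card_Diff_singleton)
  then obtain f where f: "bij_betw f (A - {a}) (B - {b})"
    using assms finite_same_card_bij[of "A - {a}" "B - {b}"] by auto
  then have "bij_betw (f(a := b)) (insert a (A - {a})) (insert b (B - {b}))"
    by (intro bij_betw_combine[where A = "{a}" and B = "{b}", simplified])
      (auto simp: bij_betw_def inj_on_def)
  then show ?thesis using that[of "f(a := b)"] True assms by (simp add: insert_absorb)
next
  case False
  then show ?thesis using that assms finite_same_card_bij[of A B] by auto
qed

text \<open>Cutting an edge leaves trees on arbitrary vertex sets. A bijection built colour by
  colour, with root going to root, brings them back to the standard sets
  \<open>vertices n k\<close>.\<close>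

lemma tree_sum_card_cong:
  assumes V: "finite V" "0 \<notin> V" "r \<in> V" and V': "finite V'" "0 \<notin> V'" "r' \<in> V'"
    and r: "sgn r = sgn r'"
    and card: "card {v \<in> V. 0 < v} = card {v \<in> V'. 0 < v}" "card {v \<in> V. v < 0} = card {v \<in> V'. v < 0}"
  shows "tree_sum \<sigma> \<gamma> V r a = tree_sum \<sigma> \<gamma> V' r' a"
proof -
  have rr: "0 < r \<longleftrightarrow> 0 < r'" "r < 0 \<longleftrightarrow> r' < 0"
    using r by (auto simp: sgn_if split: if_splits)
  obtain f where f: "bij_betw f {v \<in> V. 0 < v} {v \<in> V'. 0 < v}" "0 < r \<Longrightarrow> f r = r'"
    using bij_betw_with_point[of "{v \<in> V. 0 < v}" "{v \<in> V'. 0 < v}" r r'] V V' card rr by auto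
  obtain g where g: "bij_betw g {v \<in> V. v < 0} {v \<in> V'. v < 0}" "r < 0 \<Longrightarrow> g r = r'"
    using bij_betw_with_point[of "{v \<in> V. v < 0}" "{v \<in> V'. v < 0}" r r'] V V' card rr by auto
  define \<pi> where "\<pi> v = (if 0 < v then f v else g v)" for v
  have "bij_betw \<pi> {v \<in> V. 0 < v} {v \<in> V'. 0 < v}"
    using f(1) by (rule iffD1[OF bij_betw_cong, rotated]) (simp add: \<pi>_def)
  moreover have "bij_betw \<pi> {v \<in> V. v < 0} {v \<in> V'. v < 0}"
    using g(1) by (rule iffD1[OF bij_betw_cong, rotated]) (simp add: \<pi>_def)
  moreover have "{v \<in> V. 0 < v} \<union> {v \<in> V. v < 0} = V" if "0 \<notin> V" for V :: "int set"
    using that by (auto simp: neq_iff) (metis linorder_neqE)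
  ultimately have bij: "bij_betw \<pi> V V'"
    using bij_betw_combine[of \<pi> "{v \<in> V. 0 < v}" "{v \<in> V'. 0 < v}" "{v \<in> V. v < 0}" "{v \<in> V'. v < 0}"]
      V V' by (auto simp: Int_def)
  have "sgn (\<pi> v) = sgn v" if "v \<in> V" for v
  proof (cases "0 < v")
    case True
    then have "\<pi> v \<in> {v \<in> V'. 0 < v}" using f that by (auto simp: \<pi>_def bij_betw_def)
    then show ?thesis using True by simp
  next
    case False
    then have "v < 0" using that V by (metis linorder_neqE)
    moreover from this have "\<pi> v \<in> {v \<in> V'. v < 0}" using g that by (auto simp: \<pi>_def bij_betw_def)
    ultimately show ?thesis by simp
  qed
  moreover have "\<pi> r = r'"
    using f(2) g(2) V by (metis \<pi>_def linorder_neqE)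
  ultimately show ?thesis
    using tree_sum_image[of V r \<pi> \<sigma> \<gamma> a] bij V by (simp add: bij_betw_def)
qed

section \<open>Recursions in the numbers of black and white vertices\<close>

definition vertices :: "nat \<Rightarrow> nat \<Rightarrow> int set" where
  "vertices n k = {1..int n} \<union> {- int k..-1}"

lemma vertices_simps [simp]:
  "finite (vertices n k)" "0 \<notin> vertices n k"
  "card {v \<in> vertices n k. 0 < v} = n" "card {v \<in> vertices n k. v < 0} = k"
proof -
  have "{v \<in> vertices n k. 0 < v} = {1..int n}" "{v \<in> vertices n k. v < 0} = {- int k..-1}"
    by (auto simp: vertices_def)
  then show "card {v \<in> vertices n k. 0 < v} = n" "card {v \<in> vertices n k. v < 0} = k" by auto
qed (auto simp: vertices_def)

definition white_rooted ::
  "('n::finite multiset \<Rightarrow> real) \<Rightarrow> ('n multiset \<Rightarrow> real) \<Rightarrow> nat \<Rightarrow> nat \<Rightarrow> 'n multiset \<Rightarrow> real" where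
  "white_rooted \<sigma> \<gamma> n k a = tree_sum \<sigma> \<gamma> (vertices n (Suc k)) (-1) a"

definition black_rooted ::
  "('n::finite multiset \<Rightarrow> real) \<Rightarrow> ('n multiset \<Rightarrow> real) \<Rightarrow> nat \<Rightarrow> nat \<Rightarrow> 'n multiset \<Rightarrow> real" where
  "black_rooted \<sigma> \<gamma> n k a = tree_sum \<sigma> \<gamma> (vertices (Suc n) k) 1 a"

lemma tree_sum_eq_white_rooted:
  assumes "finite V" "0 \<notin> V" "r \<in> V" "r < 0"
  shows "tree_sum \<sigma> \<gamma> V r a =
    white_rooted \<sigma> \<gamma> (card {v \<in> V. 0 < v}) (card {v \<in> V. v < 0} - 1) a"
proof -
  have "0 < card {v \<in> V. v < 0}"
    using assms by (subst card_gt_0_iff) auto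
  then have "card {v \<in> V. v < 0} = Suc (card {v \<in> V. v < 0} - 1)" by simp
  then show ?thesis
    unfolding white_rooted_def using assms
    by (intro tree_sum_card_cong) (simp_all only: vertices_simps, auto simp: vertices_def)
qed

lemma tree_sum_eq_black_rooted:
  assumes "finite V" "0 \<notin> V" "r \<in> V" "0 < r"
  shows "tree_sum \<sigma> \<gamma> V r a =
    black_rooted \<sigma> \<gamma> (card {v \<in> V. 0 < v} - 1) (card {v \<in> V. v < 0}) a"
proof -
  have "0 < card {v \<in> V. 0 < v}"
    using assms by (subst card_gt_0_iff) auto
  then have "card {v \<in> V. 0 < v} = Suc (card {v \<in> V. 0 < v} - 1)" by simp
  then show ?thesis
    unfolding black_rooted_def using assms
    by (intro tree_sum_card_cong) (simp_all only: vertices_simps, auto simp: vertices_def)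
qed

lemma sum_Pow_card:
  fixes f :: "nat \<Rightarrow> real"
  assumes "finite A"
  shows "(\<Sum>X\<in>Pow A. f (card X)) = (\<Sum>j\<le>card A. real (card A choose j) * f j)"
proof -
  have "(\<Sum>X\<in>Pow A. f (card X)) = (\<Sum>j\<le>card A. \<Sum>X | X \<in> Pow A \<and> card X = j. f (card X))"
    using assms by (intro sum.group[symmetric]) (auto intro: card_mono)
  also have "\<dots> = (\<Sum>j\<le>card A. real (card A choose j) * f j)"
    using n_subsets[OF assms] by (intro sum.cong) simp_all
  finally show ?thesis .
qed

text \<open>The other vertices are distributed between the branch of the marked white vertex \<open>m\<close>
  and the rest.\<close>
lemma tree_sum_branch_card:
  fixes h :: "nat \<Rightarrow> nat \<Rightarrow> real"
  assumes V: "finite V" "0 \<notin> V" and rm: "r \<in> V" "m \<in> V" "m \<noteq> r" "m < 0"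
    and n: "n = card {v \<in> V - {r}. 0 < v}" and k: "k = card {v \<in> V - {r, m}. v < 0}"
    and h: "\<And>B W. B \<subseteq> {v \<in> V - {r}. 0 < v} \<Longrightarrow> W \<subseteq> {v \<in> V - {r, m}. v < 0} \<Longrightarrow>
      (\<Sum>c | c \<in> insert m (B \<union> W) \<and> opp r c. \<Sum>i\<in>UNIV.
        tree_sum \<sigma> \<gamma> (V - insert m (B \<union> W)) r (add_mset i a) *
        tree_sum \<sigma> \<gamma> (insert m (B \<union> W)) c {#i#}) = h (card B) (card W)"
  shows "tree_sum \<sigma> \<gamma> V r a = (\<Sum>j\<le>n. \<Sum>l\<le>k. real (n choose j) * real (k choose l) * h j l)"
proof -
  let ?B = "{v \<in> V - {r}. 0 < v}" and ?W = "{v \<in> V - {r, m}. v < 0}"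
  let ?f = "\<lambda>V2. \<Sum>c | c \<in> V2 \<and> opp r c. \<Sum>i\<in>UNIV.
        tree_sum \<sigma> \<gamma> (V - V2) r (add_mset i a) * tree_sum \<sigma> \<gamma> V2 c {#i#}"
  have "tree_sum \<sigma> \<gamma> V r a = (\<Sum>V2 | V2 \<subseteq> V - {r} \<and> m \<in> V2. ?f V2)"
    using V rm by (intro tree_sum_branch) auto
  also have "\<dots> = (\<Sum>(B, W)\<in>Pow ?B \<times> Pow ?W. h (card B) (card W))"
  proof (rule sum.reindex_bij_witness[of _ "\<lambda>(B, W). insert m (B \<union> W)"
        "\<lambda>V2. ({v \<in> V2. 0 < v}, {v \<in> V2 - {m}. v < 0})"], goal_cases)
    case (1 V2)
    have "0 \<notin> V2" using 1 V by auto
    then have "V2 = insert m ({v \<in> V2. 0 < v} \<union> {v \<in> V2 - {m}. v < 0})"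
      using 1 by (auto simp: neq_iff)
    then show ?case by simp
  next
    case (3 p)
    then show ?case using rm by auto
  next
    case (5 V2)
    have "0 \<notin> V2" using 5 V by auto
    then have V2: "V2 = insert m ({v \<in> V2. 0 < v} \<union> {v \<in> V2 - {m}. v < 0})"
      using 5 by (auto simp: neq_iff)
    have "?f (insert m ({v \<in> V2. 0 < v} \<union> {v \<in> V2 - {m}. v < 0})) =
        h (card {v \<in> V2. 0 < v}) (card {v \<in> V2 - {m}. v < 0})"
      using 5 by (intro h) auto
    then show ?case unfolding V2[symmetric] by simp
  qed (use rm in auto)
  also have "\<dots> = (\<Sum>B\<in>Pow ?B. \<Sum>W\<in>Pow ?W. h (card B) (card W))"
    by (simp add: sum.cartesian_product)
  also have "\<dots> = (\<Sum>B\<in>Pow ?B. \<Sum>l\<le>k. (k choose l) * h (card B) l)"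
    using V k by (subst sum_Pow_card) simp_all
  also have "\<dots> = (\<Sum>j\<le>n. real (n choose j) * (\<Sum>l\<le>k. real (k choose l) * h j l))"
    using V n by (subst sum_Pow_card) simp_all
  finally show ?thesis by (simp add: sum_distrib_left mult.assoc)
qed

text \<open>The marked vertex is -2, and the branch takes j black vertices and l white ones besides
  -2. Its end at the cut edge can be any of the j black vertices, hence the factor j, which also
  disposes of the truncated \<open>j - 1\<close> at j = 0.\<close>

lemma white_rooted_Suc:
  "white_rooted \<sigma> \<gamma> n (Suc k) a = (\<Sum>j\<le>n. \<Sum>l\<le>k. real (n choose j) * real (k choose l) *
     (\<Sum>i\<in>UNIV. real j * (white_rooted \<sigma> \<gamma> (n - j) (k - l) (add_mset i a) *
       black_rooted \<sigma> \<gamma> (j - 1) (Suc l) {#i#})))"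
  unfolding white_rooted_def[of _ _ n]
proof (rule tree_sum_branch_card)
  let ?V = "vertices n (Suc (Suc k))"
  have B0: "{v \<in> ?V - {-1}. 0 < v} = {v \<in> ?V. 0 < v}" by auto
  have W0: "{v \<in> ?V - {-1, -2}. v < 0} = {- int (Suc (Suc k))..-3}" by (auto simp: vertices_def)
  show "n = card {v \<in> ?V - {-1}. 0 < v}" "k = card {v \<in> ?V - {-1, -2}. v < 0}"
    unfolding B0 W0 by simp_all
  fix B W assume B: "B \<subseteq> {v \<in> ?V - {-1}. 0 < v}" and W: "W \<subseteq> {v \<in> ?V - {-1, -2}. v < 0}"
  let ?V2 = "insert (-2) (B \<union> W)"
  have finB: "finite B" by (rule finite_subset[of _ ?V]) (use B in auto)
  have finW: "finite W" by (rule finite_subset[of _ ?V]) (use W in auto)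
  have pos2: "{v \<in> ?V2. 0 < v} = B" and neg2: "{v \<in> ?V2. v < 0} = insert (-2) W"
    using B W by force+
  have pos1: "{v \<in> ?V - ?V2. 0 < v} = {v \<in> ?V. 0 < v} - B"
    and neg1: "{v \<in> ?V - ?V2. v < 0} = {v \<in> ?V. v < 0} - insert (-2) W"
    using B W by force+
  have sub: "insert (-2) W \<subseteq> {v \<in> ?V. v < 0}" using W by (auto simp: vertices_def)
  have "card (insert (-2) W) = Suc (card W)" using W finW by (subst card_insert_disjoint) auto
  then have c1: "card {v \<in> ?V - ?V2. 0 < v} = n - card B"
    "card {v \<in> ?V - ?V2. v < 0} = Suc (k - card W)"
    using card_Diff_subset[OF finB, of "{v \<in> ?V. 0 < v}"]
      card_Diff_subset[OF finite_subset[OF sub], of "{v \<in> ?V. v < 0}"] B sub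
      card_mono[OF _ W] unfolding pos1 neg1 W0 by auto
  have c2: "card {v \<in> ?V2. 0 < v} = card B" "card {v \<in> ?V2. v < 0} = Suc (card W)"
    unfolding pos2 neg2 using \<open>card (insert (-2) W) = _\<close> by simp_all
  have V2: "finite ?V2" "0 \<notin> ?V2" "-1 \<in> ?V - ?V2"
    using finB finW B W by (auto simp: vertices_def)
  have "(\<Sum>c | c \<in> ?V2 \<and> opp (-1) c. \<Sum>i\<in>UNIV.
        tree_sum \<sigma> \<gamma> (?V - ?V2) (-1) (add_mset i a) * tree_sum \<sigma> \<gamma> ?V2 c {#i#}) =
     (\<Sum>c\<in>B. \<Sum>i\<in>UNIV. white_rooted \<sigma> \<gamma> (n - card B) (k - card W) (add_mset i a) *
       black_rooted \<sigma> \<gamma> (card B - 1) (Suc (card W)) {#i#})"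
  proof (rule sum.cong)
    show "{c. c \<in> ?V2 \<and> opp (-1) c} = B" using pos2 by (auto simp: opp_def)
    fix c assume "c \<in> B"
    then have "c \<in> ?V2" "0 < c" using pos2 by auto
    then show "(\<Sum>i\<in>UNIV. tree_sum \<sigma> \<gamma> (?V - ?V2) (-1) (add_mset i a) * tree_sum \<sigma> \<gamma> ?V2 c {#i#}) =
      (\<Sum>i\<in>UNIV. white_rooted \<sigma> \<gamma> (n - card B) (k - card W) (add_mset i a) *
       black_rooted \<sigma> \<gamma> (card B - 1) (Suc (card W)) {#i#})"
      using V2 c1 c2 tree_sum_eq_white_rooted[of "?V - ?V2" "-1" \<sigma> \<gamma>]
        tree_sum_eq_black_rooted[of ?V2 c \<sigma> \<gamma>] by (simp only:) simp
  qed
  also have "\<dots> = (\<Sum>i\<in>UNIV. real (card B) * (white_rooted \<sigma> \<gamma> (n - card B) (k - card W) (add_mset i a) *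
       black_rooted \<sigma> \<gamma> (card B - 1) (Suc (card W)) {#i#}))"
    by (simp add: sum_distrib_left)
  finally show "(\<Sum>c | c \<in> ?V2 \<and> opp (-1) c. \<Sum>i\<in>UNIV.
        tree_sum \<sigma> \<gamma> (?V - ?V2) (-1) (add_mset i a) * tree_sum \<sigma> \<gamma> ?V2 c {#i#}) = \<dots>" .
qed (auto simp: vertices_def)

text \<open>The marked vertex is -1. The branch is now attached at a white vertex, which may be the
  marked one itself, so there are \<open>Suc l\<close> choices.\<close>

lemma black_rooted_Suc:
  "black_rooted \<sigma> \<gamma> n (Suc k) a = (\<Sum>j\<le>n. \<Sum>l\<le>k. real (n choose j) * real (k choose l) *
     (\<Sum>i\<in>UNIV. real (Suc l) * (black_rooted \<sigma> \<gamma> (n - j) (k - l) (add_mset i a) *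
       white_rooted \<sigma> \<gamma> j l {#i#})))"
  unfolding black_rooted_def[of _ _ n]
proof (rule tree_sum_branch_card)
  let ?V = "vertices (Suc n) (Suc k)"
  have B0: "{v \<in> ?V - {1}. 0 < v} = {2..int (Suc n)}" by (auto simp: vertices_def)
  have W0: "{v \<in> ?V - {1, -1}. v < 0} = {- int (Suc k)..-2}" by (auto simp: vertices_def)
  show "n = card {v \<in> ?V - {1}. 0 < v}" "k = card {v \<in> ?V - {1, -1}. v < 0}"
    unfolding B0 W0 by simp_all
  fix B W assume B: "B \<subseteq> {v \<in> ?V - {1}. 0 < v}" and W: "W \<subseteq> {v \<in> ?V - {1, -1}. v < 0}"
  let ?V2 = "insert (-1) (B \<union> W)"
  have finB: "finite B" by (rule finite_subset[of _ ?V]) (use B in auto)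
  have finW: "finite W" by (rule finite_subset[of _ ?V]) (use W in auto)
  have pos2: "{v \<in> ?V2. 0 < v} = B" and neg2: "{v \<in> ?V2. v < 0} = insert (-1) W"
    using B W by force+
  have pos1: "{v \<in> ?V - ?V2. 0 < v} = {v \<in> ?V. 0 < v} - B"
    and neg1: "{v \<in> ?V - ?V2. v < 0} = {v \<in> ?V. v < 0} - insert (-1) W"
    using B W by force+
  have sub: "insert (-1) W \<subseteq> {v \<in> ?V. v < 0}" using W by (auto simp: vertices_def)
  have subB: "B \<subseteq> {v \<in> ?V. 0 < v}" using B by auto
  have "card (insert (-1) W) = Suc (card W)" using W finW by (subst card_insert_disjoint) auto
  then have c1: "card {v \<in> ?V - ?V2. 0 < v} = Suc (n - card B)"
    "card {v \<in> ?V - ?V2. v < 0} = k - card W"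
    using card_Diff_subset[OF finB subB]
      card_Diff_subset[OF finite_subset[OF sub], of "{v \<in> ?V. v < 0}"] B sub
      card_mono[OF _ B] unfolding pos1 neg1 B0 by auto
  have c2: "card {v \<in> ?V2. 0 < v} = card B" "card {v \<in> ?V2. v < 0} = Suc (card W)"
    unfolding pos2 neg2 using \<open>card (insert (-1) W) = _\<close> by simp_all
  have V2: "finite ?V2" "0 \<notin> ?V2" "1 \<in> ?V - ?V2"
    using finB finW B W by (auto simp: vertices_def)
  have "(\<Sum>c | c \<in> ?V2 \<and> opp 1 c. \<Sum>i\<in>UNIV.
        tree_sum \<sigma> \<gamma> (?V - ?V2) 1 (add_mset i a) * tree_sum \<sigma> \<gamma> ?V2 c {#i#}) =
     (\<Sum>c\<in>insert (-1) W. \<Sum>i\<in>UNIV. black_rooted \<sigma> \<gamma> (n - card B) (k - card W) (add_mset i a) *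
       white_rooted \<sigma> \<gamma> (card B) (card W) {#i#})"
  proof (rule sum.cong)
    show "{c. c \<in> ?V2 \<and> opp 1 c} = insert (-1) W" using neg2 by (auto simp: opp_def)
    fix c assume "c \<in> insert (-1) W"
    then have "c \<in> ?V2" "c < 0" using neg2 by auto
    then show "(\<Sum>i\<in>UNIV. tree_sum \<sigma> \<gamma> (?V - ?V2) 1 (add_mset i a) * tree_sum \<sigma> \<gamma> ?V2 c {#i#}) =
      (\<Sum>i\<in>UNIV. black_rooted \<sigma> \<gamma> (n - card B) (k - card W) (add_mset i a) *
       white_rooted \<sigma> \<gamma> (card B) (card W) {#i#})"
      using V2 c1 c2 tree_sum_eq_black_rooted[of "?V - ?V2" "1" \<sigma> \<gamma>]
        tree_sum_eq_white_rooted[of ?V2 c \<sigma> \<gamma>] by (simp only:) simp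
  qed
  also have "\<dots> = (\<Sum>i\<in>UNIV. real (Suc (card W)) * (black_rooted \<sigma> \<gamma> (n - card B) (k - card W) (add_mset i a) *
       white_rooted \<sigma> \<gamma> (card B) (card W) {#i#}))"
    unfolding \<open>card (insert (-1) W) = _\<close>[symmetric] by (simp only: sum_constant sum_distrib_left)
  finally show "(\<Sum>c | c \<in> ?V2 \<and> opp 1 c. \<Sum>i\<in>UNIV.
        tree_sum \<sigma> \<gamma> (?V - ?V2) 1 (add_mset i a) * tree_sum \<sigma> \<gamma> ?V2 c {#i#}) = \<dots>" .
qed (auto simp: vertices_def)

lemma is_tree_singleton_iff: "r \<noteq> 0 \<Longrightarrow> is_tree {r} E \<longleftrightarrow> E = {}"
  by (auto simp: is_tree_def bip_def)

lemma tree_sum_singleton: "r \<noteq> 0 \<Longrightarrow> tree_sum \<sigma> \<gamma> {r} r a = vertex_weight \<sigma> \<gamma> r a"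
  by (simp add: tree_sum_def is_tree_singleton_iff graph_weight_def inc_def)

lemma black_rooted_0: "black_rooted \<sigma> \<gamma> n 0 a = (if n = 0 then \<sigma> a else 0)"
proof (cases "n = 0")
  case True
  have "vertices (Suc 0) 0 = {1}" by (auto simp: vertices_def)
  then show ?thesis
    using True by (simp add: black_rooted_def tree_sum_singleton vertex_weight_def)
next
  case False
  have "\<not> is_tree (vertices (Suc n) 0) E" for E
  proof
    assume t: "is_tree (vertices (Suc n) 0) E"
    then have "E = {}" by (auto simp: is_tree_def bip_def vertices_def)
    moreover have "(1, 2) \<in> conn E" using t False by (simp add: is_tree_def vertices_def)
    ultimately show False by (simp add: conn_def)
  qed
  then show ?thesis using False by (simp add: black_rooted_def tree_sum_def)
qed

text \<open>When the root is the only white vertex, every black vertex is a leaf.\<close>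

lemma white_rooted_0:
  assumes "\<And>i. \<sigma> {#i#} = 0"
  shows "white_rooted \<sigma> \<gamma> n 0 a = (if n = 0 then \<gamma> a else 0)"
proof (cases "n = 0")
  case True
  have "vertices 0 (Suc 0) = {-1}" by (auto simp: vertices_def)
  then show ?thesis
    using True by (simp add: white_rooted_def tree_sum_singleton vertex_weight_def)
next
  case False
  have "graph_weight \<sigma> \<gamma> (vertices n (Suc 0)) E ((\<lambda>_. {#})(-1 := a)) = 0"
    if t: "is_tree (vertices n (Suc 0)) E" for E
  proof (rule graph_weight_black_leaf[where v = 1])
    have E: "E \<subseteq> {1..int n} \<times> {-1}" using t by (auto simp: is_tree_def bip_def vertices_def)
    have "(1, -1) \<in> conn E" using t False by (simp add: is_tree_def vertices_def)
    have "(1, -1) \<in> E"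
    proof (rule ccontr)
      assume "(1, -1) \<notin> E"
      with \<open>(1, -1) \<in> conn E\<close> have "-1 \<in> {1::int}"
        by (rule_tac conn_invariant[of 1 "-1" E]) (use E in auto)
      then show False by simp
    qed
    then have "inc E 1 = {(1, -1)}" using E by (auto simp: inc_def)
    then show "card (inc E 1) = 1" by simp
  qed (use assms False in \<open>auto simp: vertices_def\<close>)
  then show ?thesis using False by (simp add: white_rooted_def tree_sum_def)
qed

text \<open>Trees of nonzero weight have no black leaf except possibly the root. So every other
  black vertex has a white child, different ones have different children, and a black root with
  further black vertices has a white child as well. The proof finds a vanishing factor in each
  product of the recursions.\<close>

lemma rooted_eq_0:
  assumes "\<And>i. \<sigma> {#i#} = 0"
  shows "(k < n \<longrightarrow> white_rooted \<sigma> \<gamma> n k a = 0) \<and> (0 < n \<and> k \<le> n \<longrightarrow> black_rooted \<sigma> \<gamma> n k a = 0)"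
proof (induction k arbitrary: n a rule: less_induct)
  case (less k)
  show ?case
  proof (cases k)
    case 0
    then show ?thesis using assms by (simp add: white_rooted_0 black_rooted_0)
  next
    case (Suc l)
    have IHw: "white_rooted \<sigma> \<gamma> n j a = 0" if "j \<le> l" "j < n" for n j a
      using less[of j n a] that Suc by simp
    have IHb: "black_rooted \<sigma> \<gamma> n j a = 0" if "j \<le> l" "0 < n" "j \<le> n" for n j a
      using less[of j n a] that Suc by simp
    have b: "black_rooted \<sigma> \<gamma> n (Suc l) a = 0" if "Suc l \<le> n" for n a
    proof -
      have Z: "black_rooted \<sigma> \<gamma> (n - p) (l - m) b * white_rooted \<sigma> \<gamma> p m c = 0" if "m \<le> l" for p m b c
      proof (cases "m < p")
        case True
        then show ?thesis using IHw that by simp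
      next
        case False
        then show ?thesis using IHb[of "l - m" "n - p" b] that \<open>Suc l \<le> n\<close> by simp
      qed
      then show ?thesis unfolding black_rooted_Suc
        by (intro sum.neutral ballI) (simp only: Z atMost_iff mult_zero_right sum.neutral_const)
    qed
    \<comment> \<open>For m = l the black factor has \<open>Suc l\<close> white vertices, out of
      reach of the induction hypothesis; this is why the black statement \<open>b\<close> comes
      first.\<close>
    have w: "white_rooted \<sigma> \<gamma> n (Suc l) a = 0" if "Suc l < n"
    proof -
      have Z: "real p * (white_rooted \<sigma> \<gamma> (n - p) (l - m) b * black_rooted \<sigma> \<gamma> (p - 1) (Suc m) c) = 0"
        if "m \<le> l" for p m b c
      proof (cases "l - m < n - p")
        case True
        then show ?thesis using IHw[of "l - m" "n - p" b] by simp
      next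
        case False
        then have "Suc m \<le> p - 1" using that \<open>Suc l < n\<close> by linarith
        then show ?thesis using IHb[of "Suc m" "p - 1" c] b[of "p - 1" c] that
          by (cases "m = l") auto
      qed
      then show ?thesis unfolding white_rooted_Suc
        by (intro sum.neutral ballI) (simp only: Z atMost_iff mult_zero_right sum.neutral_const)
    qed
    show ?thesis using b[of n a] w Suc by auto
  qed
qed

section \<open>Differential equations for the generating series\<close>

text \<open>Exponential in both colours, with the variable for black vertices set to 1. The cut-off
  at n = k loses nothing, by \<open>rooted_eq_0\<close>.\<close>

definition white_gf ::
  "('n::finite multiset \<Rightarrow> real) \<Rightarrow> ('n multiset \<Rightarrow> real) \<Rightarrow> 'n multiset \<Rightarrow> real fps" where
  "white_gf \<sigma> \<gamma> a = Abs_fps (\<lambda>k. \<Sum>n\<le>k. white_rooted \<sigma> \<gamma> n k a / (fact n * fact k))"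

definition black_gf ::
  "('n::finite multiset \<Rightarrow> real) \<Rightarrow> ('n multiset \<Rightarrow> real) \<Rightarrow> 'n multiset \<Rightarrow> real fps" where
  "black_gf \<sigma> \<gamma> a = Abs_fps (\<lambda>k. \<Sum>n\<le>k. black_rooted \<sigma> \<gamma> n k a / (fact n * fact k))"

text \<open>Summing out the black vertices turns the binomial convolution into a product. The
  supports bounded by \<open>A\<close> and \<open>B\<close> come from \<open>rooted_eq_0\<close> and
  fit under the cut-off \<open>N\<close>.\<close>

lemma sum_convolution:
  fixes f h :: "nat \<Rightarrow> real"
  assumes "\<And>j. A < j \<Longrightarrow> f j = 0" "\<And>j. B < j \<Longrightarrow> h j = 0" "A + B \<le> N"
  shows "(\<Sum>n\<le>N. \<Sum>j\<le>n. f (n - j) * h j) = (\<Sum>n\<le>A. f n) * (\<Sum>n\<le>B. h n)"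
proof -
  have f: "j \<le> A \<or> f j = 0" and h: "j \<le> B \<or> h j = 0" for j
    using assms(1,2) not_le by blast+
  have "(\<Sum>n\<le>N. \<Sum>j\<le>n. f (n - j) * h j) = (\<Sum>(i, j) | i + j \<le> N. h i * f j)"
    using sum.triangle_reindex_eq[of "\<lambda>i j. h i * f j" N]
    by (simp add: mult.commute atMost_def)
  also have "\<dots> = (\<Sum>(i, j)\<in>{..B} \<times> {..A}. h i * f j)"
  proof (rule sum.mono_neutral_right)
    show "finite {(i, j). i + j \<le> N}"
      by (rule finite_subset[of _ "{..N} \<times> {..N}"]) auto
    show "{..B} \<times> {..A} \<subseteq> {(i, j). i + j \<le> N}" using assms(3) by auto
    show "\<forall>p\<in>{(i, j). i + j \<le> N} - {..B} \<times> {..A}. (case p of (i, j) \<Rightarrow> h i * f j) = 0"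
      using f h by fastforce
  qed
  also have "\<dots> = (\<Sum>n\<le>B. h n) * (\<Sum>n\<le>A. f n)"
    by (simp add: sum_product sum.cartesian_product)
  finally show ?thesis by (simp add: mult.commute)
qed

lemma choose_div_fact:
  assumes "j \<le> n"
  shows "real (n choose j) / fact n = 1 / (fact j * fact (n - j))"
  using binomial_fact[OF assms, where ?'a = real] by (simp add: field_simps)

lemma Suc_mult_div_fact:
  "real (Suc k) * x / (fact n * fact (Suc k)) = x / (fact n * fact k)"
  by (simp add: divide_simps del: of_nat_Suc)

text \<open>The \<open>Suc l\<close> choices for the white end of the branch are exactly the factor
  produced by differentiating \<open>fps_X * white_gf\<close>, where \<open>fps_X\<close> counts
  that end.\<close>

lemma fps_deriv_black_gf:
  assumes \<sigma>: "\<And>i. \<sigma> {#i#} = 0"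
  shows "fps_deriv (black_gf \<sigma> \<gamma> a) =
    (\<Sum>i\<in>UNIV. black_gf \<sigma> \<gamma> (add_mset i a) * fps_deriv (fps_X * white_gf \<sigma> \<gamma> {#i#}))"
proof (rule fps_ext)
  fix k
  let ?f = "\<lambda>i l m. black_rooted \<sigma> \<gamma> m (k - l) (add_mset i a) / (fact m * fact (k - l))"
  let ?h = "\<lambda>i l j. real (Suc l) * (white_rooted \<sigma> \<gamma> j l {#i#} / (fact j * fact l))"
  have "fps_deriv (black_gf \<sigma> \<gamma> a) $ k =
      (\<Sum>n\<le>Suc k. black_rooted \<sigma> \<gamma> n (Suc k) a / (fact n * fact k))"
    by (simp add: black_gf_def sum_distrib_left Suc_mult_div_fact del: sum.atMost_Suc of_nat_Suc fact_Suc)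
  also have "\<dots> = (\<Sum>n\<le>Suc k. \<Sum>j\<le>n. \<Sum>l\<le>k. \<Sum>i\<in>UNIV. ?f i l (n - j) * ?h i l j)"
  proof (rule sum.cong[OF refl])
    fix n
    have "black_rooted \<sigma> \<gamma> n (Suc k) a / (fact n * fact k) =
       (\<Sum>j\<le>n. \<Sum>l\<le>k. \<Sum>i\<in>UNIV. (real (n choose j) / fact n) * (real (k choose l) / fact k) *
          (real (Suc l) * (black_rooted \<sigma> \<gamma> (n - j) (k - l) (add_mset i a) * white_rooted \<sigma> \<gamma> j l {#i#})))"
      unfolding black_rooted_Suc sum_divide_distrib sum_distrib_left by (simp add: field_simps)
    also have "\<dots> = (\<Sum>j\<le>n. \<Sum>l\<le>k. \<Sum>i\<in>UNIV. ?f i l (n - j) * ?h i l j)"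
      by (intro sum.cong refl) (simp add: choose_div_fact mult_ac)
    finally show "black_rooted \<sigma> \<gamma> n (Suc k) a / (fact n * fact k) = \<dots>" .
  qed
  also have "\<dots> = (\<Sum>i\<in>UNIV. \<Sum>l\<le>k. \<Sum>n\<le>Suc k. \<Sum>j\<le>n. ?f i l (n - j) * ?h i l j)"
    unfolding sum.swap[where B = UNIV] sum.swap[where A = "{..n}" and B = "{..k}" for n]
      sum.swap[where A = "{..Suc k}" and B = "{..k}"] ..
  also have "\<dots> = (\<Sum>i\<in>UNIV. \<Sum>l\<le>k. (\<Sum>n\<le>k - l. ?f i l n) * (\<Sum>n\<le>l. ?h i l n))"
    using rooted_eq_0[of \<sigma>, OF \<sigma>]
    by (intro sum.cong refl sum_convolution) auto
  also have "\<dots> = (\<Sum>i\<in>UNIV. \<Sum>l\<le>k. black_gf \<sigma> \<gamma> (add_mset i a) $ (k - l) *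
      fps_deriv (fps_X * white_gf \<sigma> \<gamma> {#i#}) $ l)"
  proof (intro sum.cong refl)
    fix i l
    have "(\<Sum>n\<le>l. ?h i l n) = real (Suc l) * white_gf \<sigma> \<gamma> {#i#} $ l"
      by (simp add: white_gf_def sum_distrib_left)
    also have "\<dots> = fps_deriv (fps_X * white_gf \<sigma> \<gamma> {#i#}) $ l"
      by (simp del: fps_deriv_mult)
    finally show "(\<Sum>n\<le>k - l. ?f i l n) * (\<Sum>n\<le>l. ?h i l n) =
        black_gf \<sigma> \<gamma> (add_mset i a) $ (k - l) * fps_deriv (fps_X * white_gf \<sigma> \<gamma> {#i#}) $ l"
      by (simp add: black_gf_def)
  qed
  also have "\<dots> = (\<Sum>i\<in>UNIV. fps_deriv (fps_X * white_gf \<sigma> \<gamma> {#i#}) * black_gf \<sigma> \<gamma> (add_mset i a)) $ k"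
    unfolding fps_sum_nth fps_mult_nth[of "fps_deriv _"] by (simp add: atLeast0AtMost mult.commute del: fps_deriv_nth)
  finally show "fps_deriv (black_gf \<sigma> \<gamma> a) $ k = (\<Sum>i\<in>UNIV. black_gf \<sigma> \<gamma> (add_mset i a) *
      fps_deriv (fps_X * white_gf \<sigma> \<gamma> {#i#})) $ k"
    by (simp only: mult.commute)
qed

text \<open>The j choices for the black end cancel one factor of \<open>fact j\<close>, leaving the
  factorial of the j - 1 other black vertices of the branch.\<close>

lemma fps_deriv_white_gf:
  assumes \<sigma>: "\<And>i. \<sigma> {#i#} = 0"
  shows "fps_deriv (white_gf \<sigma> \<gamma> a) =
    (\<Sum>i\<in>UNIV. white_gf \<sigma> \<gamma> (add_mset i a) * fps_deriv (black_gf \<sigma> \<gamma> {#i#}))"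
proof (rule fps_ext)
  fix k
  let ?f = "\<lambda>i l m. white_rooted \<sigma> \<gamma> m (k - l) (add_mset i a) / (fact m * fact (k - l))"
  let ?h = "\<lambda>i l j. real j * (black_rooted \<sigma> \<gamma> (j - 1) (Suc l) {#i#} / (fact j * fact l))"
  have "fps_deriv (white_gf \<sigma> \<gamma> a) $ k =
      (\<Sum>n\<le>Suc k. white_rooted \<sigma> \<gamma> n (Suc k) a / (fact n * fact k))"
    by (simp add: white_gf_def sum_distrib_left Suc_mult_div_fact del: sum.atMost_Suc of_nat_Suc fact_Suc)
  also have "\<dots> = (\<Sum>n\<le>Suc k. \<Sum>j\<le>n. \<Sum>l\<le>k. \<Sum>i\<in>UNIV. ?f i l (n - j) * ?h i l j)"
  proof (rule sum.cong[OF refl])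
    fix n
    have "white_rooted \<sigma> \<gamma> n (Suc k) a / (fact n * fact k) =
       (\<Sum>j\<le>n. \<Sum>l\<le>k. \<Sum>i\<in>UNIV. (real (n choose j) / fact n) * (real (k choose l) / fact k) *
          (real j * (white_rooted \<sigma> \<gamma> (n - j) (k - l) (add_mset i a) * black_rooted \<sigma> \<gamma> (j - 1) (Suc l) {#i#})))"
      unfolding white_rooted_Suc sum_divide_distrib sum_distrib_left by (simp add: field_simps)
    also have "\<dots> = (\<Sum>j\<le>n. \<Sum>l\<le>k. \<Sum>i\<in>UNIV. ?f i l (n - j) * ?h i l j)"
      by (intro sum.cong refl) (simp add: choose_div_fact mult_ac)
    finally show "white_rooted \<sigma> \<gamma> n (Suc k) a / (fact n * fact k) = \<dots>" .
  qed
  also have "\<dots> = (\<Sum>i\<in>UNIV. \<Sum>l\<le>k. \<Sum>n\<le>Suc k. \<Sum>j\<le>n. ?f i l (n - j) * ?h i l j)"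
    unfolding sum.swap[where B = UNIV] sum.swap[where A = "{..n}" and B = "{..k}" for n]
      sum.swap[where A = "{..Suc k}" and B = "{..k}"] ..
  also have "\<dots> = (\<Sum>i\<in>UNIV. \<Sum>l\<le>k. (\<Sum>n\<le>k - l. ?f i l n) * (\<Sum>n\<le>Suc l. ?h i l n))"
    using rooted_eq_0[of \<sigma>, OF \<sigma>]
    by (intro sum.cong refl sum_convolution) auto
  also have "\<dots> = (\<Sum>i\<in>UNIV. \<Sum>l\<le>k. white_gf \<sigma> \<gamma> (add_mset i a) $ (k - l) *
      fps_deriv (black_gf \<sigma> \<gamma> {#i#}) $ l)"
  proof (intro sum.cong refl)
    fix i l
    \<comment> \<open>The term j = 0 vanishes and the others shift down by one. The range is then
      filled up again to \<open>Suc l\<close> by a term that is 0 by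
      \<open>rooted_eq_0\<close>.\<close>
    have "(\<Sum>n\<le>Suc l. ?h i l n) = (\<Sum>n\<le>l. black_rooted \<sigma> \<gamma> n (Suc l) {#i#} / (fact n * fact l))"
      by (subst sum.atMost_Suc_shift) (simp del: of_nat_Suc)
    also have "\<dots> = (\<Sum>n\<le>Suc l. black_rooted \<sigma> \<gamma> n (Suc l) {#i#} / (fact n * fact l))"
      using rooted_eq_0[of \<sigma> "Suc l" "Suc l", OF \<sigma>] by simp
    also have "\<dots> = fps_deriv (black_gf \<sigma> \<gamma> {#i#}) $ l"
      by (simp add: black_gf_def sum_distrib_left Suc_mult_div_fact del: sum.atMost_Suc of_nat_Suc fact_Suc)
    finally show "(\<Sum>n\<le>k - l. ?f i l n) * (\<Sum>n\<le>Suc l. ?h i l n) = white_gf \<sigma> \<gamma> (add_mset i a) $ (k - l) *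
      fps_deriv (black_gf \<sigma> \<gamma> {#i#}) $ l"
      by (simp add: white_gf_def)
  qed
  also have "\<dots> = (\<Sum>i\<in>UNIV. fps_deriv (black_gf \<sigma> \<gamma> {#i#}) * white_gf \<sigma> \<gamma> (add_mset i a)) $ k"
    unfolding fps_sum_nth fps_mult_nth[of "fps_deriv _"] by (simp add: atLeast0AtMost mult.commute del: fps_deriv_nth)
  finally show "fps_deriv (white_gf \<sigma> \<gamma> a) $ k = (\<Sum>i\<in>UNIV. white_gf \<sigma> \<gamma> (add_mset i a) *
      fps_deriv (black_gf \<sigma> \<gamma> {#i#})) $ k"
    by (simp only: mult.commute)
qed

theorem critical_value_tree_expansion:
  assumes \<sigma>: "\<And>i. \<sigma> {#i#} = 0"
  shows "critical_equations \<sigma> \<gamma> q z \<longleftrightarrow>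
      q = (\<lambda>i. fps_X * white_gf \<sigma> \<gamma> {#i#}) \<and> z = (\<lambda>i. black_gf \<sigma> \<gamma> {#i#})" (is ?uniq)
    and "critical_equations \<sigma> \<gamma> q z \<Longrightarrow> critical_value \<sigma> \<gamma> q z $ Suc k =
      (\<Sum>n\<le>k. white_rooted \<sigma> \<gamma> n k {#} / (fact n * fact (Suc k)))"
proof -
  have 0: "white_gf \<sigma> \<gamma> a $ 0 = \<gamma> a" "black_gf \<sigma> \<gamma> a $ 0 = \<sigma> a" for a
    by (simp_all add: white_gf_def black_gf_def white_rooted_0[of \<sigma>, OF \<sigma>] black_rooted_0)
  note coupled = critical_equations_iff_coupled_system[of "white_gf \<sigma> \<gamma>" "black_gf \<sigma> \<gamma>" \<gamma> \<sigma>,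
      OF fps_deriv_white_gf[of \<sigma>, OF \<sigma>] fps_deriv_black_gf[of \<sigma>, OF \<sigma>] 0 \<sigma>]
  show ?uniq by (rule coupled(1))
  assume crit: "critical_equations \<sigma> \<gamma> q z"
  \<comment> \<open>Comparing derivatives divides by \<open>Suc k\<close>, which replaces
    \<open>fact k\<close> for the white vertices other than the root by \<open>fact (Suc k)\<close>
    for all of them.\<close>
  have "real (Suc k) * critical_value \<sigma> \<gamma> q z $ Suc k = white_gf \<sigma> \<gamma> {#} $ k"
    using fps_deriv_critical_value[OF crit] unfolding coupled(2)[OF crit]
    by (metis Suc_eq_plus1 fps_deriv_nth)
  also have "\<dots> = real (Suc k) * (\<Sum>n\<le>k. white_rooted \<sigma> \<gamma> n k {#} / (fact n * fact (Suc k)))"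
    by (simp add: white_gf_def sum_distrib_left Suc_mult_div_fact del: of_nat_Suc fact_Suc)
  finally show "critical_value \<sigma> \<gamma> q z $ Suc k =
      (\<Sum>n\<le>k. white_rooted \<sigma> \<gamma> n k {#} / (fact n * fact (Suc k)))"
    by (simp del: of_nat_Suc)
qed

text \<open>Counting: with unit weights, \<open>rooted_eq_0\<close> says that there are no such trees.\<close>
lemma card_black_less_card_white:
  assumes t: "is_tree (vertices n (Suc k)) E"
    and noleaf: "\<And>v. v \<in> vertices n (Suc k) \<Longrightarrow> 0 < v \<Longrightarrow> card (inc E v) \<noteq> 1"
  shows "n \<le> k"
proof (rule ccontr)
  assume "\<not> n \<le> k"
  \<comment> \<open>\<sigma> vanishes just at single indices and all other weights are 1, so no
    weight is negative and a tree without black leaves has positive weight.\<close>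
  let ?\<sigma> = "\<lambda>M :: unit multiset. if size M = 1 then 0 else 1 :: real" and ?\<gamma> = "\<lambda>_ :: unit multiset. 1 :: real"
  let ?w = "\<lambda>E. graph_weight ?\<sigma> ?\<gamma> (vertices n (Suc k)) E ((\<lambda>_. {#})(-1 := {#}))"
  have "?w E = (\<Sum>\<iota>\<in>E \<rightarrow>\<^sub>E (UNIV :: unit set). 1)"
    unfolding graph_weight_def
    by (intro sum.cong prod.neutral refl ballI) (use noleaf in \<open>auto simp: vertex_weight_def\<close>)
  also have "\<dots> > 0"
    using is_tree_finite[OF t] by (simp add: card_PiE)
  finally have "0 < ?w E" .
  moreover have "0 \<le> ?w F" for F
    unfolding graph_weight_def by (intro sum_nonneg prod_nonneg ballI) (simp add: vertex_weight_def)
  moreover have "(\<Sum>F | is_tree (vertices n (Suc k)) F. ?w F) = 0"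
    using rooted_eq_0[of ?\<sigma> k n ?\<gamma> "{#}"] \<open>\<not> n \<le> k\<close> by (simp add: white_rooted_def tree_sum_def)
  ultimately show False
    using sum_nonneg_eq_0_iff[of "{F. is_tree (vertices n (Suc k)) F}" ?w] t
    by (auto simp: finite_trees)
qed

section \<open>Bipartite trees as labelled graphs\<close>

lemma zip_rotate1:
  "p \<noteq> [] \<Longrightarrow> zip p (rotate1 p) = zip p (tl p) @ [(last p, hd p)]"
proof (cases p)
  case (Cons x xs)
  have "zip (x # xs) (xs @ [y]) = zip (x # xs) xs @ [(last (x # xs), y)]" for y
    by (induction xs arbitrary: x) auto
  then show ?thesis using Cons by simp
qed simp

lemma conn_zip_tl:
  assumes "\<And>u v. (u, v) \<in> set (zip p (tl p)) \<Longrightarrow> ed u v \<in> F" "p \<noteq> []"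
  shows "(hd p, last p) \<in> conn F"
  using assms
proof (induction p rule: induct_list012)
  case (3 x y p)
  then have "(x, y) \<in> conn F" by (intro conn_ed) simp
  moreover have "(y, last (y # p)) \<in> conn F" using 3 by simp
  ultimately show ?case using conn_trans by force
qed simp_all

lemma distinct_path_edges:
  "distinct p \<Longrightarrow> distinct (map (\<lambda>(u, v). ed u v) (zip p (tl p)))"
proof (induction p rule: induct_list012)
  case (3 x y p)
  have "ed x y \<noteq> ed a b" if "(a, b) \<in> set (zip (y # p) p)" for a b
  proof -
    have "a \<in> set (y # p)" "b \<in> set (y # p)"
      using that by (auto dest: set_zip_leftD set_zip_rightD)
    then have "a \<noteq> x" "b \<noteq> x" using 3(3) by auto
    then show ?thesis by (auto simp: ed_def max_def min_def split: if_splits)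
  qed
  then show ?case using 3 by auto
qed simp_all

text \<open>\<open>is_cycle\<close> asks for distinct vertices, so walks have to be shortened: when
  the next vertex already lies on the path, the path is cut off there.\<close>

lemma conn_distinct_path:
  assumes "F \<subseteq> bip V" "(u, v) \<in> conn F"
  obtains p where "p \<noteq> []" "hd p = u" "last p = v" "distinct p"
    "\<And>a b. (a, b) \<in> set (zip p (tl p)) \<Longrightarrow> ed a b \<in> F"
proof -
  have "\<exists>p. p \<noteq> [] \<and> hd p = u \<and> last p = v \<and> distinct p \<and> (\<forall>(a, b) \<in> set (zip p (tl p)). ed a b \<in> F)"
    using assms(2)
  proof (induction rule: conn_induct)
    case refl
    then show ?case by (intro exI[of _ "[u]"]) simp
  next
    case (step x y)
    then obtain p where p: "p \<noteq> []" "hd p = u" "last p = x" "distinct p"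
      "\<forall>(a, b) \<in> set (zip p (tl p)). ed a b \<in> F" by blast
    have xy: "ed x y \<in> F"
      using step(2) assms(1) by (auto simp: ed_def bip_def max_def min_def)
    show ?case
    proof (cases "y \<in> set p")
      case True
      then obtain p1 p2 where p12: "p = p1 @ y # p2" by (meson split_list)
      have "set (zip (p1 @ [y]) (tl (p1 @ [y]))) \<subseteq> set (zip p (tl p))"
      proof -
        have "zip p (tl p) = zip (p1 @ [y]) (tl (p1 @ [y])) @ zip (y # p2) p2"
          unfolding p12 by (induction p1 rule: induct_list012) auto
        then show ?thesis by simp
      qed
      then show ?thesis
        using p p12 by (intro exI[of _ "p1 @ [y]"]) (auto simp: hd_append)
    next
      case False
      obtain p' where p': "p = p' @ [x]" using p by (metis append_butlast_last_id)
      have "zip (p @ [y]) (tl (p @ [y])) = zip p (tl p) @ [(x, y)]"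
        unfolding p' by (induction p' rule: induct_list012) auto
      then show ?thesis
        using p xy False by (intro exI[of _ "p @ [y]"]) auto
    qed
  qed
  then show ?thesis using that by blast
qed

lemma mset_subset_mset_set:
  assumes "finite E"
  shows "mset l \<subseteq># mset_set E \<longleftrightarrow> distinct l \<and> set l \<subseteq> E"
proof
  assume sub: "mset l \<subseteq># mset_set E"
  then have "set l \<subseteq> E" using set_mset_mono[OF sub] assms by simp
  moreover have "count (mset l) a = (if a \<in> set l then 1 else 0)" for a
  proof -
    have "count (mset l) a \<le> count (mset_set E) a" using sub by (rule mset_subset_eq_count)
    also have "\<dots> \<le> 1" by (simp add: count_mset_set')
    finally have "count (mset l) a \<le> 1" .
    moreover have "a \<in> set l \<Longrightarrow> 1 \<le> count (mset l) a" by simp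
    moreover have "a \<notin> set l \<Longrightarrow> count (mset l) a = 0" by (simp add: count_eq_zero_iff)
    ultimately show ?thesis by (simp add: le_antisym)
  qed
  then have "distinct l" unfolding distinct_count_atmost_1 by blast
  ultimately show "distinct l \<and> set l \<subseteq> E" by blast
next
  assume "distinct l \<and> set l \<subseteq> E"
  then show "mset l \<subseteq># mset_set E"
    using assms by (metis mset_set_set subset_imp_msubset_mset_set)
qed

abbreviation verts :: "bigraph \<Rightarrow> int set" where
  "verts t \<equiv> vertices (num_black t) (num_white t)"

abbreviation edge_set :: "bigraph \<Rightarrow> (int \<times> int) set" where
  "edge_set t \<equiv> set_mset (edges t)"

definition simple_graph :: "bigraph \<Rightarrow> bool" where
  "simple_graph t \<longleftrightarrow> edges t = mset_set (edge_set t)"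

lemma simple_graph_iff_count: "simple_graph t \<longleftrightarrow> (\<forall>e\<in>edge_set t. count (edges t) e = 1)"
  by (auto simp: simple_graph_def multiset_eq_iff count_mset_set' count_eq_zero_iff)

lemma black_Un_white: "black t \<union> white t = verts t"
  by (auto simp: black_def white_def vertices_def)

lemma bipartite_graph_iff: "bipartite_graph t \<longleftrightarrow> edge_set t \<subseteq> bip (verts t)"
proof -
  have "black t \<times> white t = bip (verts t)"
    by (auto simp: black_def white_def vertices_def bip_def)
  then show ?thesis by (simp add: bipartite_graph_def)
qed

lemma connected_graph_iff:
  "connected_graph t \<longleftrightarrow> (\<forall>u\<in>verts t. \<forall>v\<in>verts t. (u, v) \<in> conn (edge_set t))"
  by (simp add: connected_graph_def black_Un_white adjacency_def conn_def)

text \<open>An edge that is not a bridge closes a path with distinct vertices to a cycle; conversely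
  the rest of a cycle bypasses its closing edge. A repeated edge is a cycle of length two, which
  accounts for simplicity.\<close>

lemma acyclic_iff_bridges:
  assumes bip: "edge_set t \<subseteq> bip V" and V: "finite V"
  shows "(\<nexists>vs. is_cycle t vs) \<longleftrightarrow> simple_graph t \<and>
    (\<forall>u v. (u, v) \<in> edge_set t \<longrightarrow> (u, v) \<notin> conn (edge_set t - {(u, v)}))"
proof -
  let ?E = "edge_set t" and ?f = "\<lambda>(u, v). ed u v"
  have fin: "finite ?E" by simp
  have cyc: "is_cycle t vs \<longleftrightarrow> 2 \<le> length vs \<and> distinct vs \<and>
      mset (map ?f (zip vs (tl vs)) @ [ed (last vs) (hd vs)]) \<subseteq># edges t" for vs
    by (cases "vs = []") (simp_all add: is_cycle_def zip_rotate1 ed_def)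
  have orient: "ed u v = (u, v)" "ed v u = (u, v)" "u \<noteq> v" if "(u, v) \<in> ?E" for u v
    using that bip by (auto simp: ed_def bip_def)
  show ?thesis
  proof (intro iffI conjI allI impI notI)
    assume nc: "\<nexists>vs. is_cycle t vs"
    have "count (edges t) (u, v) = 1" if uv: "(u, v) \<in> ?E" for u v
    proof (rule ccontr)
      assume "count (edges t) (u, v) \<noteq> 1"
      moreover have "count (edges t) (u, v) > 0" using uv by simp
      ultimately have "{#(u, v), (u, v)#} \<subseteq># edges t"
        by (intro mset_subset_eqI) (auto simp del: count_greater_zero_iff)
      then have "is_cycle t [u, v]" using orient[OF uv] by (simp add: cyc)
      with nc show False by blast
    qed
    then show "simple_graph t" by (auto simp: simple_graph_iff_count)
    then have simple: "edges t = mset_set ?E" by (simp only: simple_graph_def)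
    fix u v assume uv: "(u, v) \<in> ?E" and conn: "(u, v) \<in> conn (?E - {(u, v)})"
    obtain p where p: "p \<noteq> []" "hd p = u" "last p = v" "distinct p"
      "\<And>a b. (a, b) \<in> set (zip p (tl p)) \<Longrightarrow> ed a b \<in> ?E - {(u, v)}"
      using conn_distinct_path[OF _ conn, of V] bip by blast
    define L where "L = map ?f (zip p (tl p))"
    have L: "set L \<subseteq> ?E - {(u, v)}"
    proof
      fix e assume "e \<in> set L"
      then obtain a b where ab: "(a, b) \<in> set (zip p (tl p))" "e = ed a b" by (auto simp: L_def)
      show "e \<in> ?E - {(u, v)}" unfolding ab(2) by (rule p(5)[OF ab(1)])
    qed
    then have "distinct (L @ [(u, v)])" "set (L @ [(u, v)]) \<subseteq> ?E"
      using distinct_path_edges[OF p(4), folded L_def] uv by auto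
    then have "mset (L @ [(u, v)]) \<subseteq># mset_set ?E"
      unfolding mset_subset_mset_set[OF fin] by blast
    then have "mset (L @ [(u, v)]) \<subseteq># edges t"
      by (simp only: simple[symmetric])
    moreover have "2 \<le> length p"
      using p(1-3) orient(3)[OF uv] by (cases p rule: list.exhaust; cases "tl p") auto
    ultimately have "is_cycle t p"
      unfolding cyc L_def p(2,3) orient(2)[OF uv] using p(4) by blast
    with nc show False by blast
  next
    assume simple_bridges: "simple_graph t \<and> (\<forall>u v. (u, v) \<in> ?E \<longrightarrow> (u, v) \<notin> conn (?E - {(u, v)}))"
    assume "\<exists>vs. is_cycle t vs"
    then obtain vs where vs: "is_cycle t vs" by blast
    let ?e = "ed (last vs) (hd vs)"
    define L where "L = map ?f (zip vs (tl vs))"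
    have len: "2 \<le> length vs" and "mset (L @ [?e]) \<subseteq># edges t"
      using vs unfolding cyc L_def by blast+
    moreover have "edges t = mset_set ?E" using simple_bridges by (simp only: simple_graph_def)
    ultimately have "mset (L @ [?e]) \<subseteq># mset_set ?E" by (simp only:)
    then have L: "distinct (L @ [?e])" "set (L @ [?e]) \<subseteq> ?E"
      unfolding mset_subset_mset_set[OF fin] by blast+
    have conn: "(hd vs, last vs) \<in> conn (?E - {?e})"
    proof (rule conn_zip_tl)
      fix u v assume "(u, v) \<in> set (zip vs (tl vs))"
      then have "ed u v \<in> set L" by (force simp: L_def)
      then show "ed u v \<in> ?E - {?e}" using L by auto
    qed (use len in auto)
    have "?e \<in> ?E" using L by simp
    moreover have "?e = (last vs, hd vs) \<or> ?e = (hd vs, last vs)"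
      by (auto simp: ed_def max_def min_def)
    ultimately show False using conn conn_sym simple_bridges by metis
  qed
qed

lemma bipartite_tree_iff:
  "bipartite_tree t \<longleftrightarrow> is_tree (verts t) (edge_set t) \<and> simple_graph t"
proof -
  \<comment> \<open>\<open>acyclic_iff_bridges\<close> is available only under the bipartite
    condition, here \<open>P\<close>, so the conjuncts are rearranged with \<open>P\<close> as a
    premise.\<close>
  have taut: "(P \<and> N \<and> K \<and> C) = ((F \<and> N \<and> Z \<and> P \<and> K \<and> B) \<and> D)"
    if "F" "Z" "P \<Longrightarrow> C = (D \<and> B)" for P N K C F Z B D
    using that by blast
  show ?thesis
    unfolding bipartite_tree_def black_Un_white bipartite_graph_iff connected_graph_iff is_tree_def
    by (rule taut, simp, simp, rule acyclic_iff_bridges, assumption, simp)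
qed

lemma incident_edges_eq: "simple_graph t \<Longrightarrow>
  incident_edges t v = mset_set (inc (edge_set t) v)"
  using filter_mset_mset_set[of "edge_set t" "\<lambda>e. fst e = v \<or> snd e = v"]
  by (simp only: incident_edges_def inc_def simple_graph_def[symmetric] finite_set_mset)
    (simp only: simple_graph_def)

lemma degree_eq: "simple_graph t \<Longrightarrow> degree t v = card (inc (edge_set t) v)"
  by (simp add: degree_def incident_edges_eq)

definition white_leaf_tree :: "int set \<Rightarrow> (int \<times> int) set \<Rightarrow> bool" where
  "white_leaf_tree V E \<longleftrightarrow> is_tree V E \<and> (\<forall>v\<in>V. 0 < v \<longrightarrow> card (inc E v) \<noteq> 1)"

lemma white_leaf_trees_iff:
  "t \<in> white_leaf_trees \<longleftrightarrow> white_leaf_tree (verts t) (edge_set t) \<and> simple_graph t"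
proof -
  have "v \<in> white t \<longleftrightarrow> \<not> 0 < v" if "v \<in> verts t" for v
    using that by (auto simp: white_def vertices_def)
  then show ?thesis
    unfolding white_leaf_trees_def white_leaf_tree_def mem_Collect_eq bipartite_tree_iff black_Un_white
    by (auto simp: degree_eq)
qed

lemma white_leaf_trees_bij:
  "bij_betw (\<lambda>E. \<lparr>num_black = n, num_white = k, edges = mset_set E\<rparr>)
     {E. white_leaf_tree (vertices n k) E} {t \<in> white_leaf_trees. num_black t = n \<and> num_white t = k}"
proof -
  have fin: "finite E" if "white_leaf_tree V E" for V E
    using that is_tree_finite by (auto simp: white_leaf_tree_def)
  have "edge_set t \<in> {E. white_leaf_tree (vertices n k) E}"
    "t = \<lparr>num_black = n, num_white = k, edges = mset_set (edge_set t)\<rparr>"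
    if "t \<in> white_leaf_trees" "num_black t = n" "num_white t = k" for t
    using that unfolding white_leaf_trees_iff simple_graph_def
    by (simp_all only: mem_Collect_eq, intro bigraph.equality) (simp_all only: bigraph.simps unit_eq)
  then show ?thesis
    using fin by (intro bij_betw_byWitness[where f' = edge_set]) (auto simp: white_leaf_trees_iff simple_graph_def)
qed

text \<open>The lone black vertex is the only tree of degree 0 in g; it accounts for the term
  \<open>S []\<close>.\<close>

lemma white_leaf_tree_0_iff: "white_leaf_tree (vertices n 0) E \<longleftrightarrow> n = 1 \<and> E = {}"
proof
  assume "white_leaf_tree (vertices n 0) E"
  then have t: "is_tree (vertices n 0) E" by (simp add: white_leaf_tree_def)
  have "bip (vertices n 0) = {}" by (auto simp: bip_def vertices_def)
  with t have E: "E = {}" unfolding is_tree_def by blast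
  have "vertices 0 0 = {}" by (simp add: vertices_def)
  with t have "n \<noteq> 0" unfolding is_tree_def by metis
  moreover have "\<not> 2 \<le> n"
  proof
    assume "2 \<le> n"
    then have "(1, 2) \<in> conn E" using t by (simp add: is_tree_def vertices_def)
    then show False using E by (simp add: conn_def)
  qed
  ultimately show "n = 1 \<and> E = {}" using E by simp
next
  have "vertices 1 0 = {1}" by (auto simp: vertices_def)
  then show "n = 1 \<and> E = {} \<Longrightarrow> white_leaf_tree (vertices n 0) E"
    by (simp add: white_leaf_tree_def is_tree_singleton_iff inc_def)
qed

lemma num_black_le_num_white:
  assumes "t \<in> white_leaf_trees" "num_white t = Suc k"
  shows "num_black t \<le> k"
proof (rule card_black_less_card_white)
  have "white_leaf_tree (vertices (num_black t) (Suc k)) (edge_set t)"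
    using assms unfolding white_leaf_trees_iff by metis
  then show "is_tree (vertices (num_black t) (Suc k)) (edge_set t)"
    "\<And>v. v \<in> vertices (num_black t) (Suc k) \<Longrightarrow> 0 < v \<Longrightarrow> card (inc (edge_set t) v) \<noteq> 1"
    unfolding white_leaf_tree_def by blast+
qed

lemma finite_white_leaf_trees: "finite {t \<in> white_leaf_trees. num_white t = k}"
proof -
  \<comment> \<open>\<open>Suc k\<close> rather than k because of the lone black vertex at k =
    0.\<close>
  have "num_black t \<le> Suc k" if "t \<in> white_leaf_trees" "num_white t = k" for t
    using that num_black_le_num_white[of t "k - 1"] white_leaf_tree_0_iff[of "num_black t"]
    by (cases k) (auto simp: white_leaf_trees_iff)
  then have "{t \<in> white_leaf_trees. num_white t = k} \<subseteq>
      (\<Union>n\<le>Suc k. {t \<in> white_leaf_trees. num_black t = n \<and> num_white t = k})"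
    by auto
  moreover have "finite {t \<in> white_leaf_trees. num_black t = n \<and> num_white t = k}" for n
  proof -
    have "finite {E. white_leaf_tree (vertices n k) E}"
      by (rule finite_subset[OF _ finite_trees[of "vertices n k"]]) (auto simp: white_leaf_tree_def)
    then show ?thesis using bij_betw_finite[OF white_leaf_trees_bij] by blast
  qed
  ultimately show ?thesis by (meson finite_UN_I finite_atMost finite_subset)
qed

section \<open>Isomorphisms\<close>

lemma graph_iso_trans:
  assumes "graph_iso t t' (p, q)" "graph_iso t' t'' (p', q')"
  shows "graph_iso t t'' (p' \<circ> p, q' \<circ> q)"
proof -
  have "p permutes black t" "p' permutes black t" "q permutes white t" "q' permutes white t"
    using assms by (auto simp: graph_iso_def black_def white_def)
  moreover have "image_mset (map_prod (p' \<circ> p) (q' \<circ> q)) (edges t) = edges t''"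
    using assms by (auto simp: graph_iso_def map_prod_compose multiset.map_comp[symmetric])
  ultimately show ?thesis
    using assms by (simp add: graph_iso_def permutes_compose)
qed

lemma graph_iso_sym:
  assumes "graph_iso t t' (p, q)"
  shows "graph_iso t' t (inv p, inv q)"
proof -
  have pq: "p permutes black t" "q permutes white t" and e: "image_mset (map_prod p q) (edges t) = edges t'"
    and n: "num_black t = num_black t'" "num_white t = num_white t'"
    using assms by (auto simp: graph_iso_def)
  have "map_prod (inv p) (inv q) \<circ> map_prod p q = id"
    using permutes_inv_o[OF pq(1)] permutes_inv_o[OF pq(2)] by (simp add: map_prod_compose[symmetric] map_prod.id)
  then have "image_mset (map_prod (inv p) (inv q)) (edges t') = edges t"
    unfolding e[symmetric] by (simp add: multiset.map_comp)
  then show ?thesis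
    using pq n permutes_inv by (auto simp: graph_iso_def black_def white_def)
qed

lemma graph_iso_refl: "graph_iso t t (id, id)"
  by (simp add: graph_iso_def permutes_id map_prod.id)

lemma equiv_tree_iso: "equiv white_leaf_trees tree_iso"
proof (rule equivI)
  show "refl_on white_leaf_trees tree_iso"
    using graph_iso_refl by (auto simp: refl_on_def tree_iso_def)
  show "sym tree_iso"
    unfolding sym_def tree_iso_def using graph_iso_sym by (auto simp: split_paired_Ex) blast
  show "trans tree_iso"
    unfolding trans_def tree_iso_def using graph_iso_trans by (auto simp: split_paired_Ex) blast
qed (auto simp: tree_iso_def)

text \<open>On graphs with the given signs the two permutations act as one.\<close>
definition glue :: "(int \<Rightarrow> int) \<Rightarrow> (int \<Rightarrow> int) \<Rightarrow> int \<Rightarrow> int" where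
  "glue p q v = (if 0 < v then p v else q v)"

lemma glue:
  assumes "p permutes black t" "q permutes white t"
  shows "inj_on (glue p q) (verts t)" "\<And>v. v \<in> verts t \<Longrightarrow> sgn (glue p q v) = sgn v"
    "glue p q ` verts t = verts t"
    "E \<subseteq> bip (verts t) \<Longrightarrow> map_prod p q ` E = map_prod (glue p q) (glue p q) ` E"
proof -
  have b: "v \<in> black t \<Longrightarrow> glue p q v = p v" and w: "v \<in> white t \<Longrightarrow> glue p q v = q v" for v
    by (auto simp: glue_def black_def white_def)
  have p: "p v \<in> black t \<longleftrightarrow> v \<in> black t" and q: "q v \<in> white t \<longleftrightarrow> v \<in> white t" for v
    using permutes_in_image[OF assms(1)] permutes_in_image[OF assms(2)] by simp_all
  show sgn: "sgn (glue p q v) = sgn v" if "v \<in> verts t" for v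
  proof (cases "v \<in> black t")
    case True
    then have "0 < v" "0 < glue p q v" using b p[of v] by (simp_all add: black_def)
    then show ?thesis by simp
  next
    case False
    then have "v \<in> white t" using that black_Un_white by blast
    then have "v < 0" "glue p q v < 0" using w q[of v] by (simp_all add: white_def)
    then show ?thesis by simp
  qed
  show "inj_on (glue p q) (verts t)"
  proof (rule inj_onI)
    fix x y assume xy: "x \<in> verts t" "y \<in> verts t" "glue p q x = glue p q y"
    then have "0 < x \<longleftrightarrow> 0 < y" using sgn sgn_1_pos by metis
    then have "p x = p y \<or> q x = q y" using xy(3) by (auto simp: glue_def split: if_splits)
    then show "x = y" using permutes_inj[OF assms(1)] permutes_inj[OF assms(2)] by (auto dest: injD)
  qed
  have "glue p q ` black t = p ` black t" "glue p q ` white t = q ` white t"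
    by (simp_all add: b w cong: image_cong)
  then have "glue p q ` black t = black t" "glue p q ` white t = white t"
    using permutes_image[OF assms(1)] permutes_image[OF assms(2)] by simp_all
  then show "glue p q ` verts t = verts t"
    unfolding black_Un_white[symmetric] image_Un by simp
  show "map_prod p q ` E = map_prod (glue p q) (glue p q) ` E" if "E \<subseteq> bip (verts t)"
    using that by (intro image_cong refl) (auto simp: glue_def bip_def)
qed

text \<open>Ensures that an isomorphism class is a whole orbit of the relabellings.\<close>

lemma white_leaf_trees_image:
  assumes t: "t \<in> white_leaf_trees" and pq: "p permutes black t" "q permutes white t"
  shows "t\<lparr>edges := image_mset (map_prod p q) (edges t)\<rparr> \<in> white_leaf_trees"
proof -
  let ?E = "edge_set t" and ?\<pi> = "glue p q"
  note glue = glue[OF pq]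
  have tree: "is_tree (verts t) ?E" and simple: "edges t = mset_set ?E"
    and nl: "\<And>v. v \<in> verts t \<Longrightarrow> 0 < v \<Longrightarrow> card (inc ?E v) \<noteq> 1"
    using t unfolding white_leaf_trees_iff white_leaf_tree_def simple_graph_def by blast+
  have E: "?E \<subseteq> bip (verts t)" using tree by (simp add: is_tree_def)
  then have EV: "?E \<subseteq> verts t \<times> verts t" by (auto simp: bip_def)
  have inj: "inj_on (map_prod ?\<pi> ?\<pi>) ?E"
    using map_prod_inj_on[OF glue(1) glue(1)] EV by (rule inj_on_subset)
  have tree': "is_tree (verts t) (map_prod ?\<pi> ?\<pi> ` ?E)"
    using is_tree_image[OF tree glue(1,2)] glue(3) by simp
  have "card (inc (map_prod ?\<pi> ?\<pi> ` ?E) v) \<noteq> 1" if "v \<in> verts t" "0 < v" for v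
  proof -
    have "v \<in> ?\<pi> ` verts t" using that(1) glue(3) by simp
    then obtain u where u: "u \<in> verts t" "v = ?\<pi> u" by (elim imageE)
    then have "0 < u" using glue(2)[OF u(1)] that(2) sgn_1_pos by metis
    have "card (inc (map_prod ?\<pi> ?\<pi> ` ?E) v) = card (inc ?E u)"
      unfolding u(2) inc_image[OF EV glue(1) u(1)]
      by (intro card_image inj_on_subset[OF inj]) (auto simp: inc_def)
    then show ?thesis using nl u \<open>0 < u\<close> by simp
  qed
  then have wlt: "white_leaf_tree (verts t) (map_prod p q ` ?E)"
    using tree' unfolding glue(4)[OF E] white_leaf_tree_def by blast
  have inj': "inj_on (map_prod p q) ?E"
    using permutes_inj[OF pq(1)] permutes_inj[OF pq(2)] by (intro inj_on_subset[OF prod.inj_map]) auto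
  have "image_mset (map_prod p q) (edges t) = mset_set (map_prod p q ` ?E)"
    by (subst simple) (simp add: image_mset_mset_set[OF inj'])
  then show ?thesis using wlt by (simp add: white_leaf_trees_iff simple_graph_def)
qed

text \<open>Orbit-stabilizer for the action of the relabellings on \<open>t\<close>.\<close>
lemma card_iso_class:
  assumes t: "t \<in> white_leaf_trees"
  shows "card (tree_iso `` {t}) * card (automorphisms t) = fact (num_black t) * fact (num_white t)"
    "finite (tree_iso `` {t})" "card (automorphisms t) \<noteq> 0"
proof -
  let ?G = "{p. p permutes black t} \<times> {q. q permutes white t}"
  let ?F = "\<lambda>(p, q). t\<lparr>edges := image_mset (map_prod p q) (edges t)\<rparr>"
  have finG: "finite ?G" and cardG: "card ?G = fact (num_black t) * fact (num_white t)"
    by (simp_all add: black_def white_def finite_permutations card_permutations)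
  have iso: "graph_iso t t' g \<longleftrightarrow> g \<in> ?G \<and> ?F g = t'" for t' g
    by (cases g) (auto simp: graph_iso_def intro: bigraph.equality)
  have cls: "tree_iso `` {t} = ?F ` ?G"
    using white_leaf_trees_image t iso unfolding tree_iso_def by fastforce
  then show fin: "finite (tree_iso `` {t})" using finG by simp
  have aut: "automorphisms t \<subseteq> ?G" by (auto simp: automorphisms_def iso)
  have "(id, id) \<in> automorphisms t" by (simp add: automorphisms_def graph_iso_refl)
  then show "card (automorphisms t) \<noteq> 0"
    using finite_subset[OF aut finG] by auto
  \<comment> \<open>The isomorphisms from t to t' form a coset of the automorphism group, so all
    fibres of the orbit map have the same size.\<close>
  have fibre: "card {g \<in> ?G. ?F g = t'} = card (automorphisms t)" if t': "t' \<in> tree_iso `` {t}" for t'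
  proof -
    obtain p q where pq: "graph_iso t t' (p, q)" using t' by (auto simp: tree_iso_def)
    then have perm: "p permutes black t" "q permutes white t" by (auto simp: graph_iso_def)
    have "bij_betw (\<lambda>(p', q'). (p \<circ> p', q \<circ> q')) (automorphisms t) {g. graph_iso t t' g}"
    proof (rule bij_betw_byWitness[where f' = "\<lambda>(p', q'). (inv p \<circ> p', inv q \<circ> q')"])
      show "\<forall>g\<in>automorphisms t. (\<lambda>(p', q'). (inv p \<circ> p', inv q \<circ> q')) ((\<lambda>(p', q'). (p \<circ> p', q \<circ> q')) g) = g"
        using permutes_inv_o[OF perm(1)] permutes_inv_o[OF perm(2)] by (auto simp: comp_assoc[symmetric])
      show "\<forall>g\<in>{g. graph_iso t t' g}. (\<lambda>(p', q'). (p \<circ> p', q \<circ> q')) ((\<lambda>(p', q'). (inv p \<circ> p', inv q \<circ> q')) g) = g"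
        using permutes_inv_o[OF perm(1)] permutes_inv_o[OF perm(2)] by (auto simp: comp_assoc[symmetric])
      show "(\<lambda>(p', q'). (p \<circ> p', q \<circ> q')) ` automorphisms t \<subseteq> {g. graph_iso t t' g}"
        using graph_iso_trans[OF _ pq] by (auto simp: automorphisms_def)
      show "(\<lambda>(p', q'). (inv p \<circ> p', inv q \<circ> q')) ` {g. graph_iso t t' g} \<subseteq> automorphisms t"
        using graph_iso_trans[OF _ graph_iso_sym[OF pq]] by (auto simp: automorphisms_def)
    qed
    then have "card (automorphisms t) = card {g. graph_iso t t' g}" by (rule bij_betw_same_card)
    also have "{g. graph_iso t t' g} = {g \<in> ?G. ?F g = t'}" using iso by blast
    finally show ?thesis by simp
  qed
  have "card ?G = (\<Sum>t'\<in>tree_iso `` {t}. card {g \<in> ?G. ?F g = t'})"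
    using sum.group[OF finG fin, of ?F "\<lambda>_. 1 :: nat"] cls by simp
  also have "\<dots> = (\<Sum>t'\<in>tree_iso `` {t}. card (automorphisms t))"
    by (rule sum.cong) (simp_all only: fibre)
  finally show "card (tree_iso `` {t}) * card (automorphisms t) = fact (num_black t) * fact (num_white t)"
    using cardG by simp
qed

section \<open>The pullback\<close>

lemma fps_has_sum_graded:
  fixes c :: "'a \<Rightarrow> real" and d :: "'a \<Rightarrow> nat"
  assumes fin: "\<And>k. finite {t \<in> A. d t = k}" and F: "\<And>k. F $ k = (\<Sum>t | t \<in> A \<and> d t = k. c t)"
  shows "((\<lambda>t. fps_const (c t) * fps_X ^ d t) has_sum F) A"
proof (rule fps_has_sumI)
  fix k
  have nth: "(fps_const (c t) * fps_X ^ d t) $ k = (if d t = k then c t else 0)" for t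
    by (simp add: fps_X_power_nth)
  then have sub: "{t \<in> A. (fps_const (c t) * fps_X ^ d t) $ k \<noteq> 0} \<subseteq> {t \<in> A. d t = k}"
    by auto
  then show "finite {t \<in> A. (fps_const (c t) * fps_X ^ d t) $ k \<noteq> 0}"
    using fin by (rule finite_subset)
  show "F $ k = (\<Sum>t | t \<in> A \<and> (fps_const (c t) * fps_X ^ d t) $ k \<noteq> 0. (fps_const (c t) * fps_X ^ d t) $ k)"
    unfolding F using sub fin[of k] by (intro sum.mono_neutral_cong_right) (auto simp: nth)
qed

definition mset_eval :: "('n list \<Rightarrow> real) \<Rightarrow> 'n multiset \<Rightarrow> real" where
  "mset_eval T M = T (SOME l. mset l = M)"

lemma mset_eval_mset:
  assumes "\<And>a b. mset a = mset b \<Longrightarrow> T a = T b"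
  shows "mset_eval T (mset a) = T a"
  unfolding mset_eval_def by (rule assms, rule someI_ex[of "\<lambda>l. mset l = mset a"]) auto

lemma edge_list: "mset (edge_list t v) = incident_edges t v"
  unfolding edge_list_def by (rule someI_ex[of "\<lambda>es. mset es = incident_edges t v"]) (rule ex_mset)

context
  fixes U :: "(real^'m::finite) set" and V :: "(real^'n::finite) set"
    and S :: "('m, 'n) generating_function"
    and g :: "real^'n \<Rightarrow> real" and x :: "real^'m"
  assumes thick: "thick_morphism U V S" and smooth: "smooth_on V g" and x: "x \<in> U"
begin

text \<open>The derivatives of S in q at q = 0.\<close>

definition S_mset :: "'n multiset \<Rightarrow> real" where
  "S_mset M = fact (size M) * mset_eval (\<lambda>a. S a x) M"

text \<open>Dropping the linear part of \<open>S\<close> amounts to measuring \<open>y\<close> from \<open>\<phi>(x)\<close>, and it kills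
  the trees with black leaves.\<close>
definition S_nonlin :: "'n multiset \<Rightarrow> real" where
  "S_nonlin M = (if size M = 1 then 0 else S_mset M)"

definition g_mset :: "'n multiset \<Rightarrow> real" where
  "g_mset = mset_eval (\<lambda>a. iter_partial a g (base_map S x))"

lemma S_mset: "S_mset (mset a) = fact (length a) * S a x"
proof -
  have "mset_eval (\<lambda>a. S a x) (mset a) = S a x"
  proof (rule mset_eval_mset)
    show "S a x = S b x" if "mset a = mset b" for a b
      using thick that unfolding thick_morphism_def by metis
  qed
  then show ?thesis by (simp add: S_mset_def)
qed

lemma S_eq_S_mset: "S a x = S_mset (mset a) / fact (length a)"
  by (simp add: S_mset)

lemma g_mset: "g_mset (mset a) = iter_partial a g (base_map S x)"
proof -
  have V: "open V" "base_map S x \<in> V" using thick x unfolding thick_morphism_def by blast+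
  show ?thesis
    unfolding g_mset_def by (rule mset_eval_mset) (rule iter_partial_mset_cong[OF V(1) smooth V(2)])
qed

lemma S_nonlin_single: "S_nonlin {#i#} = 0"
  by (simp add: S_nonlin_def)

lemma tree_pairing_eq_graph_weight:
  assumes "bipartite_tree t"
  shows "tree_pairing S g t x = graph_weight S_mset g_mset (verts t) (edge_set t) (\<lambda>_. {#})"
proof -
  have simple: "simple_graph t" using assms by (simp add: bipartite_tree_iff)
  have m: "image_mset \<iota> (mset_set (inc (edge_set t) v)) = mset (map \<iota> (edge_list t v))" for \<iota> :: "int \<times> int \<Rightarrow> 'n" and v
    using simple by (simp add: edge_list incident_edges_eq)
  have len: "length (edge_list t v) = degree t v" for v
    by (metis degree_def edge_list size_mset)
  have fin: "finite (black t)" "finite (white t)" "black t \<inter> white t = {}"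
    by (auto simp: black_def white_def)
  have w: "(\<Prod>v\<in>verts t. vertex_weight S_mset g_mset v ({#} + mset (map \<iota> (edge_list t v)))) =
     (\<Prod>v\<in>black t. fact (degree t v) * S (map \<iota> (edge_list t v)) x) *
     (\<Prod>w\<in>white t. iter_partial (map \<iota> (edge_list t w)) g (base_map S x))" for \<iota>
  proof -
    have "(\<Prod>v\<in>black t. vertex_weight S_mset g_mset v ({#} + mset (map \<iota> (edge_list t v)))) =
      (\<Prod>v\<in>black t. fact (degree t v) * S (map \<iota> (edge_list t v)) x)"
    proof (rule prod.cong[OF refl])
      fix v assume "v \<in> black t"
      then have "0 < v" by (simp add: black_def)
      then show "vertex_weight S_mset g_mset v ({#} + mset (map \<iota> (edge_list t v))) =
          fact (degree t v) * S (map \<iota> (edge_list t v)) x"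
        by (simp only: vertex_weight_def add_0 S_mset length_map len if_True)
    qed
    moreover have "(\<Prod>v\<in>white t. vertex_weight S_mset g_mset v ({#} + mset (map \<iota> (edge_list t v)))) =
      (\<Prod>w\<in>white t. iter_partial (map \<iota> (edge_list t w)) g (base_map S x))"
    proof (rule prod.cong[OF refl])
      fix v assume "v \<in> white t"
      then have "\<not> 0 < v" by (simp add: white_def)
      then show "vertex_weight S_mset g_mset v ({#} + mset (map \<iota> (edge_list t v))) =
          iter_partial (map \<iota> (edge_list t v)) g (base_map S x)"
        by (simp only: vertex_weight_def add_0 g_mset if_False)
    qed
    ultimately show ?thesis
      unfolding black_Un_white[symmetric] using fin by (simp only: prod.union_disjoint)
  qed
  show ?thesis
    unfolding tree_pairing_def graph_weight_def m w ..
qed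

text \<open>The two tensors differ only at single indices, and a black vertex would see a single
  index only as a leaf.\<close>

lemma graph_weight_white_leaf_tree:
  assumes "white_leaf_tree N E"
  shows "graph_weight S_mset \<gamma> N E (\<lambda>_. {#}) = graph_weight S_nonlin \<gamma> N E (\<lambda>_. {#})"
proof -
  have "vertex_weight S_mset \<gamma> v (image_mset \<iota> (mset_set (inc E v))) =
      vertex_weight S_nonlin \<gamma> v (image_mset \<iota> (mset_set (inc E v)))" if "v \<in> N" for v \<iota>
    using assms that by (auto simp: vertex_weight_def S_nonlin_def white_leaf_tree_def)
  then show ?thesis by (simp add: graph_weight_def)
qed

text \<open>The sum may be enlarged to all trees, since with \<open>S_nonlin\<close> the added ones
  have weight 0. Without extra indices the root -1 is an ordinary vertex.\<close>

lemma sum_white_leaf_trees_fixed_size: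
  "(\<Sum>t | t \<in> white_leaf_trees \<and> num_black t = n \<and> num_white t = Suc k. tree_pairing S g t x) =
   white_rooted S_nonlin g_mset n k {#}"
proof -
  let ?V = "vertices n (Suc k)"
  have "(\<Sum>t | t \<in> white_leaf_trees \<and> num_black t = n \<and> num_white t = Suc k. tree_pairing S g t x) =
     (\<Sum>E | white_leaf_tree ?V E. tree_pairing S g \<lparr>num_black = n, num_white = Suc k, edges = mset_set E\<rparr> x)"
    by (rule sum.reindex_bij_betw[OF white_leaf_trees_bij, symmetric])
  also have "\<dots> = (\<Sum>E | white_leaf_tree ?V E. graph_weight S_nonlin g_mset ?V E (\<lambda>_. {#}))"
  proof (rule sum.cong[OF refl], unfold mem_Collect_eq)
    fix E assume E: "white_leaf_tree ?V E"
    then have t: "is_tree ?V E" by (simp add: white_leaf_tree_def)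
    then have "bipartite_tree \<lparr>num_black = n, num_white = Suc k, edges = mset_set E\<rparr>"
      by (simp add: bipartite_tree_iff simple_graph_def is_tree_finite)
    then show "tree_pairing S g \<lparr>num_black = n, num_white = Suc k, edges = mset_set E\<rparr> x =
        graph_weight S_nonlin g_mset ?V E (\<lambda>_. {#})"
      using is_tree_finite[OF t] graph_weight_white_leaf_tree[OF E]
      by (simp add: tree_pairing_eq_graph_weight)
  qed
  also have "\<dots> = (\<Sum>E | is_tree ?V E. graph_weight S_nonlin g_mset ?V E (\<lambda>_. {#}))"
  proof (rule sum.mono_neutral_left)
    show "finite {E. is_tree ?V E}" by (simp add: finite_trees)
    show "{E. white_leaf_tree ?V E} \<subseteq> {E. is_tree ?V E}" by (auto simp: white_leaf_tree_def)
    show "\<forall>E\<in>{E. is_tree ?V E} - {E. white_leaf_tree ?V E}.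
        graph_weight S_nonlin g_mset ?V E (\<lambda>_. {#}) = 0"
    proof
      fix E assume "E \<in> {E. is_tree ?V E} - {E. white_leaf_tree ?V E}"
      then obtain v where "v \<in> ?V" "0 < v" "card (inc E v) = 1" by (auto simp: white_leaf_tree_def)
      then show "graph_weight S_nonlin g_mset ?V E (\<lambda>_. {#}) = 0"
        by (intro graph_weight_black_leaf S_nonlin_single) simp_all
    qed
  qed
  finally show ?thesis by (simp add: white_rooted_def tree_sum_def fun_upd_idem)
qed

lemma ev_S_nonlin:
  assumes q: "\<And>i. q i $ 0 = 0"
  shows "ev (\<lambda>M. S_mset (add_mset i M)) q = ev (\<lambda>M. S_nonlin (add_mset i M)) q + fps_const (S [i] x)"
    and "ev S_mset q = ev S_nonlin q + (\<Sum>i\<in>UNIV. fps_const (S [i] x) * q i)"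
proof -
  show *: "ev (\<lambda>M. S_mset (add_mset i M)) q = ev (\<lambda>M. S_nonlin (add_mset i M)) q + fps_const (S [i] x)" for i
  proof (rule fps_ext)
    fix k
    have "homog_part (\<lambda>M. S_mset (add_mset i M)) q (Suc m) = homog_part (\<lambda>M. S_nonlin (add_mset i M)) q (Suc m)" for m
      by (simp add: S_nonlin_def)
    moreover have "S_mset {#i#} = S [i] x" using S_mset[of "[i]"] by simp
    ultimately show "ev (\<lambda>M. S_mset (add_mset i M)) q $ k =
        (ev (\<lambda>M. S_nonlin (add_mset i M)) q + fps_const (S [i] x)) $ k"
      by (simp add: ev_def sum.atMost_shift S_nonlin_single del: homog_part.simps(2))
  qed
  \<comment> \<open>Differentiating reduces the second identity to the first; the constant terms
    agree because each \<open>q i\<close> has none.\<close>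
  have "fps_deriv (ev S_mset q) = fps_deriv (ev S_nonlin q + (\<Sum>i\<in>UNIV. fps_const (S [i] x) * q i))"
    by (simp add: fps_deriv_ev[OF q] * fps_deriv_sum distrib_right sum.distrib)
  moreover have "ev S_mset q $ 0 = (ev S_nonlin q + (\<Sum>i\<in>UNIV. fps_const (S [i] x) * q i)) $ 0"
    by (simp add: ev_nth_0 fps_sum_nth q S_nonlin_def)
  ultimately show "ev S_mset q = ev S_nonlin q + (\<Sum>i\<in>UNIV. fps_const (S [i] x) * q i)"
    unfolding fps_deriv_eq_iff by simp
qed

lemma base_map_nth: "vec_nth (base_map S x) i = S [i] x"
  by (simp add: base_map_def)

lemma taylor_eval_eq_ev:
  assumes "\<And>i. y i $ 0 = S [i] x"
  shows "taylor_eval (partial_deriv i g) (base_map S x) y =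
      ev (\<lambda>M. g_mset (add_mset i M)) (\<lambda>i. y i - fps_const (S [i] x))"
    and "taylor_eval g (base_map S x) y = ev g_mset (\<lambda>i. y i - fps_const (S [i] x))"
proof -
  \<comment> \<open>The derivative in \<open>i\<close> acts on g before those in \<open>a\<close>,
    so \<open>i\<close> stands last in the list; the multiset forgets this.\<close>
  have "iter_partial a (partial_deriv i g) (base_map S x) = g_mset (add_mset i (mset a))" for a
    using g_mset[of "a @ [i]"] by (simp add: iter_partial_append)
  then show "taylor_eval (partial_deriv i g) (base_map S x) y =
      ev (\<lambda>M. g_mset (add_mset i M)) (\<lambda>i. y i - fps_const (S [i] x))"
    unfolding taylor_eval_def base_map_nth by (intro subst_series_eq_ev) (simp_all add: assms)
  show "taylor_eval g (base_map S x) y = ev g_mset (\<lambda>i. y i - fps_const (S [i] x))"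
    unfolding taylor_eval_def base_map_nth by (intro subst_series_eq_ev) (simp_all add: assms g_mset)
qed

text \<open>Rewriting substitutions as \<open>ev\<close> requires series without constant term. If
  the constant terms are wrong, both sides are false for that reason alone.\<close>

lemma pullback_equations_iff:
  "pullback_equations S g x q y \<longleftrightarrow>
     critical_equations S_nonlin g_mset q (\<lambda>i. y i - fps_const (S [i] x))"
proof (cases "(\<forall>i. q i $ 0 = 0) \<and> (\<forall>i. y i $ 0 = S [i] x)")
  case True
  then have q: "q i $ 0 = 0" and y: "y i $ 0 = S [i] x" for i by blast+
  have s: "subst_series (dq i (\<lambda>a. S a x)) q = ev (\<lambda>M. S_nonlin (add_mset i M)) q + fps_const (S [i] x)" for i
    unfolding ev_S_nonlin(1)[OF q, symmetric]
    by (intro subst_series_eq_ev q dq_symmetric S_eq_S_mset)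
  have z: "(y i - fps_const (S [i] x)) $ 0 = 0" for i
    by (simp add: y)
  show ?thesis
    unfolding pullback_equations_def critical_equations_def base_map_nth
    by (simp only: q y z s taylor_eval_eq_ev(1)[OF y] diff_eq_eq simp_thms)
next
  case False
  have "(y i - fps_const (S [i] x)) $ 0 = 0 \<longleftrightarrow> y i $ 0 = S [i] x" for i
    by simp
  with False show ?thesis
    unfolding pullback_equations_def critical_equations_def base_map_nth by (simp only:) blast
qed

lemma pullback_equations_unique: "\<exists>!p. case p of (q, y) \<Rightarrow> pullback_equations S g x q y"
proof -
  let ?q = "\<lambda>i. fps_X * white_gf S_nonlin g_mset {#i#}"
  let ?y = "\<lambda>i. black_gf S_nonlin g_mset {#i#} + fps_const (S [i] x)"
  have "pullback_equations S g x q y \<longleftrightarrow> q = ?q \<and> y = ?y" for q y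
    unfolding pullback_equations_iff critical_value_tree_expansion(1)[of S_nonlin, OF S_nonlin_single]
    by (simp only: fun_eq_iff diff_eq_eq)
  then show ?thesis by (intro ex1I[of _ "(?q, ?y)"]) auto
qed

lemma pullback_nth:
  "pullback S g x $ 0 = S [] x"
  "pullback S g x $ Suc k = (\<Sum>n\<le>k. white_rooted S_nonlin g_mset n k {#} / (fact n * fact (Suc k)))"
proof -
  obtain q y where THE: "(THE (q, y). pullback_equations S g x q y) = (q, y)"
    by (cases "THE (q, y). pullback_equations S g x q y") auto
  have eqs: "pullback_equations S g x q y"
    using theI'[OF pullback_equations_unique] unfolding THE by simp
  then have q: "\<And>i. q i $ 0 = 0" and y: "\<And>i. y i $ 0 = S [i] x"
    by (auto simp: pullback_equations_def base_map_nth)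
  let ?z = "\<lambda>i. y i - fps_const (S [i] x)"
  have crit: "critical_equations S_nonlin g_mset q ?z"
    using eqs by (simp only: pullback_equations_iff)
  have "subst_series (\<lambda>a. S a x) q = ev S_mset q"
    by (intro subst_series_eq_ev q S_eq_S_mset)
  \<comment> \<open>The pairing of \<open>y\<close> with \<open>q\<close> exceeds that of
    \<open>?z\<close> with \<open>q\<close> by the sum of \<open>S [i] x\<close> times
    \<open>q i\<close>, which is also the linear part of S at q; the two cancel.\<close>
  then have "pullback S g x = critical_value S_nonlin g_mset q ?z"
    unfolding pullback_def THE Let_def critical_value_def ev_S_nonlin(2)[OF q] taylor_eval_eq_ev(2)[OF y]
    by (simp add: taylor_eval_eq_ev(2)[OF y] ev_S_nonlin(2)[OF q] left_diff_distrib sum_subtractf)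
  moreover have "S_nonlin {#} = S [] x"
    using S_mset[of "[]"] by (simp add: S_nonlin_def)
  ultimately show "pullback S g x $ 0 = S [] x"
    "pullback S g x $ Suc k = (\<Sum>n\<le>k. white_rooted S_nonlin g_mset n k {#} / (fact n * fact (Suc k)))"
    using critical_value_nth_0[OF crit] critical_value_tree_expansion(2)[of S_nonlin, OF S_nonlin_single crit] by simp_all
qed

lemma pullback_nth_eq_tree_sum:
  "pullback S g x $ k = (\<Sum>t | t \<in> white_leaf_trees \<and> num_white t = k.
     tree_pairing S g t x / (fact (num_white t) * fact (num_black t)))"
proof (cases k)
  case 0
  let ?t = "\<lparr>num_black = 1, num_white = 0, edges = {#}\<rparr>"
  have "{t \<in> white_leaf_trees. num_white t = 0} = {?t}"
  proof (intro equalityI subsetI)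
    fix t assume "t \<in> {t \<in> white_leaf_trees. num_white t = 0}"
    then have "white_leaf_tree (vertices (num_black t) 0) (edge_set t)" "num_white t = 0"
      by (auto simp: white_leaf_trees_iff)
    then show "t \<in> {?t}" unfolding white_leaf_tree_0_iff by (auto intro: bigraph.equality)
  next
    fix t assume "t \<in> {?t}"
    then show "t \<in> {t \<in> white_leaf_trees. num_white t = 0}"
      using white_leaf_tree_0_iff[of 1 "{}"] by (simp add: white_leaf_trees_iff simple_graph_def)
  qed
  moreover have "tree_pairing S g ?t x = S [] x"
  proof -
    have "incident_edges ?t v = {#}" for v by (simp add: incident_edges_def)
    then have "edge_list ?t v = []" "degree ?t v = 0" for v
      using edge_list[of ?t v] by (simp_all add: degree_def)
    then show ?thesis by (simp add: tree_pairing_def black_def white_def)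
  qed
  ultimately show ?thesis using 0 by (simp add: pullback_nth)
next
  case (Suc l)
  let ?A = "{t \<in> white_leaf_trees. num_white t = Suc l}"
  have "(\<Sum>t\<in>?A. tree_pairing S g t x / (fact (num_white t) * fact (num_black t))) =
      (\<Sum>n\<le>l. \<Sum>t | t \<in> ?A \<and> num_black t = n. tree_pairing S g t x / (fact (num_white t) * fact (num_black t)))"
    using num_black_le_num_white by (intro sum.group[symmetric] finite_white_leaf_trees) auto
  also have "\<dots> = (\<Sum>n\<le>l. (\<Sum>t | t \<in> white_leaf_trees \<and> num_black t = n \<and> num_white t = Suc l.
      tree_pairing S g t x) / (fact n * fact (Suc l)))"
    unfolding sum_divide_distrib by (intro sum.cong refl) (auto simp: mult.commute)
  also have "\<dots> = pullback S g x $ Suc l"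
    by (simp only: sum_white_leaf_trees_fixed_size pullback_nth)
  finally show ?thesis using Suc by simp
qed

lemma tree_pairing_iso:
  assumes "(t, t') \<in> tree_iso"
  shows "tree_pairing S g t x = tree_pairing S g t' x" "num_black t = num_black t'" "num_white t = num_white t'"
proof -
  obtain p q where pq: "graph_iso t t' (p, q)" and t: "t \<in> white_leaf_trees" "t' \<in> white_leaf_trees"
    using assms by (auto simp: tree_iso_def)
  then show n: "num_black t = num_black t'" "num_white t = num_white t'" by (auto simp: graph_iso_def)
  have perm: "p permutes black t" "q permutes white t" and e: "edges t' = image_mset (map_prod p q) (edges t)"
    using pq by (auto simp: graph_iso_def)
  have bt: "bipartite_tree t" "bipartite_tree t'" using t by (simp_all add: white_leaf_trees_def)
  then have E: "edge_set t \<subseteq> bip (verts t)" by (auto simp: bipartite_tree_iff is_tree_def)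
  have "edge_set t' = map_prod (glue p q) (glue p q) ` edge_set t"
    using glue(4)[OF perm E] e by simp
  then have "tree_pairing S g t' x = graph_weight S_mset g_mset (glue p q ` verts t)
      (map_prod (glue p q) (glue p q) ` edge_set t) (\<lambda>_. {#})"
    using tree_pairing_eq_graph_weight[OF bt(2)] n glue(3)[OF perm] by simp
  also have "\<dots> = graph_weight S_mset g_mset (verts t) (edge_set t) ((\<lambda>_. {#}) \<circ> glue p q)"
    using glue(1,2)[OF perm] E by (intro graph_weight_image) simp_all
  finally show "tree_pairing S g t x = tree_pairing S g t' x"
    using tree_pairing_eq_graph_weight[OF bt(1)] by (simp add: comp_def)
qed

lemma tree_iso_class:
  assumes "C \<in> white_leaf_trees // tree_iso" "r \<in> C"
  shows "tree_iso `` {r} = C" "r \<in> white_leaf_trees"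
proof -
  obtain s where s: "C = tree_iso `` {s}" using assms(1) by (elim quotientE)
  then have "(s, r) \<in> tree_iso" using assms(2) by simp
  then show "r \<in> white_leaf_trees" by (simp add: tree_iso_def)
  show "tree_iso `` {r} = C"
    unfolding s by (rule equiv_class_eq[OF equiv_tree_iso \<open>(s, r) \<in> tree_iso\<close>, symmetric])
qed

text \<open>All trees of a class contribute equally, and by orbit-stabilizer the size of the class
  turns the factorials into the order of the automorphism group.\<close>

lemma sum_iso_class:
  assumes C: "C \<in> white_leaf_trees // tree_iso" and r: "r \<in> C"
  shows "(\<Sum>t\<in>C. tree_pairing S g t x / (fact (num_white t) * fact (num_black t))) =
    tree_pairing S g r x / card (automorphisms r)"
proof -
  note CR = tree_iso_class(1)[OF C r, symmetric] and rW = tree_iso_class(2)[OF C r]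
  have "(\<Sum>t\<in>C. tree_pairing S g t x / (fact (num_white t) * fact (num_black t))) =
      (\<Sum>t\<in>C. tree_pairing S g r x / (fact (num_white r) * fact (num_black r)))"
    using tree_pairing_iso[of r] CR by (intro sum.cong refl) auto
  also have "\<dots> = real (card C) * (tree_pairing S g r x / (fact (num_white r) * fact (num_black r)))"
    by simp
  also have "fact (num_white r) * fact (num_black r) = real (card C) * real (card (automorphisms r))"
  proof -
    have "real (card C * card (automorphisms r)) = real (fact (num_black r) * fact (num_white r))"
      using card_iso_class(1)[OF rW] CR by simp
    then show ?thesis by simp
  qed
  also have "real (card C) * (tree_pairing S g r x / (real (card C) * real (card (automorphisms r)))) =
      tree_pairing S g r x / card (automorphisms r)"
    using card_iso_class(2)[OF rW] CR r by (auto simp: card_eq_0_iff)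
  finally show ?thesis .
qed

lemma class_num_white:
  assumes "C \<in> white_leaf_trees // tree_iso" "r \<in> C" "t \<in> C"
  shows "num_white t = num_white r"
proof -
  have "t \<in> tree_iso `` {r}" using assms(3) by (simp only: tree_iso_class(1)[OF assms(1,2)])
  then show ?thesis using tree_pairing_iso(3)[of r t] by simp
qed

text \<open>The finite sum over trees is grouped by class. Any choice of representatives will do
  because the number of white vertices is constant on a class.\<close>

lemma pullback_nth_eq_class_sum:
  assumes rep: "\<And>C. C \<in> white_leaf_trees // tree_iso \<Longrightarrow> rep C \<in> C"
  shows "finite {C \<in> white_leaf_trees // tree_iso. num_white (rep C) = k}"
    and "pullback S g x $ k = (\<Sum>C | C \<in> white_leaf_trees // tree_iso \<and> num_white (rep C) = k.
     tree_pairing S g (rep C) x / card (automorphisms (rep C)))"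
proof -
  let ?A = "{t \<in> white_leaf_trees. num_white t = k}"
  let ?Q = "{C \<in> white_leaf_trees // tree_iso. num_white (rep C) = k}"
  let ?cls = "\<lambda>t. tree_iso `` {t}"
  have cls_in: "?cls t \<in> ?Q" if "t \<in> ?A" for t
  proof -
    have Q: "?cls t \<in> white_leaf_trees // tree_iso" "t \<in> ?cls t"
      using that equiv_class_self[OF equiv_tree_iso, of t] by (simp_all add: quotientI)
    then show ?thesis using class_num_white[OF Q(1) rep[OF Q(1)] Q(2)] that by simp
  qed
  have fibre: "{t \<in> ?A. ?cls t = C} = C" if "C \<in> ?Q" for C
  proof -
    have C: "C \<in> white_leaf_trees // tree_iso" "num_white (rep C) = k" using that by auto
    have "t \<in> ?A \<and> ?cls t = C" if "t \<in> C" for t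
      using tree_iso_class[OF C(1) that] class_num_white[OF C(1) rep[OF C(1)] that] C(2) by simp
    moreover have "t \<in> C" if "t \<in> ?A" "?cls t = C" for t
    proof -
      have "t \<in> ?cls t" using that(1) equiv_class_self[OF equiv_tree_iso, of t] by simp
      then show ?thesis using that(2) by simp
    qed
    ultimately show ?thesis by blast
  qed
  have "?Q \<subseteq> ?cls ` ?A"
  proof
    fix C assume C: "C \<in> ?Q"
    then have "rep C \<in> {t \<in> ?A. ?cls t = C}" using fibre[OF C] rep by auto
    then show "C \<in> ?cls ` ?A" by blast
  qed
  then show fin: "finite ?Q"
    by (rule finite_subset) (intro finite_imageI finite_white_leaf_trees)
  have "pullback S g x $ k = (\<Sum>C\<in>?Q. \<Sum>t | t \<in> ?A \<and> ?cls t = C.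
      tree_pairing S g t x / (fact (num_white t) * fact (num_black t)))"
    unfolding pullback_nth_eq_tree_sum
    by (rule sum.group[OF finite_white_leaf_trees fin image_subsetI[OF cls_in], symmetric])
  also have "\<dots> = (\<Sum>C\<in>?Q. tree_pairing S g (rep C) x / card (automorphisms (rep C)))"
  proof (rule sum.cong[OF refl])
    fix C assume C: "C \<in> ?Q"
    then have CQ: "C \<in> white_leaf_trees // tree_iso" by simp
    show "(\<Sum>t | t \<in> ?A \<and> ?cls t = C. tree_pairing S g t x / (fact (num_white t) * fact (num_black t))) =
        tree_pairing S g (rep C) x / card (automorphisms (rep C))"
      unfolding fibre[OF C] by (rule sum_iso_class[OF CQ rep[OF CQ]])
  qed
  finally show "pullback S g x $ k = (\<Sum>C\<in>?Q. tree_pairing S g (rep C) x / card (automorphisms (rep C)))" .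
qed

end

theorem mainTheorem3:
  fixes U :: "(real^'m::finite) set" and V :: "(real^'n::finite) set"
    and S :: "('m, 'n) generating_function"
    and g :: "real^'n \<Rightarrow> real" and x :: "real^'m"
  assumes "thick_morphism U V S"
    and "smooth_on V g"
    and "x \<in> U"
  shows "(\<exists>!(q, y). pullback_equations S g x q y) \<and>
    ((\<lambda>t. fps_const (1 / (fact (num_white t) * fact (num_black t))) * tree_term S g t x)
       has_sum pullback S g x) white_leaf_trees \<and>
    (\<forall>rep. (\<forall>C \<in> white_leaf_trees // tree_iso. rep C \<in> C) \<longrightarrow>
      ((\<lambda>C. fps_const (1 / real (card (automorphisms (rep C)))) * tree_term S g (rep C) x)
         has_sum pullback S g x) (white_leaf_trees // tree_iso))"
proof (intro conjI allI impI)
  show "\<exists>!(q, y). pullback_equations S g x q y"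
    using assms by (rule pullback_equations_unique)
  \<comment> \<open>Only the finitely many trees with k white vertices reach coefficient k, so the
    formal sum can be checked degree by degree.\<close>
  have "((\<lambda>t. fps_const (tree_pairing S g t x / (fact (num_white t) * fact (num_black t))) *
      fps_X ^ num_white t) has_sum pullback S g x) white_leaf_trees"
    by (intro fps_has_sum_graded finite_white_leaf_trees pullback_nth_eq_tree_sum[OF assms])
  then show "((\<lambda>t. fps_const (1 / (fact (num_white t) * fact (num_black t))) * tree_term S g t x)
       has_sum pullback S g x) white_leaf_trees"
    by (simp add: tree_term_def mult.assoc[symmetric])
  fix rep assume rep: "\<forall>C \<in> white_leaf_trees // tree_iso. rep C \<in> C"
  then have "((\<lambda>C. fps_const (tree_pairing S g (rep C) x / card (automorphisms (rep C))) *
      fps_X ^ num_white (rep C)) has_sum pullback S g x) (white_leaf_trees // tree_iso)"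
    by (intro fps_has_sum_graded pullback_nth_eq_class_sum[OF assms]) auto
  then show "((\<lambda>C. fps_const (1 / real (card (automorphisms (rep C)))) * tree_term S g (rep C) x)
         has_sum pullback S g x) (white_leaf_trees // tree_iso)"
    by (simp add: tree_term_def mult.assoc[symmetric])
qed

end
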